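(* Let $p\ge1$ and $h$ be integers. Suppose $K\in\mathcal D_1$ is diagonalizable (over $\mathbf C$) and $f\in\mathcal F_{p,h}$. Suppose also that there exist integers $h_k$ and $\theta_k\in\Theta_{h_k}$ ($k=1,\dots,n$) such that $[\theta_j,\theta_k]=0$ for all $j,k$, and such that $\theta_jK^{2j-1}$ ($j=1,\dots,n$) are linearly independent. Then the system $$\Phi_{\sigma,x}=\big(\lambda^pf(L(\lambda))\big)_+\Big|_{\lambda=\lambda_\sigma}\Phi_\sigma\qquad(\sigma=1,\dots,r)$$ is an integrable Hamiltonian system in the Liouville sense, with Hamiltonian function $$H=\frac1{2\kappa m_1\cdots m_N}\,\mathrm{tr}\Big(\mathrm{Res}\,\lambda^pF(L(\lambda))\Big),$$ where $F$ is the matrix-valued polynomial with $F'(\tau)=f(\tau)$, $F(0)=0$.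
   Context: Algebraic setting. $W$ is a $2n\times 2n$ invertible antisymmetric real matrix. $G=\{A\in GL(2n,\mathbf C): A^TWA=W\}$ and $\mathfrak g=\{X\in gl(2n,\mathbf C): X^T=-WXW^{-1}\}$ is its Lie algebra. $\mathrm{pr}:G\to G/\{\pm I\}$ is the projection. $G_0$ is a finite subgroup of $G$ such that every $A\in G_0$ satisfies $\bar AA=\pm I$ (bar = entrywise complex conjugation); then $\mathrm{pr}(G_0)$ is Abelian. $\Omega_1,\dots,\Omega_N\in G_0$ are such that $\mathrm{pr}(\Omega_1),\dots,\mathrm{pr}(\Omega_N)$ generate $\mathrm{pr}(G_0)$, and $m_a$ is the order of $\mathrm{pr}(\Omega_a)$, so $\Omega_a^{m_a}=\pm I$. $m_0$ is the least common multiple of $m_1,\dots,m_N$. $\Sigma_0=\{\alpha=(\alpha_1,\dots,\alpha_N)\in\mathbf Z^N: 0\le\alpha_a<m_a\}$ and $\Omega^\alpha=\Omega_1^{\alpha_1}\cdots\Omega_N^{\alpha_N}$. $\omega:G_0\to S^1=\{z\in\mathbf C:|z|=1\}$ is a group homomorphism with $\omega(\pm I)=1$; $\omega_a=\omega(\Omega_a)$ and $\omega^\alpha=\omega_1^{\alpha_1}\cdots\omega_N^{\alpha_N}$. For an integer $k$, $\mathcal D_k=\{X\in\mathfrak g: \bar X=X,\ \Omega X\Omega^{-1}=\omega(\Omega)^kX\text{ for all }\Omega\in G_0\}$. For an integer $h$, $\Theta_h$ is the set of matrices $\theta=cg$ with $c\in S^1$, $g\in G_0$, such that $\bar\theta=\theta$,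 $\omega(g)=1$, $\theta^T=W\theta W^{-1}$, and $\Omega\theta\Omega^{-1}=\omega(\Omega)^h\theta$ for all $\Omega\in G_0$. For integers $p,h$, $\mathcal F_{p,h}$ is the set of matrix-valued polynomials $f(\tau)=\sum_{j=1}^s\theta f_{s-j}\tau^{j-1}$ with $s$ a positive integer, $\theta\in\Theta_h$, $f_{s-j}\in\mathbf R$, such that $f_{s-j}\neq0$ only when $j$ is even and $h+j\equiv p+1 \pmod{m_0}$. For a square matrix $X$, $f(X)=\sum_{j=1}^s f_{s-j}\theta X^{j-1}$; likewise $F(X)=\sum_{j=1}^s\frac1jf_{s-j}\theta X^j$. Lax matrix. $\lambda_1,\dots,\lambda_r$ are non-zero real numbers with $\lambda_1^2,\dots,\lambda_r^2$ distinct, $\kappa\neq0$ is a real constant, $\Phi_\sigma=(\phi_{1\sigma},\dots,\phi_{2n,\sigma})^T$ are real column vectors, and $$L(\lambda)=K+\kappa\sum_{\alpha\in\Sigma_0}\sum_{\sigma=1}^r\frac{\Omega^\alpha\Phi_\sigma\Phi_\sigma^T(\Omega^\alpha)^TW}{\lambda-\omega^\alpha\lambda_\sigma}.$$ For a series $N(\lambda)=\sum_{j\le m}N_j\lambda^j$ (expansion at $\lambda=\infty$), $N(\lambda)_+=\sum_{0\le j\le m}N_j\lambda^j$ and $\mathrm{Res}\,N(\lambda)=N_{-1}$. Hamiltonian structure. On $\mathbf R^{2n\times r}$ with coordinates $\phi_{j\sigma}$ the Poisson bracket is $\{f,g\}=\sum_{j,k=1}^{2n}\sum_{\sigma=1}^r(W^{-1})_{jk}\frac{\partial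 f}{\partial\phi_{j\sigma}}\frac{\partial g}{\partial\phi_{k\sigma}}$; the Hamiltonian system of $H$ is $\phi_{j\sigma,x}=\sum_{k}(W^{-1})_{jk}\partial H/\partial\phi_{k\sigma}$. It is Liouville integrable if there exist $nr$ conserved integrals (functions Poisson-commuting with $H$) that are pairwise in involution and functionally independent on a dense open subset of $\mathbf R^{2n\times r}$. *)

theory Defs
  imports
    "HOL-Analysis.Analysis"
    "HOL-Computational_Algebra.Polynomial"
    "HOL-Computational_Algebra.Formal_Laurent_Series"
    "HOL-Number_Theory.Cong"
    "HOL-Algebra.Coset"
    "HOL-Algebra.Generated_Groups"
    "HOL-Algebra.Multiplicative_Group"
begin

section \<open>Matrices\<close>

text \<open>The type-class operations \<open>*\<close>, \<open>1\<close> and \<open>^\<close> on \<open>vec\<close> are componentwise. The matrix product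
  is \<open>**\<close>, and \<open>mat c ** A\<close> is the scalar multiple of \<open>A\<close> by \<open>c\<close>.\<close>

primrec matpow :: "'a::semiring_1^'m^'m \<Rightarrow> nat \<Rightarrow> 'a^'m^'m" where
  "matpow A 0 = mat 1"
| "matpow A (Suc k) = matpow A k ** A"

definition cmat :: "real^'a^'b \<Rightarrow> complex^'a^'b" where
  "cmat A = map_matrix complex_of_real A"

definition cvec :: "real^'a \<Rightarrow> complex^'a" where
  "cvec v = (\<chi> i. complex_of_real (v $ i))"

definition conjmat :: "complex^'a^'b \<Rightarrow> complex^'a^'b" where
  "conjmat A = map_matrix cnj A"

definition diagonalizable :: "complex^'m^'m \<Rightarrow> bool" where
  "diagonalizable A \<longleftrightarrow> (\<exists>P D :: complex^'m^'m. invertible P \<and> (\<forall>i j. i \<noteq> j \<longrightarrow> D $ i $ j = 0)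
     \<and> A = P ** D ** matrix_inv P)"

section \<open>The group, its Lie algebra, and the symmetry classes\<close>

definition Sp_group :: "real^'m^'m \<Rightarrow> (complex^'m^'m) monoid" where
  "Sp_group W = \<lparr>carrier = {A. invertible A \<and> transpose A ** cmat W ** A = cmat W},
     mult = (**), one = mat 1\<rparr>"

definition lie_alg :: "real^'m^'m \<Rightarrow> (complex^'m^'m) set" where
  "lie_alg W = {X. transpose X = - (cmat W ** X ** matrix_inv (cmat W))}"

definition circle_group :: "complex monoid" where
  "circle_group = \<lparr>carrier = {z. cmod z = 1}, mult = (*), one = 1\<rparr>"

definition pmI :: "(complex^'m^'m) set" where
  "pmI = {mat 1, - mat 1}"

definition pr :: "real^'m^'m \<Rightarrow> complex^'m^'m \<Rightarrow> (complex^'m^'m) set" where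
  "pr W A = pmI #>\<^bsub>Sp_group W\<^esub> A"

definition ord_pr :: "real^'m^'m \<Rightarrow> (nat \<Rightarrow> complex^'m^'m) \<Rightarrow> nat \<Rightarrow> nat" where
  "ord_pr W \<Omega> a = group.ord (Sp_group W Mod pmI) (pr W (\<Omega> a))"

definition m0 :: "real^'m^'m \<Rightarrow> (nat \<Rightarrow> complex^'m^'m) \<Rightarrow> nat \<Rightarrow> nat" where
  "m0 W \<Omega> N = Lcm (ord_pr W \<Omega> ` {1..N})"

definition \<D> :: "real^'m^'m \<Rightarrow> (complex^'m^'m) set \<Rightarrow> (complex^'m^'m \<Rightarrow> complex) \<Rightarrow> int
    \<Rightarrow> (complex^'m^'m) set" where
  "\<D> W G\<^sub>0 \<omega> k = {X \<in> lie_alg W. conjmat X = X \<and>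
     (\<forall>A\<in>G\<^sub>0. A ** X ** matrix_inv A = mat (\<omega> A powi k) ** X)}"

definition \<Theta> :: "real^'m^'m \<Rightarrow> (complex^'m^'m) set \<Rightarrow> (complex^'m^'m \<Rightarrow> complex) \<Rightarrow> int
    \<Rightarrow> (complex^'m^'m) set" where
  "\<Theta> W G\<^sub>0 \<omega> h = {\<theta>. \<exists>c g. cmod c = 1 \<and> g \<in> G\<^sub>0 \<and> \<theta> = mat c ** g \<and>
     conjmat \<theta> = \<theta> \<and> \<omega> g = 1 \<and> transpose \<theta> = cmat W ** \<theta> ** matrix_inv (cmat W) \<and>
     (\<forall>A\<in>G\<^sub>0. A ** \<theta> ** matrix_inv A = mat (\<omega> A powi h) ** \<theta>)}"

section \<open>Matrix-valued polynomials\<close>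

text \<open>Only the additive structure of \<open>poly\<close> is used; the coefficients are matrices, and
  substituting a matrix puts the coefficients on the left of the powers.\<close>

definition \<F> :: "real^'m^'m \<Rightarrow> (complex^'m^'m) set \<Rightarrow> (complex^'m^'m \<Rightarrow> complex)
    \<Rightarrow> (nat \<Rightarrow> complex^'m^'m) \<Rightarrow> nat \<Rightarrow> nat \<Rightarrow> int \<Rightarrow> (complex^'m^'m) poly set" where
  "\<F> W G\<^sub>0 \<omega> \<Omega> N p h =
     {f. \<exists>(s::nat) \<theta> (c :: nat \<Rightarrow> real). 1 \<le> s \<and> \<theta> \<in> \<Theta> W G\<^sub>0 \<omega> h \<and>
        (\<forall>j\<in>{1..s}. c (s - j) \<noteq> 0 \<longrightarrow>
           even j \<and> [h + int j = int p + 1] (mod int (m0 W \<Omega> N))) \<and>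
        f = (\<Sum>j=1..s. Polynomial.monom (c (s - j) *\<^sub>R \<theta>) (j - 1))}"

definition mp_deriv :: "(complex^'m^'m) poly \<Rightarrow> (complex^'m^'m) poly" where
  "mp_deriv F = (\<Sum>i=1..degree F. Polynomial.monom (real i *\<^sub>R Polynomial.coeff F i) (i - 1))"

definition mp_eval :: "(complex^'m^'m) poly \<Rightarrow> (complex fls)^'m^'m \<Rightarrow> (complex fls)^'m^'m" where
  "mp_eval f X = (\<Sum>i\<le>degree f. map_matrix fls_const (Polynomial.coeff f i) ** matpow X i)"

section \<open>Expansions at infinity and the Lax matrix\<close>

text \<open>The formal variable \<open>fls_X\<close> stands for \<open>1/\<lambda>\<close>, so \<open>\<lambda>\<close> is \<open>fls_X_inv\<close> and the
  coefficient of \<open>\<lambda>\<^sup>j\<close> has index \<open>-j\<close>. The field \<open>complex fls\<close> contains the rational functions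
  of \<open>\<lambda>\<close> through their expansions at \<open>\<lambda> = \<infinity>\<close>.\<close>

definition lam_coeff :: "(complex fls)^'m^'m \<Rightarrow> int \<Rightarrow> complex^'m^'m" where
  "lam_coeff M j = map_matrix (\<lambda>g. fls_nth g (- j)) M"

definition Res :: "(complex fls)^'m^'m \<Rightarrow> complex^'m^'m" where
  "Res M = lam_coeff M (- 1)"

text \<open>The index set is finite, since every entry has only finitely many positive powers of \<open>\<lambda>\<close>.\<close>

definition plus_part_at :: "(complex fls)^'m^'m \<Rightarrow> complex \<Rightarrow> complex^'m^'m" where
  "plus_part_at M z =
     (\<Sum>j | lam_coeff M (int j) \<noteq> 0. mat (z ^ j) ** lam_coeff M (int j))"

definition \<Sigma>\<^sub>0 :: "real^'m^'m \<Rightarrow> (nat \<Rightarrow> complex^'m^'m) \<Rightarrow> nat \<Rightarrow> (nat \<Rightarrow> nat) set" where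
  "\<Sigma>\<^sub>0 W \<Omega> N = PiE {1..N} (\<lambda>a. {..<ord_pr W \<Omega> a})"

primrec Omega_pow :: "(nat \<Rightarrow> complex^'m^'m) \<Rightarrow> nat \<Rightarrow> (nat \<Rightarrow> nat) \<Rightarrow> complex^'m^'m" where
  "Omega_pow \<Omega> 0 \<alpha> = mat 1"
| "Omega_pow \<Omega> (Suc k) \<alpha> = Omega_pow \<Omega> k \<alpha> ** matpow (\<Omega> (Suc k)) (\<alpha> (Suc k))"

definition omega_pow :: "(complex^'m^'m \<Rightarrow> complex) \<Rightarrow> (nat \<Rightarrow> complex^'m^'m) \<Rightarrow> nat
    \<Rightarrow> (nat \<Rightarrow> nat) \<Rightarrow> complex" where
  "omega_pow \<omega> \<Omega> N \<alpha> = (\<Prod>a=1..N. \<omega> (\<Omega> a) ^ \<alpha> a)"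

definition Lax :: "real^'m^'m \<Rightarrow> (nat \<Rightarrow> complex^'m^'m) \<Rightarrow> nat \<Rightarrow> (complex^'m^'m \<Rightarrow> complex)
    \<Rightarrow> complex^'m^'m \<Rightarrow> real \<Rightarrow> ('r \<Rightarrow> real) \<Rightarrow> real^'m^'r::finite \<Rightarrow> (complex fls)^'m^'m" where
  "Lax W \<Omega> N \<omega> K \<kappa> l \<Phi> =
     map_matrix fls_const K + mat (fls_const (complex_of_real \<kappa>)) **
       (\<Sum>\<alpha>\<in>\<Sigma>\<^sub>0 W \<Omega> N. \<Sum>\<sigma>\<in>UNIV.
          mat (1 / (fls_X_inv - fls_const (omega_pow \<omega> \<Omega> N \<alpha> * complex_of_real (l \<sigma>)))) **
          map_matrix fls_const
            (Omega_pow \<Omega> N \<alpha> ** (columnvector (cvec (\<Phi> $ \<sigma>)) :: complex^1^'m)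
               ** rowvector (cvec (\<Phi> $ \<sigma>)) ** transpose (Omega_pow \<Omega> N \<alpha>) ** cmat W))"

section \<open>Hamiltonian structure\<close>

text \<open>A point \<open>\<Phi> :: real^'m^'r\<close> of phase space has coordinates \<open>\<phi>\<^bsub>j\<sigma>\<^esub> = \<Phi> $ \<sigma> $ j\<close>.\<close>

definition pd :: "'r \<Rightarrow> 'm \<Rightarrow> (real^'m^'r::finite \<Rightarrow> real) \<Rightarrow> real^'m^'r \<Rightarrow> real" where
  "pd \<sigma> j f \<Phi> = deriv (\<lambda>t. f (\<Phi> + t *\<^sub>R axis \<sigma> (axis j 1))) 0"

primrec iter_pd :: "('r \<times> 'm) list \<Rightarrow> (real^'m^'r::finite \<Rightarrow> real) \<Rightarrow> real^'m^'r \<Rightarrow> real" where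
  "iter_pd [] f = f"
| "iter_pd (d # ds) f = pd (fst d) (snd d) (iter_pd ds f)"

text \<open>Differentiability of all iterated partial derivatives is the class \<open>C\<^sup>\<infinity>\<close>.\<close>

definition smooth :: "(real^'m^'r::finite \<Rightarrow> real) \<Rightarrow> bool" where
  "smooth f \<longleftrightarrow> (\<forall>ds. iter_pd ds f differentiable_on UNIV)"

definition poisson :: "real^'m^'m \<Rightarrow> (real^'m^'r::finite \<Rightarrow> real) \<Rightarrow> (real^'m^'r \<Rightarrow> real)
    \<Rightarrow> real^'m^'r \<Rightarrow> real" where
  "poisson W f g \<Phi> =
     (\<Sum>j\<in>UNIV. \<Sum>k\<in>UNIV. \<Sum>\<sigma>\<in>UNIV. matrix_inv W $ j $ k * pd \<sigma> j f \<Phi> * pd \<sigma> k g \<Phi>)"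

definition ham_field :: "real^'m^'m \<Rightarrow> (real^'m^'r::finite \<Rightarrow> real) \<Rightarrow> real^'m^'r \<Rightarrow> real^'m^'r" where
  "ham_field W H \<Phi> = (\<chi> \<sigma> j. \<Sum>k\<in>UNIV. matrix_inv W $ j $ k * pd \<sigma> k H \<Phi>)"

definition gradient :: "(real^'m^'r::finite \<Rightarrow> real) \<Rightarrow> real^'m^'r \<Rightarrow> real^'m^'r" where
  "gradient f \<Phi> = (\<chi> \<sigma> j. pd \<sigma> j f \<Phi>)"

definition functionally_independent_at ::
    "nat \<Rightarrow> (nat \<Rightarrow> real^'m^'r::finite \<Rightarrow> real) \<Rightarrow> real^'m^'r \<Rightarrow> bool" where
  "functionally_independent_at d E \<Phi> \<longleftrightarrow>
     (\<forall>c :: nat \<Rightarrow> real. (\<Sum>i<d. c i *\<^sub>R gradient (E i) \<Phi>) = 0 \<longrightarrow> (\<forall>i<d. c i = 0))"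

text \<open>Phase space has dimension \<open>2d\<close> with \<open>d = CARD('m) * CARD('r) div 2\<close>.\<close>

definition liouville_integrable :: "real^'m^'m \<Rightarrow> (real^'m^'r::finite \<Rightarrow> real) \<Rightarrow> bool" where
  "liouville_integrable W H \<longleftrightarrow> smooth H \<and>
     (let d = CARD('m) * CARD('r) div 2 in
      \<exists>E :: nat \<Rightarrow> real^'m^'r \<Rightarrow> real.
        (\<forall>i<d. smooth (E i)) \<and>
        (\<forall>i<d. \<forall>\<Phi>. poisson W (E i) H \<Phi> = 0) \<and>
        (\<forall>i<d. \<forall>j<d. \<forall>\<Phi>. poisson W (E i) (E j) \<Phi> = 0) \<and>
        (\<exists>U. open U \<and> closure U = UNIV \<and>
           (\<forall>\<Phi>\<in>U. functionally_independent_at d E \<Phi>)))"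

end

(* With P(u) = u u^T W and kap = kappa m_1...m_N / |G0| the Lax matrix expands at infinity, in
   powers of X = 1/lambda, as
     L = K + kap * SUM_q X^(q+1) SUM_{g in G0, sigma} (omega(g) lambda_sigma)^q g P(Phi_sigma) g^-1,
   so that A L(lambda) A^-1 = omega(A) L(omega(A) lambda).  Elements of Theta_h commute with L, and
   M = f(L) satisfies A M_i A^-1 = omega(A)^(p-i) M_i; hence every g in G0 contributes equally to
   dH = (1/2) SUM_sigma tr(M_+(lambda_sigma) dP(Phi_sigma)), where M_+ = (lambda^p M)_+, and this
   gives the Hamiltonian vector field.  Along that field lambda^p dL is the commutator of a
   truncation of M with L, which makes all tr(theta L^k) constant, so all functions of this shape
   are in involution.  As integrals take the coefficients of tr(theta_k L^(2k)), k = 1..n, at r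
   residue-compatible powers of lambda.  Near Phi = 0 their gradients are, to leading order,
   lambda_sigma^q W theta_k K^(2k-1) Phi_sigma.  The matrices theta_k (with theta_k^2 = +-1) and K
   have a common eigenbasis, so a generic real Phi_sigma separates the theta_k K^(2k-1), and a
   Vandermonde argument in lambda_sigma^(m_0) separates the powers.  The Gram determinant of the
   gradients is therefore a non-zero polynomial. *)

theory Submission
  imports Defs
begin

subsection \<open>Matrices over commutative rings\<close>

text \<open>The Lax matrix is indexed by exponent tuples, and alpha |-> pr(Omega^alpha) need not be
  injective. The proof therefore passes to a sum over all of \<open>G\<^sub>0\<close>: the summands
  do not see the sign of a group element, left multiplication by a generator shifts one exponent
  cyclically, and averaging over translates produces the factor in kap. A sum over the group can be
  reindexed, and both the covariance of L and the reality of its coefficients are such reindexings;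
  for reality, the condition on the entrywise conjugate turns conjugation by g into conjugation by
  the inverse of g. The gradients of the integrals vanish at Phi = 0, so their leading order cannot
  be read off there. On a ray t Phi0 the gradient is exactly t w(t Phi0) with w polynomial; the w
  are independent at 0, hence also for small t > 0, and one such point suffices for density. For
  fixed k the admissible powers of lambda form a residue class modulo m_0, and its first r members
  give n r integrals in all. Distinctness of the squares lambda_sigma^2 is what separates the
  lambda_sigma^(m_0) when m_0 is even.\<close>

lemma mat_mult_nth [simp]: "(mat c ** A) $ i $ j = c * A $ i $ j" for A :: "'a::semiring_1^'n^'m"
  by (simp add: matrix_matrix_mult_def mat_def if_distrib if_distribR sum.delta cong: if_cong)

lemma mat_mult_assoc': "A ** (mat c ** B) = mat c ** (A ** B)" for A :: "'a::comm_semiring_1^'n^'m"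
  by (simp add: vec_eq_iff matrix_matrix_mult_def sum_distrib_left algebra_simps mat_def if_distrib if_distribR sum.delta cong: if_cong)

lemma mat_mult_mat [simp]: "mat c ** mat d = (mat (c * d) :: 'a::semiring_1^'n^'n)"
  by (simp add: vec_eq_iff) (simp add: mat_def)

lemma mat_mult_mat_left [simp]: "mat c ** (mat d ** A) = mat (c * d) ** A" for A :: "'a::semiring_1^'n^'m"
  by (simp add: vec_eq_iff mult.assoc)

lemma mat_vector_mult_nth [simp]: "(mat c *v x) $ i = c * x $ i" for x :: "'a::semiring_1^'m"
  by (simp add: matrix_vector_mult_def mat_def if_distrib if_distribR sum.delta cong: if_cong)

lemma matrix_mult_nth: "(A ** B) $ i $ j = (\<Sum>k\<in>UNIV. A $ i $ k * B $ k $ j)"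
  by (simp add: matrix_matrix_mult_def)

lemma matrix_mult_zero_left [simp]: "0 ** A = 0" for A :: "'a::semiring_1^'n^'m"
  by (simp add: vec_eq_iff matrix_mult_nth)

lemma matrix_mult_zero_right [simp]: "A ** 0 = 0" for A :: "'a::semiring_1^'n^'m"
  by (simp add: vec_eq_iff matrix_mult_nth)

lemma matrix_mult_minus_left [simp]: "(- A) ** B = - (A ** B)" for A :: "'a::ring_1^'n^'m"
  by (simp add: vec_eq_iff matrix_mult_nth sum_negf)

lemma matrix_mult_minus_right [simp]: "A ** (- B) = - (A ** B)" for A :: "'a::ring_1^'n^'m"
  by (simp add: vec_eq_iff matrix_mult_nth sum_negf)

lemma matrix_diff_ldistrib: "A ** (B - C) = A ** B - A ** C" for A :: "'a::ring_1^'n^'m"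
  by (simp add: vec_eq_iff matrix_mult_nth sum_subtractf algebra_simps)

lemma matrix_diff_rdistrib: "(A - B) ** C = A ** C - B ** C" for A :: "'a::ring_1^'n^'m"
  by (simp add: vec_eq_iff matrix_mult_nth sum_subtractf algebra_simps)

lemma matrix_add_rdistrib': "(A + B) ** C = A ** C + B ** C" for A :: "'a::semiring_1^'n^'m"
  by (simp add: vec_eq_iff matrix_mult_nth sum.distrib algebra_simps)

lemma matrix_sum_ldistrib: "A ** (\<Sum>i\<in>I. f i) = (\<Sum>i\<in>I. A ** f i)" for A :: "'a::semiring_1^'n^'m"
  by (induction I rule: infinite_finite_induct) (simp_all add: matrix_add_ldistrib)

lemma matrix_sum_rdistrib: "(\<Sum>i\<in>I. f i) ** A = (\<Sum>i\<in>I. f i ** A)" for A :: "'a::semiring_1^'n^'m"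
  by (induction I rule: infinite_finite_induct) (simp_all add: matrix_add_rdistrib')

lemma matrix_vector_sum_rdistrib: "(\<Sum>i\<in>I. f i) *v x = (\<Sum>i\<in>I. f i *v x)"
  for x :: "'a::semiring_1^'n"
  by (induction I rule: infinite_finite_induct) (simp_all add: matrix_vector_mult_add_rdistrib)

lemma transpose_sum: "transpose (\<Sum>i\<in>I. f i) = (\<Sum>i\<in>I. transpose (f i))"
  by (simp add: vec_eq_iff transpose_def)

lemma transpose_minus: "transpose (- A) = - transpose A"
  by (simp add: vec_eq_iff transpose_def)

lemma transpose_mat_mult: "transpose (mat c ** A) = mat c ** transpose A"
  for A :: "'a::semiring_1^'n^'n"
  by (simp add: vec_eq_iff transpose_def)

lemma trace_sum: "trace (\<Sum>i\<in>I. f i) = (\<Sum>i\<in>I. trace (f i :: 'a::comm_semiring_1^'n^'n))"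
  by (induction I rule: infinite_finite_induct) (simp_all add: trace_add, simp_all add: trace_def)

lemma trace_mat_mult: "trace (mat c ** A) = c * trace A" for A :: "'a::semiring_1^'n^'n"
  by (simp add: trace_def sum_distrib_left)

lemma trace_zero [simp]: "trace 0 = 0"
  by (simp add: trace_def)

lemma matpow_commute: "A ** B = B ** A \<Longrightarrow> matpow A k ** B = B ** matpow A k"
  by (induction k) (simp_all, metis matrix_mul_assoc)

lemma matpow_Suc_left: "matpow A (Suc k) = A ** matpow A k"
  by (simp add: matpow_commute)

lemma matpow_add: "matpow A (i + j) = matpow A i ** matpow A j"
  by (induction j) (simp_all add: matrix_mul_assoc)

lemma matrix_inv_left: "invertible A \<Longrightarrow> matrix_inv A ** A = mat 1"
  and matrix_inv_right: "invertible A \<Longrightarrow> A ** matrix_inv A = mat 1"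
  unfolding matrix_inv_def invertible_def by (metis (mono_tags, lifting) someI_ex)+

lemma matrix_inv_unique: "A ** B = mat 1 \<Longrightarrow> B ** A = mat 1 \<Longrightarrow> matrix_inv A = B"
  by (metis invertible_def matrix_inv_left matrix_mul_assoc matrix_mul_lid matrix_mul_rid)

lemma matrix_left_cancel: "invertible A \<Longrightarrow> A ** B = A ** C \<longleftrightarrow> B = C"
  by (metis matrix_inv_left matrix_mul_assoc matrix_mul_lid)

lemma matrix_right_cancel: "invertible A \<Longrightarrow> B ** A = C ** A \<longleftrightarrow> B = C"
  by (metis matrix_inv_right matrix_mul_assoc matrix_mul_rid)

lemma map_matrix_mult:
  assumes "\<And>x y. f (x + y) = f x + f y" "\<And>x y. f (x * y) = f x * f y" "f 0 = 0"
  shows "map_matrix f (A ** B) = map_matrix f A ** map_matrix f B"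
proof -
  have *: "f (sum g I) = (\<Sum>i\<in>I. f (g i))" for g :: "_ \<Rightarrow> _" and I
    using assms by (induction I rule: infinite_finite_induct) auto
  show ?thesis by (simp add: vec_eq_iff matrix_mult_nth assms *)
qed

lemma cmat_mult: "cmat (A ** B) = cmat A ** cmat B"
  unfolding cmat_def by (rule map_matrix_mult) auto

lemma cmat_mat [simp]: "cmat (mat c) = mat (complex_of_real c)"
  by (simp add: vec_eq_iff cmat_def mat_def)

lemma cmat_nth [simp]: "cmat A $ i $ j = complex_of_real (A $ i $ j)"
  by (simp add: cmat_def)

lemma cvec_nth [simp]: "cvec v $ i = complex_of_real (v $ i)"
  by (simp add: cvec_def)

lemma invertible_cmat: "invertible A \<Longrightarrow> invertible (cmat A)"
  by (metis cmat_mult cmat_mat invertible_def of_real_1)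

lemma matrix_inv_cmat: "invertible A \<Longrightarrow> matrix_inv (cmat A) = cmat (matrix_inv A)"
  by (rule matrix_inv_unique)
    (metis cmat_mult cmat_mat matrix_inv_left matrix_inv_right of_real_1)+

lemma conjmat_nth [simp]: "conjmat A $ i $ j = cnj (A $ i $ j)"
  by (simp add: conjmat_def)

lemma conjmat_mult: "conjmat (A ** B) = conjmat A ** conjmat B"
  unfolding conjmat_def by (rule map_matrix_mult) auto

lemma conjmat_sum: "conjmat (\<Sum>i\<in>I. f i) = (\<Sum>i\<in>I. conjmat (f i))"
  by (simp add: vec_eq_iff)

lemma conjmat_mat [simp]: "conjmat (mat c) = mat (cnj c)"
  by (simp add: vec_eq_iff mat_def)

lemma conjmat_cmat [simp]: "conjmat (cmat A) = cmat A"
  by (simp add: vec_eq_iff)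

section \<open>Rank-one matrices\<close>

definition outer :: "'a::times^'m \<Rightarrow> 'a^'m \<Rightarrow> 'a^'m^'m" where
  "outer u v = (\<chi> i j. u $ i * v $ j)"

lemma outer_nth [simp]: "outer u v $ i $ j = u $ i * v $ j"
  by (simp add: outer_def)

lemma matrix_mult_outer: "A ** outer u v = outer (A *v u) v" for A :: "'a::comm_semiring_1^'m^'m"
  by (simp add: vec_eq_iff matrix_mult_nth matrix_vector_mult_def sum_distrib_left sum_distrib_right ac_simps)

lemma outer_mult_matrix: "outer u v ** A = outer u (transpose A *v v)" for A :: "'a::comm_semiring_1^'m^'m"
  by (simp add: vec_eq_iff matrix_mult_nth matrix_vector_mult_def transpose_def sum_distrib_left ac_simps)

lemma trace_outer: "trace (outer u v) = (\<Sum>i\<in>UNIV. v $ i * u $ i)" for u :: "'a::comm_semiring_1^'m"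
  by (simp add: trace_def mult.commute)

lemma transpose_outer: "transpose (outer u v) = outer v u" for u :: "'a::comm_semiring_1^'m"
  by (simp add: vec_eq_iff transpose_def mult.commute)

lemma columnvector_mult_rowvector: "(columnvector u :: 'a::semiring_1^1^'m) ** rowvector v = outer u v"
  by (simp add: vec_eq_iff matrix_mult_nth columnvector_def rowvector_def)

subsection \<open>Matrices of formal power series\<close>

text \<open>A series type over \<open>vec\<close> would multiply coefficients componentwise, so
  series with matrix coefficients are represented as matrices of series. The series variable stands
  for 1/lambda.\<close>

definition mcoeff :: "('a fps)^'m^'n \<Rightarrow> nat \<Rightarrow> 'a^'m^'n" where
  "mcoeff M n = map_matrix (\<lambda>g. fps_nth g n) M"

definition mfps :: "(nat \<Rightarrow> 'a^'m^'n) \<Rightarrow> ('a fps)^'m^'n" where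
  "mfps a = (\<chi> i j. Abs_fps (\<lambda>n. a n $ i $ j))"

abbreviation mconst :: "'a::zero^'m^'n \<Rightarrow> ('a fps)^'m^'n" where
  "mconst A \<equiv> map_matrix fps_const A"

lemma mcoeff_nth [simp]: "mcoeff M n $ i $ j = fps_nth (M $ i $ j) n"
  by (simp add: mcoeff_def)

lemma mcoeff_mfps [simp]: "mcoeff (mfps a) n = a n"
  by (simp add: vec_eq_iff mfps_def)

lemma mcoeff_eqI: "(\<And>n. mcoeff M n = mcoeff N n) \<Longrightarrow> M = N"
  by (auto simp add: vec_eq_iff fps_eq_iff)

lemma mcoeff_add: "mcoeff (M + N) n = mcoeff M n + mcoeff N n"
  by (simp add: vec_eq_iff)

lemma mcoeff_diff: "mcoeff (M - N) n = mcoeff M n - mcoeff N n" for M :: "('a::group_add fps)^'m^'n"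
  by (simp add: vec_eq_iff)

lemma mcoeff_uminus: "mcoeff (- M) n = - mcoeff M n" for M :: "('a::group_add fps)^'m^'n"
  by (simp add: vec_eq_iff)

lemma mcoeff_zero [simp]: "mcoeff 0 n = 0"
  by (simp add: vec_eq_iff)

lemma mcoeff_sum: "mcoeff (\<Sum>i\<in>I. f i) n = (\<Sum>i\<in>I. mcoeff (f i) n)"
  by (induction I rule: infinite_finite_induct) (simp_all add: mcoeff_add)

lemma mcoeff_mult: "mcoeff (M ** N) n = (\<Sum>i\<le>n. mcoeff M i ** mcoeff N (n - i))" for M :: "('a::semiring_1 fps)^'m^'n"
proof -
  have "mcoeff (M ** N) n $ a $ b = (\<Sum>i\<le>n. mcoeff M i ** mcoeff N (n - i)) $ a $ b" for a b
    by (simp add: matrix_mult_nth fps_sum_nth fps_mult_nth atMost_atLeast0 sum.swap[of _ UNIV])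
  then show ?thesis by (simp add: vec_eq_iff)
qed

lemma mcoeff_mconst: "mcoeff (mconst A) n = (if n = 0 then A else 0)"
  by (simp add: vec_eq_iff)

lemma mcoeff_mconst_mult: "mcoeff (mconst A ** M) n = A ** mcoeff M n" for M :: "('a::semiring_1 fps)^'m^'n"
proof -
  have "mcoeff (mconst A ** M) n = (\<Sum>i\<le>n. if i = 0 then A ** mcoeff M n else 0)"
    unfolding mcoeff_mult mcoeff_mconst by (rule sum.cong) auto
  also have "\<dots> = A ** mcoeff M n" by simp
  finally show ?thesis .
qed

lemma mcoeff_mult_mconst: "mcoeff (M ** mconst A) n = mcoeff M n ** A" for M :: "('a::semiring_1 fps)^'m^'n"
proof -
  have "mcoeff (M ** mconst A) n = (\<Sum>i\<le>n. if i = n then mcoeff M n ** A else 0)"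
    unfolding mcoeff_mult mcoeff_mconst by (rule sum.cong) auto
  also have "\<dots> = mcoeff M n ** A" by simp
  finally show ?thesis .
qed

lemma mcoeff_mat: "mcoeff (mat c) n = mat (fps_nth c n)"
  by (simp add: vec_eq_iff mat_def)

lemma mat_fps_const: "mat (fps_const c) = mconst (mat c)"
  by (simp add: vec_eq_iff mat_def)

lemma mcoeff_const_mult: "mcoeff (mat (fps_const c) ** M) n = mat c ** mcoeff M n" for M :: "('a::semiring_1 fps)^'m^'n"
  by (simp add: mat_fps_const mcoeff_mconst_mult)

lemma mcoeff_transpose: "mcoeff (transpose M) n = transpose (mcoeff M n)"
  by (simp add: vec_eq_iff transpose_def)

lemma fps_nth_trace: "fps_nth (trace M) n = trace (mcoeff M n)"
  by (simp add: trace_def fps_sum_nth)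

lemma mconst_commute_iff:
  "mconst A ** M = M ** mconst A \<longleftrightarrow> (\<forall>n. A ** mcoeff M n = mcoeff M n ** A)"
  for M :: "('a::semiring_1 fps)^'m^'m"
  by (metis mcoeff_eqI mcoeff_mconst_mult mcoeff_mult_mconst)

subsection \<open>Polynomial functions on phase space\<close>

text \<open>The second conjunct closes the class under partial derivatives, so that smoothness of
  every order follows by iteration.\<close>

lemma real_polynomial_function_has_derivative:
  "real_polynomial_function f \<Longrightarrow>
     \<exists>f'. (\<forall>x. (f has_derivative f' x) (at x)) \<and> (\<forall>v. real_polynomial_function (\<lambda>x. f' x v))"
proof (induction f rule: real_polynomial_function.induct)
  case (linear f)
  then show ?case
    by (intro exI[of _ "\<lambda>x. f"]) (auto simp: bounded_linear_imp_has_derivative)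
next
  case (const c)
  show ?case by (intro exI[of _ "\<lambda>x v. 0"]) auto
next
  case (add f g)
  then obtain f' g' where
    "\<forall>x. (f has_derivative f' x) (at x)" "\<forall>v. real_polynomial_function (\<lambda>x. f' x v)"
    "\<forall>x. (g has_derivative g' x) (at x)" "\<forall>v. real_polynomial_function (\<lambda>x. g' x v)" by blast
  then show ?case
    by (intro exI[of _ "\<lambda>x v. f' x v + g' x v"]) (auto intro!: has_derivative_add)
next
  case (mult f g)
  then obtain f' g' where
    "\<forall>x. (f has_derivative f' x) (at x)" "\<forall>v. real_polynomial_function (\<lambda>x. f' x v)"
    "\<forall>x. (g has_derivative g' x) (at x)" "\<forall>v. real_polynomial_function (\<lambda>x. g' x v)" by blast
  with mult.hyps show ?case
    by (intro exI[of _ "\<lambda>x v. f x * g' x v + f' x v * g x"]) (auto intro!: has_derivative_mult real_polynomial_function.intros(3,4))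
qed

lemma has_real_derivative_along_line:
  fixes f :: "'a::real_normed_vector \<Rightarrow> real"
  assumes "(f has_derivative D) (at x)"
  shows "((\<lambda>t. f (x + t *\<^sub>R v)) has_real_derivative D v) (at 0)"
proof -
  have "((\<lambda>t. x + t *\<^sub>R v) has_derivative (\<lambda>t. t *\<^sub>R v)) (at 0)"
    by (auto intro!: derivative_eq_intros)
  from has_derivative_compose[OF this, of f D] assms
  have "((\<lambda>t. f (x + t *\<^sub>R v)) has_derivative (\<lambda>t. D (t *\<^sub>R v))) (at 0)" by simp
  moreover have "D (t *\<^sub>R v) = D v * t" for t
    using linear_scale[OF has_derivative_linear[OF assms]] by simp
  ultimately show ?thesis by (simp add: has_field_derivative_def)
qed

lemma pd_eqI:
  "((\<lambda>t. f (\<Phi> + t *\<^sub>R axis \<sigma> (axis j 1))) has_real_derivative c) (at 0) \<Longrightarrow> pd \<sigma> j f \<Phi> = c"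
  unfolding pd_def by (rule DERIV_imp_deriv)

lemma real_polynomial_function_pd:
  assumes "real_polynomial_function f" shows "real_polynomial_function (pd \<sigma> j f)"
proof -
  obtain f' where f': "\<And>x. (f has_derivative f' x) (at x)"
    "\<And>v. real_polynomial_function (\<lambda>x. f' x v)"
    using real_polynomial_function_has_derivative[OF assms] by blast
  have "pd \<sigma> j f = (\<lambda>x. f' x (axis \<sigma> (axis j 1)))"
    by (rule ext) (rule pd_eqI has_real_derivative_along_line f')+
  then show ?thesis using f'(2) by simp
qed

lemma real_polynomial_function_smooth:
  assumes "real_polynomial_function f" shows "smooth f"
proof -
  have "real_polynomial_function (iter_pd ds f)" for ds
    by (induction ds) (simp_all add: assms real_polynomial_function_pd)
  then show ?thesis
    unfolding smooth_def differentiable_on_def differentiable_def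
    by (meson real_polynomial_function_has_derivative has_derivative_at_withinI)
qed

lemma real_polynomial_function_coordinate:
  "real_polynomial_function (\<lambda>x :: real^'m^'r. x $ s $ j)"
  by (rule real_polynomial_function.intros(1))
     (rule bounded_linear_compose[OF bounded_linear_vec_nth bounded_linear_vec_nth])

lemma real_polynomial_function_continuous_on:
  "real_polynomial_function f \<Longrightarrow> continuous_on S f"
  by (meson real_polynomial_function_has_derivative has_derivative_continuous continuous_at_imp_continuous_on)

text \<open>On the line from a zero x to z the function is a univariate polynomial that is non-zero
  at parameter 1; its finitely many roots leave points arbitrarily close to x where f does not
  vanish.\<close>

lemma nonvanishing_set_open_dense:
  fixes f :: "'a::euclidean_space \<Rightarrow> real"
  assumes f: "real_polynomial_function f" and z: "f z \<noteq> 0"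
  shows "open {x. f x \<noteq> 0}" "closure {x. f x \<noteq> 0} = UNIV"
proof -
  have "open (f -` (- {0}))"
    by (rule open_vimage) (auto intro: real_polynomial_function_continuous_on f)
  then show "open {x. f x \<noteq> 0}" by (simp add: vimage_def)
  have "x \<in> closure {x. f x \<noteq> 0}" for x
  proof (cases "f x = 0")
    case True
    define g where "g t = f (x + t *\<^sub>R (z - x))" for t
    have "polynomial_function (\<lambda>t::real. x + t *\<^sub>R (z - x))"
      by (intro polynomial_function_add polynomial_function_const polynomial_function_mult)
         (auto simp: real_polynomial_function_eq[symmetric])
    then have "real_polynomial_function g"
      using real_polynomial_function_compose[OF _ f, of "\<lambda>t::real. x + t *\<^sub>R (z - x)"]
      by (simp add: g_def[abs_def] o_def)
    then obtain a n where a: "g = (\<lambda>t. \<Sum>i\<le>n. a i * t ^ i)"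
      using real_polynomial_function_iff_sum by blast
    have "g 1 \<noteq> 0" using z by (simp add: g_def)
    then have "\<exists>i\<le>n. a i \<noteq> 0" unfolding a by (auto intro: sum.neutral)
    then have "finite {t. g t = 0}" unfolding a using polyfun_finite_roots[of a n] by simp
    then have fin: "finite ({t. g t = 0} \<union> {0})" by simp
    show ?thesis unfolding closure_approachable
    proof (intro allI impI)
      fix e :: real assume "e > 0"
      have nz: "norm (z - x) > 0" using True z by auto
      have "infinite {0<..<e / norm (z - x)}" using \<open>e > 0\<close> nz by (simp add: infinite_Ioo)
      then obtain t where t: "t \<in> {0<..<e / norm (z - x)}" "g t \<noteq> 0"
        using finite_subset[OF _ fin] by blast
      then have "dist (x + t *\<^sub>R (z - x)) x < e"
        using nz by (simp add: dist_norm pos_less_divide_eq)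
      then show "\<exists>y\<in>{x. f x \<noteq> 0}. dist y x < e" using t(2) by (auto simp: g_def)
    qed
  qed (metis (mono_tags, lifting) closure_subset mem_Collect_eq subsetD)
  then show "closure {x. f x \<noteq> 0} = UNIV" by blast
qed

text \<open>The Hamiltonians are real but assembled from complex matrices; real and imaginary parts
  carry the polynomial property through the intermediate steps.\<close>

definition complex_polynomial_function :: "('a::real_normed_vector \<Rightarrow> complex) \<Rightarrow> bool" where
  "complex_polynomial_function f \<longleftrightarrow>
     real_polynomial_function (\<lambda>x. Re (f x)) \<and> real_polynomial_function (\<lambda>x. Im (f x))"

lemma complex_polynomial_function_const [intro]: "complex_polynomial_function (\<lambda>x. c)"
  by (auto simp: complex_polynomial_function_def)

lemma complex_polynomial_function_of_real:
  "real_polynomial_function f \<Longrightarrow> complex_polynomial_function (\<lambda>x. complex_of_real (f x))"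
  by (auto simp: complex_polynomial_function_def)

lemma complex_polynomial_function_mult [intro]:
  "complex_polynomial_function f \<Longrightarrow> complex_polynomial_function g
     \<Longrightarrow> complex_polynomial_function (\<lambda>x. f x * g x)"
  by (auto simp: complex_polynomial_function_def)

lemma complex_polynomial_function_sum [intro]:
  "(\<And>i. i \<in> I \<Longrightarrow> complex_polynomial_function (\<lambda>x. f x i))
     \<Longrightarrow> complex_polynomial_function (\<lambda>x. sum (f x) I)"
  by (induction I rule: infinite_finite_induct) (auto simp: complex_polynomial_function_def)

definition mpoly_function :: "('a::real_normed_vector \<Rightarrow> (complex fps)^'m^'m) \<Rightarrow> bool" where
  "mpoly_function M \<longleftrightarrow> (\<forall>i j n. complex_polynomial_function (\<lambda>x. fps_nth (M x $ i $ j) n))"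

lemma mpoly_function_const: "mpoly_function (\<lambda>x. A)"
  by (auto simp: mpoly_function_def)

lemma mpoly_function_mult:
  "mpoly_function M \<Longrightarrow> mpoly_function N \<Longrightarrow> mpoly_function (\<lambda>x. M x ** N x)"
  unfolding mpoly_function_def matrix_mult_nth fps_sum_nth fps_mult_nth
  by (intro allI complex_polynomial_function_sum complex_polynomial_function_mult) auto

lemma mpoly_function_sum:
  "(\<And>i. i \<in> I \<Longrightarrow> mpoly_function (\<lambda>x. M x i)) \<Longrightarrow> mpoly_function (\<lambda>x. \<Sum>i\<in>I. M x i)"
  unfolding mpoly_function_def by (auto simp: fps_sum_nth)

lemma mpoly_function_matpow: "mpoly_function M \<Longrightarrow> mpoly_function (\<lambda>x. matpow (M x) k)"
  by (induction k) (auto simp: mpoly_function_const mpoly_function_mult)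

subsection \<open>Derivatives of curves of matrices of power series\<close>

text \<open>Coefficientwise differentiation needs no topology on power series. The base point 0 is
  enough, since every curve used is a line through the point of interest.\<close>

definition mder :: "(real \<Rightarrow> (complex fps)^'m^'m) \<Rightarrow> (complex fps)^'m^'m \<Rightarrow> bool" where
  "mder F D \<longleftrightarrow> (\<forall>i j n. ((\<lambda>t. fps_nth (F t $ i $ j) n) has_vector_derivative fps_nth (D $ i $ j) n) (at 0))"

lemma mder_const: "mder (\<lambda>t. A) 0"
  by (simp add: mder_def)

lemma mder_mult:
  assumes "mder F D" "mder G E"
  shows "mder (\<lambda>t. F t ** G t) (D ** G 0 + F 0 ** E)"
proof -
  have "((\<lambda>t. fps_nth ((F t ** G t) $ i $ j) n) has_vector_derivative
     (\<Sum>k\<in>UNIV. \<Sum>a=0..n. fps_nth (F 0 $ i $ k) a * fps_nth (E $ k $ j) (n - a)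
        + fps_nth (D $ i $ k) a * fps_nth (G 0 $ k $ j) (n - a))) (at 0)" for i j n
    unfolding matrix_mult_nth fps_sum_nth fps_mult_nth
    by (intro has_vector_derivative_sum has_vector_derivative_mult)
       (use assms in \<open>auto simp: mder_def\<close>)
  then show ?thesis unfolding mder_def
    by (simp add: matrix_mult_nth fps_sum_nth fps_mult_nth sum.distrib add.commute)
qed

text \<open>The product rule puts the derivative at k different places; under a trace against B
  commuting with \<open>L 0\<close>, cyclicity makes the k terms equal. \<open>E\<close> stays
  anonymous because it is only needed inside such a trace. For k = 0 the truncated exponent is
  harmless because of the factor \<open>of_nat k\<close>.\<close>

lemma mder_matpow:
  assumes "mder L D"
  shows "\<exists>E. mder (\<lambda>t. matpow (L t) k) E \<and>
    (\<forall>B. B ** L 0 = L 0 ** B \<longrightarrow>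
       trace (B ** E) = of_nat k * trace (B ** matpow (L 0) (k - 1) ** D))"
proof (induction k)
  case 0
  then show ?case by (intro exI[of _ 0]) (simp add: mder_const)
next
  case (Suc k)
  then obtain E where E: "mder (\<lambda>t. matpow (L t) k) E"
    "\<And>B. B ** L 0 = L 0 ** B \<Longrightarrow>
       trace (B ** E) = of_nat k * trace (B ** matpow (L 0) (k - 1) ** D)" by blast
  let ?E = "E ** L 0 + matpow (L 0) k ** D"
  have "mder (\<lambda>t. matpow (L t) (Suc k)) ?E"
    using mder_mult[OF E(1) assms] by simp
  moreover have "trace (B ** ?E) = of_nat (Suc k) * trace (B ** matpow (L 0) k ** D)"
    if B: "B ** L 0 = L 0 ** B" for B
  proof -
    have "trace (B ** ?E) = trace (B ** E ** L 0) + trace (B ** matpow (L 0) k ** D)"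
      by (simp add: matrix_add_ldistrib trace_add matrix_mul_assoc)
    also have "trace (B ** E ** L 0) = trace (L 0 ** B ** E)"
      by (metis trace_mul_sym matrix_mul_assoc)
    \<comment> \<open>The induction hypothesis is applied to \<open>L 0 ** B\<close>, which commutes
      with \<open>L 0\<close> as well.\<close>
    also have "\<dots> = of_nat k * trace (L 0 ** B ** matpow (L 0) (k - 1) ** D)"
      by (rule E(2)) (metis B matrix_mul_assoc)
    also have "\<dots> = of_nat k * trace (B ** matpow (L 0) k ** D)"
    proof (cases k)
      case (Suc k')
      have "L 0 ** B ** matpow (L 0) k' = B ** matpow (L 0) k"
        by (simp only: Suc matpow_Suc_left B[symmetric] matrix_mul_assoc)
      then show ?thesis using Suc by simp
    qed simp
    finally show ?thesis by (simp add: algebra_simps)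
  qed
  ultimately show ?case by auto
qed

lemma has_vector_derivative_trace:
  "mder F D \<Longrightarrow> ((\<lambda>t. fps_nth (trace (F t)) n) has_vector_derivative fps_nth (trace D) n) (at 0)"
  unfolding trace_def fps_sum_nth mder_def by (rule has_vector_derivative_sum) blast

subsection \<open>Linear independence through a Gram determinant\<close>

text \<open>The integrals are numbered by naturals, while \<open>det\<close> wants a finite index
  type; an arbitrary numbering of that type links the two. It also supplies the exponents of the
  moment curve below.\<close>

definition enum_index :: "'q::finite \<Rightarrow> nat" where
  "enum_index = (SOME e. bij_betw e UNIV {..<CARD('q)})"

lemma bij_betw_enum_index: "bij_betw (enum_index :: 'q::finite \<Rightarrow> nat) UNIV {..<CARD('q)}"
  unfolding enum_index_def
  using someI_ex[OF ex_bij_betw_finite_nat[of "UNIV :: 'q set", simplified atLeast0LessThan]] by simp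

lemma sum_enum_index:
  fixes g :: "nat \<Rightarrow> 'b::comm_monoid_add"
  assumes "d \<le> CARD('q::finite)"
  shows "(\<Sum>b\<in>(UNIV::'q set). if enum_index b < d then g (enum_index b) else 0) = (\<Sum>i<d. g i)"
proof -
  have "(\<Sum>b\<in>(UNIV::'q set). if enum_index b < d then g (enum_index b) else 0)
      = (\<Sum>i<CARD('q). if i < d then g i else 0)"
    by (rule sum.reindex_bij_betw[OF bij_betw_enum_index])
  also have "\<dots> = (\<Sum>i<d. g i)"
    using assms by (intro sum.mono_neutral_cong_right) auto
  finally show ?thesis .
qed

text \<open>The Gram matrix of the first \<open>d\<close> vectors, padded by an identity block to a size that is a type.\<close>

definition gram :: "nat \<Rightarrow> (nat \<Rightarrow> real^'m^'r) \<Rightarrow> real^('r \<times> 'm)^('r \<times> 'm)" where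
  "gram d v = (\<chi> a b. if enum_index a < d \<and> enum_index b < d
      then v (enum_index a) \<bullet> v (enum_index b) else if a = b then 1 else 0)"

text \<open>A kernel vector c of a Gram matrix gives |sum c_i v_i|^2 = 0, and the identity block
  forces the padding entries to be zero. Independence thus becomes non-vanishing of a function that
  is polynomial whenever the vectors are.\<close>

lemma gram_det_nonzero_iff:
  fixes v :: "nat \<Rightarrow> real^'m^'r"
  assumes d: "d \<le> CARD('r) * CARD('m)"
  shows "det (gram d v) \<noteq> 0 \<longleftrightarrow> (\<forall>c. (\<Sum>i<d. c i *\<^sub>R v i) = 0 \<longrightarrow> (\<forall>i<d. c i = 0))"
proof -
  have d': "d \<le> CARD('r \<times> 'm)" using d by simp
  have low: "(gram d v *v x) $ a = v (enum_index a) \<bullet> (\<Sum>i<d. c i *\<^sub>R v i)"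
    if "enum_index a < d" "\<And>b. enum_index b < d \<Longrightarrow> x $ b = c (enum_index b)" for x c a
  proof -
    have "(gram d v *v x) $ a
        = (\<Sum>b\<in>(UNIV :: ('r \<times> 'm) set). if enum_index b < d then (v (enum_index a) \<bullet> v (enum_index b)) * c (enum_index b) else 0)"
      unfolding matrix_vector_mult_def gram_def vec_lambda_beta using that by (auto intro!: sum.cong)
    also have "\<dots> = v (enum_index a) \<bullet> (\<Sum>i<d. c i *\<^sub>R v i)"
      by (subst sum_enum_index[OF d']) (simp add: inner_sum_right mult.commute)
    finally show ?thesis .
  qed
  have high: "(gram d v *v x) $ a = x $ a" if "\<not> enum_index a < d" for x a
    using that by (simp add: matrix_vector_mult_def gram_def mult_delta_left)
  have onto: "\<exists>a :: 'r \<times> 'm. enum_index a = i" if "i < d" for i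
    using bij_betw_enum_index[where 'q = "'r \<times> 'm"] that d'
    unfolding bij_betw_def by (metis (no_types, lifting) image_iff lessThan_iff order_less_le_trans)
  have "det (gram d v) \<noteq> 0 \<longleftrightarrow> (\<forall>x. gram d v *v x = 0 \<longrightarrow> x = 0)"
    by (simp add: invertible_det_nz[symmetric] invertible_left_inverse matrix_left_invertible_ker)
  also have "\<dots> \<longleftrightarrow> (\<forall>c. (\<Sum>i<d. c i *\<^sub>R v i) = 0 \<longrightarrow> (\<forall>i<d. c i = 0))"
  proof (intro iffI allI impI)
    fix c i assume inj: "\<forall>x. gram d v *v x = 0 \<longrightarrow> x = 0" and c: "(\<Sum>i<d. c i *\<^sub>R v i) = 0" and "i < d"
    define x where "x = (\<chi> a::'r \<times> 'm. if enum_index a < d then c (enum_index a) else 0)"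
    have "(gram d v *v x) $ a = 0" for a
      using low[of a x c] high[of a x] c by (cases "enum_index a < d") (auto simp: x_def)
    then have "x = 0" using inj by (simp add: vec_eq_iff)
    moreover obtain a :: "'r \<times> 'm" where "enum_index a = i" using onto \<open>i < d\<close> by blast
    ultimately show "c i = 0" using \<open>i < d\<close>
      by (metis (mono_tags, lifting) x_def vec_lambda_beta zero_index)
  next
    fix x assume ind: "\<forall>c. (\<Sum>i<d. c i *\<^sub>R v i) = 0 \<longrightarrow> (\<forall>i<d. c i = 0)" and x: "gram d v *v x = 0"
    define c where "c i = x $ (inv_into UNIV enum_index i)" for i
    have "inj (enum_index :: 'r \<times> 'm \<Rightarrow> nat)"
      using bij_betw_enum_index bij_betw_def by blast
    then have c: "x $ b = c (enum_index b)" for b by (simp add: c_def)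
    let ?s = "\<Sum>i<d. c i *\<^sub>R v i"
    have "v i \<bullet> ?s = 0" if "i < d" for i
      using onto[OF that] low[of _ x c] c x that by (metis zero_index)
    then have "?s \<bullet> ?s = 0" by (subst inner_sum_left) simp
    then have "\<forall>i<d. c i = 0" using ind by simp
    then have "x $ a = 0" for a
      using c[of a] high[of a x] x by (cases "enum_index a < d") auto
    then show "x = 0" by (simp add: vec_eq_iff)
  qed
  finally show ?thesis .
qed

lemma real_polynomial_function_gram_det:
  fixes v :: "nat \<Rightarrow> 'a::real_normed_vector \<Rightarrow> real^'m^'r"
  assumes "\<And>i s j. i < d \<Longrightarrow> real_polynomial_function (\<lambda>x. v i x $ s $ j)"
  shows "real_polynomial_function (\<lambda>x. det (gram d (\<lambda>i. v i x)))"
proof -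
  have "real_polynomial_function (\<lambda>x. gram d (\<lambda>i. v i x) $ a $ b)" for a b
    by (cases "enum_index a < d \<and> enum_index b < d")
       (auto simp: gram_def inner_vec_def assms intro!: real_polynomial_function_sum real_polynomial_function.intros(4))
  then show ?thesis unfolding det_def
    by (intro real_polynomial_function_sum real_polynomial_function.intros(4) real_polynomial_function_prod)
       (auto simp: finite_permutations)
qed

subsection \<open>The Lax matrix and its symmetries\<close>

lemma sum_atMost_rev: "(\<Sum>i\<le>n. f (n - i)) = (\<Sum>i\<le>n. f i)" for f :: "nat \<Rightarrow> 'a::comm_monoid_add"
  by (rule sum.reindex_bij_witness[of _ "\<lambda>i. n - i" "\<lambda>i. n - i"]) auto

lemma mat_uminus: "mat (- c) = - (mat c :: 'a::ring_1^'m^'m)"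
  by (simp add: vec_eq_iff mat_def)

lemma mat_mult_mat_mult: "(mat a ** X) ** (mat b ** Y) = mat (a * b) ** (X ** Y)"
  for X :: "'a::comm_semiring_1^'m^'n"
proof -
  have "(mat a ** X) ** (mat b ** Y) = mat a ** (X ** (mat b ** Y))" by (simp only: matrix_mul_assoc)
  then show ?thesis by (simp add: mat_mult_assoc'[of X])
qed

section \<open>Conjugation by an invertible matrix\<close>

definition conj_by :: "complex^'m^'m \<Rightarrow> complex^'m^'m \<Rightarrow> complex^'m^'m" where
  "conj_by A X = A ** X ** matrix_inv A"

lemma conj_by_add: "conj_by A (X + Y) = conj_by A X + conj_by A Y"
  by (simp add: conj_by_def matrix_add_ldistrib matrix_add_rdistrib')

lemma conj_by_diff: "conj_by A (X - Y) = conj_by A X - conj_by A Y"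
  by (simp add: conj_by_def matrix_diff_ldistrib matrix_diff_rdistrib)

lemma conj_by_sum: "conj_by A (\<Sum>i\<in>I. f i) = (\<Sum>i\<in>I. conj_by A (f i))"
  by (simp add: conj_by_def matrix_sum_ldistrib matrix_sum_rdistrib)

lemma conj_by_mat_mult: "conj_by A (mat c ** X) = mat c ** conj_by A X"
  by (simp add: conj_by_def mat_mult_assoc' flip: matrix_mul_assoc)

lemma conj_by_mult: "invertible A \<Longrightarrow> conj_by A (X ** Y) = conj_by A X ** conj_by A Y"
proof -
  assume "invertible A"
  then have "X ** Y = X ** (matrix_inv A ** A) ** Y" by (simp add: matrix_inv_left)
  then show ?thesis unfolding conj_by_def by (simp only: matrix_mul_assoc)
qed

lemma matrix_inv_mult:
  "invertible A \<Longrightarrow> invertible B \<Longrightarrow> matrix_inv (A ** B) = matrix_inv B ** matrix_inv A"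
  for A :: "'a::semiring_1^'m^'m"
proof (rule matrix_inv_unique)
  assume A: "invertible A" and B: "invertible B"
  have "A ** B ** (matrix_inv B ** matrix_inv A) = A ** (B ** matrix_inv B) ** matrix_inv A"
    by (simp only: matrix_mul_assoc)
  then show "A ** B ** (matrix_inv B ** matrix_inv A) = mat 1"
    by (simp add: A B matrix_inv_right)
  have "matrix_inv B ** matrix_inv A ** (A ** B) = matrix_inv B ** (matrix_inv A ** A) ** B"
    by (simp only: matrix_mul_assoc)
  then show "matrix_inv B ** matrix_inv A ** (A ** B) = mat 1"
    by (simp add: A B matrix_inv_left)
qed

lemma conj_by_conj_by: "invertible A \<Longrightarrow> invertible B \<Longrightarrow> conj_by A (conj_by B X) = conj_by (A ** B) X"
  by (simp add: conj_by_def matrix_inv_mult matrix_mul_assoc)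

lemma trace_conj_by: "invertible A \<Longrightarrow> trace (conj_by A X) = trace X"
  unfolding conj_by_def by (subst trace_mul_sym) (simp add: matrix_mul_assoc matrix_inv_left)

text \<open>For A preserving the form, Z A^-1 = A^T Z, which lets Z pass through the outer factors
  of the conjugate.\<close>

lemma transpose_conj_by:
  assumes "transpose A ** Z ** A = Z" "invertible A" "transpose X ** Z = - (Z ** X)"
  shows "transpose (conj_by A X) ** Z = - (Z ** conj_by A X)"
proof -
  have *: "Z ** matrix_inv A = transpose A ** Z"
    by (metis assms(1,2) matrix_inv_right matrix_mul_assoc matrix_mul_rid)
  have "transpose (matrix_inv A) ** transpose A = mat 1"
    by (metis assms(2) matrix_inv_right matrix_transpose_mul transpose_mat)
  then have **: "transpose (matrix_inv A) ** (Z ** matrix_inv A) = Z"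
    unfolding * by (metis matrix_mul_assoc matrix_mul_lid)
  then have ***: "transpose (matrix_inv A) ** Z = Z ** A"
    by (metis assms(2) matrix_inv_left matrix_mul_assoc matrix_mul_rid)
  have "transpose (conj_by A X) ** Z = transpose (matrix_inv A) ** (transpose X ** (transpose A ** Z))"
    by (simp add: conj_by_def matrix_transpose_mul matrix_mul_assoc)
  also have "\<dots> = transpose (matrix_inv A) ** (transpose X ** Z) ** matrix_inv A"
    by (simp flip: * add: matrix_mul_assoc)
  also have "\<dots> = - (transpose (matrix_inv A) ** Z ** X ** matrix_inv A)"
    by (simp add: assms(3) matrix_mul_assoc)
  also have "\<dots> = - (Z ** conj_by A X)" by (simp add: *** conj_by_def matrix_mul_assoc)
  finally show ?thesis .
qed

text \<open>The generators are forgotten here: the Lax matrix becomes a sum over the whole group,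
  and the least common multiple survives only as a positive exponent \<open>m\<close> killing the
  character. \<open>kap\<close> is the coupling constant rescaled accordingly.\<close>

locale lax_data =
  fixes W :: "real^'m^'m" and G\<^sub>0 :: "(complex^'m^'m) set" and \<omega> :: "complex^'m^'m \<Rightarrow> complex"
    and l :: "'r::finite \<Rightarrow> real" and kap :: real and K :: "complex^'m^'m" and m :: nat
  assumes W_invertible: "invertible W" and W_skew: "transpose W = - W"
    and G_finite: "finite G\<^sub>0" and G_one: "mat 1 \<in> G\<^sub>0"
    and G_mult: "\<And>A B. A \<in> G\<^sub>0 \<Longrightarrow> B \<in> G\<^sub>0 \<Longrightarrow> A ** B \<in> G\<^sub>0"
    and G_inv: "\<And>A. A \<in> G\<^sub>0 \<Longrightarrow> matrix_inv A \<in> G\<^sub>0"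
    and G_invertible: "\<And>A. A \<in> G\<^sub>0 \<Longrightarrow> invertible A"
    and G_symplectic: "\<And>A. A \<in> G\<^sub>0 \<Longrightarrow> transpose A ** cmat W ** A = cmat W"
    and G_conj: "\<And>A. A \<in> G\<^sub>0 \<Longrightarrow> conjmat A ** A = mat 1 \<or> conjmat A ** A = - mat 1"
    and \<omega>_mult: "\<And>A B. A \<in> G\<^sub>0 \<Longrightarrow> B \<in> G\<^sub>0 \<Longrightarrow> \<omega> (A ** B) = \<omega> A * \<omega> B"
    and \<omega>_norm: "\<And>A. A \<in> G\<^sub>0 \<Longrightarrow> cmod (\<omega> A) = 1"
    and m_pos: "m > 0" and \<omega>_pow: "\<And>A. A \<in> G\<^sub>0 \<Longrightarrow> \<omega> A ^ m = 1"
    and l_nonzero: "\<And>\<sigma>. l \<sigma> \<noteq> 0" and l_inj: "inj (\<lambda>\<sigma>. (l \<sigma>)\<^sup>2)"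
    and kap_nonzero: "kap \<noteq> 0"
    and K_class: "K \<in> \<D> W G\<^sub>0 \<omega> 1"
begin

lemma \<omega>_nonzero: "A \<in> G\<^sub>0 \<Longrightarrow> \<omega> A \<noteq> 0"
  using \<omega>_norm by fastforce

lemma \<omega>_one: "\<omega> (mat 1) = 1"
  using \<omega>_mult[OF G_one G_one] \<omega>_nonzero[OF G_one] by simp

lemma \<omega>_inv: "A \<in> G\<^sub>0 \<Longrightarrow> \<omega> (matrix_inv A) = cnj (\<omega> A)"
proof -
  assume A: "A \<in> G\<^sub>0"
  have "\<omega> A * \<omega> (matrix_inv A) = 1"
    using \<omega>_mult[OF A G_inv[OF A]] by (simp add: matrix_inv_right G_invertible A \<omega>_one)
  moreover have "\<omega> A * cnj (\<omega> A) = 1"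
    using \<omega>_norm[OF A] by (simp add: complex_mult_cnj cmod_power2[symmetric])
  ultimately show ?thesis using \<omega>_nonzero[OF A] by (metis mult_left_cancel)
qed

lemma sum_G_translate:
  assumes "A \<in> G\<^sub>0" shows "(\<Sum>g\<in>G\<^sub>0. f (A ** g)) = (\<Sum>g\<in>G\<^sub>0. f g)"
  by (rule sum.reindex_bij_witness[of _ "\<lambda>g. matrix_inv A ** g" "\<lambda>g. A ** g"])
     (use assms in \<open>auto simp: G_mult G_inv matrix_mul_assoc matrix_inv_left matrix_inv_right G_invertible\<close>)

lemma matrix_inv_inv: "A \<in> G\<^sub>0 \<Longrightarrow> matrix_inv (matrix_inv A) = A"
  by (simp add: matrix_inv_unique matrix_inv_left matrix_inv_right G_invertible)

lemma sum_G_inverse: "(\<Sum>g\<in>G\<^sub>0. f (matrix_inv g)) = (\<Sum>g\<in>G\<^sub>0. f g)"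
  by (rule sum.reindex_bij_witness[of _ matrix_inv matrix_inv]) (auto simp: G_inv matrix_inv_inv)

text \<open>On \<open>G\<^sub>0\<close> the entrywise conjugate of A is its inverse up to sign, and
  the sign cancels in a conjugation. With \<open>\<omega>_inv\<close>, complex conjugation exchanges
  the contributions of g and its inverse.\<close>

lemma conjmat_conj_by:
  assumes "A \<in> G\<^sub>0" "conjmat X = X" shows "conjmat (conj_by A X) = conj_by (matrix_inv A) X"
proof -
  let ?s = "conjmat A ** A"
  have 1: "conjmat A = ?s ** matrix_inv A"
    by (metis matrix_inv_right G_invertible[OF assms(1)] matrix_mul_assoc matrix_mul_rid)
  have 2: "conjmat (matrix_inv A) ** conjmat A = mat 1"
    by (metis matrix_inv_left G_invertible[OF assms(1)] conjmat_mult conjmat_mat complex_cnj_one)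
  then have *: "conjmat (matrix_inv A) ** ?s = A" by (simp add: matrix_mul_assoc)
  from G_conj[OF assms(1)] show ?thesis
  proof
    assume "?s = - mat 1"
    with * have "conjmat (matrix_inv A) = - A" by (metis matrix_mul_rid matrix_mult_minus_right minus_minus)
    moreover have "conjmat A = - matrix_inv A" using 1 \<open>?s = - mat 1\<close> by simp
    ultimately show ?thesis using assms by (simp add: conj_by_def conjmat_mult matrix_inv_inv)
  qed (use 1 * assms in \<open>simp add: conj_by_def conjmat_mult matrix_inv_inv\<close>)
qed

text \<open>Two arguments, because differentiating the quadratic map u |-> u u^T W needs its
  polarisation.\<close>

definition rank_one :: "real^'m \<Rightarrow> real^'m \<Rightarrow> complex^'m^'m" where
  "rank_one u v = outer (cvec u) (cvec v) ** cmat W"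

text \<open>The coefficient of lambda^(-n-1) in the pole part, by the geometric series of 1/(lambda
  - omega(g) lambda_sigma). Q is arbitrary, since derivatives and commutators lead to moments of
  other matrices.\<close>

definition moment :: "('r \<Rightarrow> complex^'m^'m) \<Rightarrow> nat \<Rightarrow> complex^'m^'m" where
  "moment Q n = mat (complex_of_real kap) **
     (\<Sum>g\<in>G\<^sub>0. \<Sum>\<sigma>\<in>UNIV. mat ((\<omega> g * complex_of_real (l \<sigma>)) ^ n) ** conj_by g (Q \<sigma>))"

definition L :: "real^'m^'r \<Rightarrow> (complex fps)^'m^'m" where
  "L \<Phi> = mfps (case_nat K (moment (\<lambda>\<sigma>. rank_one (\<Phi> $ \<sigma>) (\<Phi> $ \<sigma>))))"

definition dL :: "('r \<Rightarrow> complex^'m^'m) \<Rightarrow> (complex fps)^'m^'m" where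
  "dL Q = mfps (case_nat 0 (moment Q))"

lemma mcoeff_L [simp]: "mcoeff (L \<Phi>) 0 = K" "mcoeff (L \<Phi>) (Suc n) = moment (\<lambda>\<sigma>. rank_one (\<Phi> $ \<sigma>) (\<Phi> $ \<sigma>)) n"
  by (simp_all add: L_def)

lemma mcoeff_dL [simp]: "mcoeff (dL Q) 0 = 0" "mcoeff (dL Q) (Suc n) = moment Q n"
  by (simp_all add: dL_def)

text \<open>Coefficientwise form of A M(lambda) A^-1 = omega(A)^e M(omega(A) lambda). Weights add
  under products; e is an integer because h may be negative.\<close>

definition covariant :: "int \<Rightarrow> (complex fps)^'m^'m \<Rightarrow> bool" where
  "covariant e M \<longleftrightarrow> (\<forall>A\<in>G\<^sub>0. \<forall>n. conj_by A (mcoeff M n) = mat (\<omega> A powi (e - int n)) ** mcoeff M n)"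

text \<open>Conjugation by A permutes the summands by g |-> A g; undoing the change of the character
  costs omega(A)^(-n).\<close>

lemma conj_by_moment:
  assumes "A \<in> G\<^sub>0" shows "conj_by A (moment Q n) = mat (\<omega> A powi (- int n)) ** moment Q n"
proof -
  have "(\<Sum>g\<in>G\<^sub>0. \<Sum>\<sigma>\<in>UNIV. mat ((\<omega> g * complex_of_real (l \<sigma>)) ^ n) ** conj_by A (conj_by g (Q \<sigma>)))
      = (\<Sum>g\<in>G\<^sub>0. \<Sum>\<sigma>\<in>UNIV. mat (\<omega> A powi (- int n)) ** (mat ((\<omega> (A ** g) * complex_of_real (l \<sigma>)) ^ n) ** conj_by (A ** g) (Q \<sigma>)))"
  proof (intro sum.cong refl)
    fix g \<sigma> assume g: "g \<in> G\<^sub>0"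
    have "\<omega> A powi (- int n) * (\<omega> (A ** g) * complex_of_real (l \<sigma>)) ^ n = (\<omega> g * complex_of_real (l \<sigma>)) ^ n"
      using \<omega>_nonzero[OF assms] by (simp add: \<omega>_mult assms g power_int_minus power_mult_distrib field_simps)
    then show "mat ((\<omega> g * complex_of_real (l \<sigma>)) ^ n) ** conj_by A (conj_by g (Q \<sigma>)) = mat (\<omega> A powi (- int n)) **
        (mat ((\<omega> (A ** g) * complex_of_real (l \<sigma>)) ^ n) ** conj_by (A ** g) (Q \<sigma>))"
      by (simp add: conj_by_conj_by G_invertible assms g)
  qed
  also have "\<dots> = mat (\<omega> A powi (- int n)) **
      (\<Sum>g\<in>G\<^sub>0. \<Sum>\<sigma>\<in>UNIV. mat ((\<omega> g * complex_of_real (l \<sigma>)) ^ n) ** conj_by g (Q \<sigma>))"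
    by (subst sum_G_translate[OF assms]) (simp add: matrix_sum_ldistrib)
  finally show ?thesis
    by (simp add: moment_def conj_by_mat_mult conj_by_sum mult.commute)
qed

lemma covariant_L: "covariant 1 (L \<Phi>)"
  unfolding covariant_def
proof (intro ballI allI)
  fix A n assume A: "A \<in> G\<^sub>0"
  show "conj_by A (mcoeff (L \<Phi>) n) = mat (\<omega> A powi (1 - int n)) ** mcoeff (L \<Phi>) n"
  proof (cases n)
    case 0
    then show ?thesis using A K_class by (simp add: \<D>_def conj_by_def)
  next
    case (Suc n)
    then show ?thesis by (simp add: conj_by_moment[OF A])
  qed
qed

lemma covariant_mult:
  assumes "covariant e M" "covariant e' N" shows "covariant (e + e') (M ** N)"
  unfolding covariant_def
proof (intro ballI allI)
  fix A n assume A: "A \<in> G\<^sub>0"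
  have "conj_by A (mcoeff M i ** mcoeff N (n - i)) = mat (\<omega> A powi (e + e' - int n)) ** (mcoeff M i ** mcoeff N (n - i))"
    if "i \<le> n" for i
  proof -
    have "\<omega> A powi (e - int i) * \<omega> A powi (e' - int (n - i)) = \<omega> A powi (e + e' - int n)"
      using that \<omega>_nonzero[OF A] by (subst power_int_add[symmetric]) (auto simp: algebra_simps of_nat_diff)
    moreover have "conj_by A (mcoeff M i) = mat (\<omega> A powi (e - int i)) ** mcoeff M i"
      "conj_by A (mcoeff N (n - i)) = mat (\<omega> A powi (e' - int (n - i))) ** mcoeff N (n - i)"
      using assms A unfolding covariant_def by blast+
    ultimately show ?thesis by (simp add: conj_by_mult[OF G_invertible[OF A]] mat_mult_mat_mult)
  qed
  then show "conj_by A (mcoeff (M ** N) n) = mat (\<omega> A powi (e + e' - int n)) ** mcoeff (M ** N) n"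
    by (simp add: mcoeff_mult conj_by_sum matrix_sum_ldistrib)
qed

lemma covariant_one: "covariant 0 (mat 1)"
  by (auto simp: covariant_def mcoeff_mat conj_by_def matrix_inv_right G_invertible)

lemma covariant_matpow_L: "covariant (int j) (matpow (L \<Phi>) j)"
proof (induction j)
  case (Suc j)
  show ?case using covariant_mult[OF Suc covariant_L] by (simp add: add.commute)
qed (simp add: covariant_one)

text \<open>The character takes values in the m-th roots of unity, so weights matter only modulo m.
  Here the congruence imposed on the exponents takes effect.\<close>

lemma covariant_cong:
  assumes "covariant e M" "[e = e'] (mod int m)" shows "covariant e' M"
proof -
  obtain q where q: "e' = e + int m * q" using assms(2) cong_iff_lin by blast
  have "\<omega> A powi (e' - int n) = \<omega> A powi (e - int n)" if "A \<in> G\<^sub>0" for A n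
  proof -
    have "\<omega> A powi (e' - int n) = \<omega> A powi (e - int n) * (\<omega> A powi (int m)) powi q"
      using \<omega>_nonzero[OF that] by (subst power_int_mult[symmetric], subst power_int_add[symmetric]) (auto simp: q algebra_simps)
    then show ?thesis using \<omega>_pow[OF that] by simp
  qed
  then show ?thesis using assms(1) by (simp add: covariant_def)
qed

lemma covariant_sum:
  "(\<And>i. i \<in> I \<Longrightarrow> covariant e (f i)) \<Longrightarrow> covariant e (\<Sum>i\<in>I. f i)"
  by (simp add: covariant_def mcoeff_sum conj_by_sum matrix_sum_ldistrib)

lemma covariant_const_mult: "covariant e M \<Longrightarrow> covariant e (mat (fps_const c) ** M)"
  by (simp add: covariant_def mcoeff_const_mult conj_by_mat_mult mult.commute)

section \<open>Reality of the coefficients\<close>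

definition real_coeffs :: "(complex fps)^'m^'m \<Rightarrow> bool" where
  "real_coeffs M \<longleftrightarrow> (\<forall>n. conjmat (mcoeff M n) = mcoeff M n)"

lemma real_coeffs_mult: "real_coeffs M \<Longrightarrow> real_coeffs N \<Longrightarrow> real_coeffs (M ** N)"
  by (simp add: real_coeffs_def mcoeff_mult conjmat_sum conjmat_mult)

lemma conjmat_rank_one: "conjmat (rank_one u v) = rank_one u v"
  by (simp add: rank_one_def conjmat_mult) (simp add: vec_eq_iff matrix_mult_nth)

text \<open>Conjugation replaces the summand of g by that of its inverse, both in the character and
  in \<open>conj_by\<close>, and the group sum is invariant under inversion.\<close>

lemma conjmat_moment:
  assumes "\<And>\<sigma>. conjmat (Q \<sigma>) = Q \<sigma>" shows "conjmat (moment Q n) = moment Q n"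
proof -
  have "conjmat (\<Sum>g\<in>G\<^sub>0. \<Sum>\<sigma>\<in>UNIV. mat ((\<omega> g * complex_of_real (l \<sigma>)) ^ n) ** conj_by g (Q \<sigma>))
     = (\<Sum>g\<in>G\<^sub>0. \<Sum>\<sigma>\<in>UNIV. mat ((\<omega> (matrix_inv g) * complex_of_real (l \<sigma>)) ^ n) ** conj_by (matrix_inv g) (Q \<sigma>))"
    by (simp add: conjmat_sum conjmat_mult conjmat_conj_by assms \<omega>_inv)
  then show ?thesis by (simp add: moment_def conjmat_mult sum_G_inverse[of "\<lambda>g. \<Sum>\<sigma>\<in>UNIV. mat ((\<omega> g * complex_of_real (l \<sigma>)) ^ n) ** conj_by g (Q \<sigma>)"])
qed

lemma real_coeffs_L: "real_coeffs (L \<Phi>)"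
  unfolding real_coeffs_def
proof
  fix n show "conjmat (mcoeff (L \<Phi>) n) = mcoeff (L \<Phi>) n"
    using K_class by (cases n) (auto simp: conjmat_moment conjmat_rank_one \<D>_def)
qed

lemma real_coeffs_matpow: "real_coeffs M \<Longrightarrow> real_coeffs (matpow M k)"
  by (induction k) (simp_all add: real_coeffs_mult, simp add: real_coeffs_def mcoeff_mat)

section \<open>Membership in the symplectic Lie algebra\<close>

lemma lie_alg_iff: "X \<in> lie_alg W \<longleftrightarrow> transpose X ** cmat W = - (cmat W ** X)"
proof -
  have i: "invertible (cmat W)" by (simp add: invertible_cmat W_invertible)
  have "X \<in> lie_alg W \<longleftrightarrow> transpose X ** cmat W = - (cmat W ** X ** matrix_inv (cmat W)) ** cmat W"
    unfolding lie_alg_def mem_Collect_eq matrix_right_cancel[OF i] ..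
  then show ?thesis by (simp add: matrix_inv_left[OF i] flip: matrix_mul_assoc)
qed

lemma transpose_cmat_W: "transpose (cmat W) = - cmat W"
proof -
  have "transpose (cmat W) = cmat (transpose W)" by (simp add: vec_eq_iff transpose_def)
  also have "\<dots> = - cmat W" unfolding W_skew by (simp add: vec_eq_iff)
  finally show ?thesis .
qed

lemma lie_alg_mat_mult: "X \<in> lie_alg W \<Longrightarrow> mat c ** X \<in> lie_alg W"
  unfolding lie_alg_iff transpose_mat_mult matrix_mul_assoc[symmetric] mat_mult_assoc'[of "cmat W"]
  by simp

lemma lie_alg_sum: "(\<And>i. i \<in> I \<Longrightarrow> f i \<in> lie_alg W) \<Longrightarrow> (\<Sum>i\<in>I. f i) \<in> lie_alg W"
  unfolding lie_alg_iff transpose_sum matrix_sum_ldistrib matrix_sum_rdistrib by (simp add: sum_negf)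

lemma lie_alg_conj_by: "A \<in> G\<^sub>0 \<Longrightarrow> X \<in> lie_alg W \<Longrightarrow> conj_by A X \<in> lie_alg W"
  unfolding lie_alg_iff by (rule transpose_conj_by) (auto simp: G_symplectic G_invertible)

lemma moment_lie_alg: "(\<And>\<sigma>. Q \<sigma> \<in> lie_alg W) \<Longrightarrow> moment Q n \<in> lie_alg W"
  unfolding moment_def by (intro lie_alg_mat_mult lie_alg_sum lie_alg_conj_by)

lemma rank_one_lie_alg: "rank_one u u \<in> lie_alg W"
  unfolding lie_alg_iff rank_one_def matrix_transpose_mul transpose_outer transpose_cmat_W
  by (simp add: matrix_mul_assoc)

lemma transpose_L: "transpose (L \<Phi>) ** mconst (cmat W) = - (mconst (cmat W) ** L \<Phi>)"
proof (rule mcoeff_eqI)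
  fix n
  have "mcoeff (L \<Phi>) n \<in> lie_alg W"
    using K_class by (cases n) (auto simp: moment_lie_alg rank_one_lie_alg \<D>_def)
  then show "mcoeff (transpose (L \<Phi>) ** mconst (cmat W)) n = mcoeff (- (mconst (cmat W) ** L \<Phi>)) n"
    by (simp add: mcoeff_mult_mconst mcoeff_uminus mcoeff_mconst_mult mcoeff_transpose lie_alg_iff)
qed

text \<open>Each factor L passes the form at the cost of a sign, so the odd powers satisfy the Lie
  algebra condition; these are the powers j - 1 with j even.\<close>

lemma transpose_matpow_L:
  "transpose (matpow (L \<Phi>) j) ** mconst (cmat W) = mat ((- 1) ^ j) ** (mconst (cmat W) ** matpow (L \<Phi>) j)"
proof (induction j)
  case (Suc j)
  let ?w = "mconst (cmat W)"
  have "transpose (matpow (L \<Phi>) (Suc j)) ** ?w = transpose (L \<Phi>) ** (transpose (matpow (L \<Phi>) j) ** ?w)"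
    by (simp add: matrix_transpose_mul matrix_mul_assoc)
  also have "\<dots> = mat ((- 1) ^ j) ** (transpose (L \<Phi>) ** ?w ** matpow (L \<Phi>) j)"
    unfolding Suc mat_mult_assoc'[of "transpose (L \<Phi>)"] by (simp only: matrix_mul_assoc)
  also have "\<dots> = mat ((- 1) ^ Suc j) ** (?w ** matpow (L \<Phi>) (Suc j))"
    unfolding transpose_L matpow_Suc_left by (simp add: mat_uminus matrix_mul_assoc)
  finally show ?case .
qed simp

end

subsection \<open>The Lax equation\<close>

lemma transpose_zero: "transpose 0 = 0"
  by (simp add: vec_eq_iff transpose_def)

lemma mcoeff_X_power_mult:
  "mcoeff (mat (fps_X ^ p) ** M) n = (if n < p then 0 else mcoeff M (n - p))"
  for M :: "('a::comm_ring_1 fps)^'m^'m"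
  by (simp add: vec_eq_iff fps_X_power_mult_nth)

context lax_data
begin

text \<open>The congruence makes conjugation of \<open>\<lambda>\<^sup>p \<theta> L\<^sup>j\<^sup>-\<^sup>1\<close> by \<open>A \<in> G\<^sub>0\<close> the substitution \<open>\<lambda> \<mapsto> \<omega>(A) \<lambda>\<close>;
  the parity puts the coefficients into the Lie algebra.\<close>

definition admissible :: "nat \<Rightarrow> int \<Rightarrow> nat \<Rightarrow> (nat \<Rightarrow> real) \<Rightarrow> bool" where
  "admissible p h s b \<longleftrightarrow> (\<forall>j\<in>{1..s}. b j \<noteq> 0 \<longrightarrow> even j \<and> [h + int j = int p + 1] (mod int m))"

text \<open>This is f(L), with \<open>b j\<close> for the coefficient f_(s-j) of the power j -
  1.\<close>

definition M :: "complex^'m^'m \<Rightarrow> nat \<Rightarrow> (nat \<Rightarrow> real) \<Rightarrow> real^'m^'r \<Rightarrow> (complex fps)^'m^'m" where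
  "M \<theta> s b \<Phi> = (\<Sum>j=1..s. mat (fps_const (complex_of_real (b j))) ** (mconst \<theta> ** matpow (L \<Phi>) (j - 1)))"

text \<open>The part of lambda^p A with non-negative powers, evaluated at z: the power lambda^i
  carries the coefficient of A at lambda^(i-p).\<close>

definition plus :: "nat \<Rightarrow> (complex fps)^'m^'m \<Rightarrow> complex \<Rightarrow> complex^'m^'m" where
  "plus p A z = (\<Sum>i\<le>p. mat (z ^ i) ** mcoeff A (p - i))"

text \<open>The index p + 1 is the residue after multiplication by lambda^p, the weights
  \<open>b j / j\<close> integrate f, and \<open>kap * card G\<^sub>0\<close> will be kappa
  m_1...m_N.\<close>

definition complex_hamiltonian :: "complex^'m^'m \<Rightarrow> nat \<Rightarrow> nat \<Rightarrow> (nat \<Rightarrow> real) \<Rightarrow> real^'m^'r \<Rightarrow> complex" where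
  "complex_hamiltonian \<theta> p s b \<Phi> = 1 / (2 * kap * card G\<^sub>0) *
     (\<Sum>j=1..s. (b j / j) * trace (mcoeff (mconst \<theta> ** matpow (L \<Phi>) j) (p + 1)))"

text \<open>The real part gives a real function for arbitrary data; for admissible data nothing is
  lost, by \<open>of_real_hamiltonian\<close>.\<close>

definition hamiltonian :: "complex^'m^'m \<Rightarrow> nat \<Rightarrow> nat \<Rightarrow> (nat \<Rightarrow> real) \<Rightarrow> real^'m^'r \<Rightarrow> real" where
  "hamiltonian \<theta> p s b \<Phi> = Re (complex_hamiltonian \<theta> p s b \<Phi>)"

lemma card_G_pos: "card G\<^sub>0 > 0"
  using G_finite G_one card_gt_0_iff by blast

context
  fixes \<theta> h p s b
  assumes \<theta>: "\<theta> \<in> \<Theta> W G\<^sub>0 \<omega> h" and adm: "admissible p h s b"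
begin

text \<open>theta is a scalar times some g with omega(g) = 1, and for such g the covariance of L
  says that every coefficient commutes with g.\<close>

lemma theta_commute: "mconst \<theta> ** L \<Phi> = L \<Phi> ** mconst \<theta>"
proof -
  obtain c g where g: "g \<in> G\<^sub>0" "\<theta> = mat c ** g" "\<omega> g = 1" using \<theta> by (auto simp: \<Theta>_def)
  have "g ** mcoeff (L \<Phi>) n = mcoeff (L \<Phi>) n ** g" for n
  proof -
    have "conj_by g (mcoeff (L \<Phi>) n) = mcoeff (L \<Phi>) n"
      using covariant_L[of \<Phi>] g by (simp add: covariant_def)
    then have "conj_by g (mcoeff (L \<Phi>) n) ** g = mcoeff (L \<Phi>) n ** g" by simp
    then show ?thesis
      by (simp add: conj_by_def matrix_inv_left G_invertible[OF g(1)] flip: matrix_mul_assoc)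
  qed
  then show ?thesis unfolding mconst_commute_iff g(2)
    by (simp add: mat_mult_assoc'[of "mcoeff _ _"] flip: matrix_mul_assoc)
qed

lemma M_commute: "M \<theta> s b \<Phi> ** L \<Phi> = L \<Phi> ** M \<theta> s b \<Phi>"
proof -
  have "mconst \<theta> ** matpow (L \<Phi>) j ** L \<Phi> = L \<Phi> ** (mconst \<theta> ** matpow (L \<Phi>) j)" for j
    by (metis theta_commute matpow_commute matrix_mul_assoc)
  then show ?thesis
    by (simp add: M_def matrix_sum_ldistrib matrix_sum_rdistrib mat_mult_assoc'[of "L _"] flip: matrix_mul_assoc)
qed

text \<open>The term j has weight h + (j - 1), and h + j is congruent to p + 1. Where
  \<open>b j\<close> vanishes no congruence is available, but the zero matrix has every
  weight.\<close>

lemma M_covariant: "covariant (int p) (M \<theta> s b \<Phi>)"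
  unfolding M_def
proof (rule covariant_sum)
  fix j assume j: "j \<in> {1..s}"
  have "covariant h (mconst \<theta>)"
    using \<theta> by (auto simp: covariant_def mcoeff_mconst conj_by_def \<Theta>_def)
  from covariant_mult[OF this covariant_matpow_L]
  have *: "covariant (h + int (j - 1)) (mconst \<theta> ** matpow (L \<Phi>) (j - 1))" .
  show "covariant (int p) (mat (fps_const (complex_of_real (b j))) ** (mconst \<theta> ** matpow (L \<Phi>) (j - 1)))"
  proof (cases "b j = 0")
    case True
    then have "mat (fps_const (complex_of_real (b j))) ** (mconst \<theta> ** matpow (L \<Phi>) (j - 1)) = 0"
      by (simp add: vec_eq_iff)
    then show ?thesis by (simp add: covariant_def conj_by_def)
  next
    case False
    then have "[h + int j - 1 = int p + 1 - 1] (mod int m)"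
      using adm j unfolding admissible_def by (intro cong_diff) auto
    then have "[h + int (j - 1) = int p] (mod int m)" using j by (simp add: of_nat_diff algebra_simps)
    then show ?thesis by (intro covariant_const_mult covariant_cong[OF *])
  qed
qed

lemma theta_real_coeffs: "real_coeffs (mconst \<theta>)"
  using \<theta> by (auto simp: real_coeffs_def mcoeff_mconst \<Theta>_def vec_eq_iff)

lemma M_real_coeffs: "real_coeffs (M \<theta> s b \<Phi>)"
proof -
  have "real_coeffs (mconst \<theta> ** matpow (L \<Phi>) j)" for j
    by (intro real_coeffs_mult theta_real_coeffs real_coeffs_matpow real_coeffs_L)
  then show ?thesis
    by (simp add: real_coeffs_def M_def mcoeff_sum conjmat_sum mcoeff_const_mult conjmat_mult)
qed

lemma plus_real: "conjmat (plus p (M \<theta> s b \<Phi>) (complex_of_real x)) = plus p (M \<theta> s b \<Phi>) (complex_of_real x)"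
  using M_real_coeffs by (simp add: plus_def conjmat_sum conjmat_mult real_coeffs_def)

text \<open>Transposition against W contributes no sign for theta and -1 for an odd power of L;
  since theta and L commute, the original order can be restored.\<close>

lemma M_lie_alg: "mcoeff (M \<theta> s b \<Phi>) n \<in> lie_alg W"
proof -
  let ?w = "mconst (cmat W)"
  have *: "mcoeff (mconst \<theta> ** matpow (L \<Phi>) k) n \<in> lie_alg W" if "odd k" for k
  proof -
    have inv: "invertible (cmat W)" by (simp add: invertible_cmat W_invertible)
    have "transpose \<theta> ** cmat W = cmat W ** \<theta> ** (matrix_inv (cmat W) ** cmat W)"
      using \<theta> by (auto simp: \<Theta>_def matrix_mul_assoc)
    then have "transpose \<theta> ** cmat W = cmat W ** \<theta>" by (simp add: matrix_inv_left inv)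
    then have t: "transpose (mconst \<theta>) ** ?w = ?w ** mconst \<theta>"
      by (intro mcoeff_eqI) (simp add: mcoeff_mult_mconst mcoeff_mconst_mult mcoeff_transpose mcoeff_mconst transpose_zero)
    have "transpose (mconst \<theta> ** matpow (L \<Phi>) k) ** ?w
        = transpose (matpow (L \<Phi>) k) ** (transpose (mconst \<theta>) ** ?w)"
      by (simp add: matrix_transpose_mul matrix_mul_assoc)
    also have "\<dots> = - (?w ** (matpow (L \<Phi>) k ** mconst \<theta>))"
      unfolding t using transpose_matpow_L[of \<Phi> k] that by (simp add: matrix_mul_assoc mat_uminus)
    also have "matpow (L \<Phi>) k ** mconst \<theta> = mconst \<theta> ** matpow (L \<Phi>) k"
      using matpow_commute[OF theta_commute[symmetric]] .
    finally have "mcoeff (transpose (mconst \<theta> ** matpow (L \<Phi>) k) ** ?w) n = mcoeff (- (?w ** (mconst \<theta> ** matpow (L \<Phi>) k))) n"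
      by simp
    then show ?thesis
      by (simp only: mcoeff_mult_mconst mcoeff_transpose mcoeff_uminus mcoeff_mconst_mult lie_alg_iff)
  qed
  show ?thesis unfolding M_def mcoeff_sum mcoeff_const_mult
  proof (rule lie_alg_sum)
    fix j assume j: "j \<in> {1..s}"
    show "mat (complex_of_real (b j)) ** mcoeff (mconst \<theta> ** matpow (L \<Phi>) (j - 1)) n \<in> lie_alg W"
    proof (cases "b j = 0")
      case False
      then have "odd (j - 1)" using adm j by (auto simp: admissible_def)
      then show ?thesis by (intro lie_alg_mat_mult *)
    qed (simp add: lie_alg_iff transpose_zero)
  qed
qed

lemma plus_lie_alg: "plus p (M \<theta> s b \<Phi>) z \<in> lie_alg W"
  unfolding plus_def by (intro lie_alg_sum lie_alg_mat_mult M_lie_alg)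

end

section \<open>The residue pairing\<close>

lemma conj_by_plus:
  assumes "covariant (int p) A" "g \<in> G\<^sub>0"
  shows "conj_by g (plus p A z) = plus p A (\<omega> g * z)"
  unfolding plus_def conj_by_sum
proof (rule sum.cong)
  fix i assume i: "i \<in> {..p}"
  have "conj_by g (mcoeff A (p - i)) = mat (\<omega> g ^ i) ** mcoeff A (p - i)"
    using assms i by (simp add: covariant_def of_nat_diff)
  then show "conj_by g (mat (z ^ i) ** mcoeff A (p - i)) = mat ((\<omega> g * z) ^ i) ** mcoeff A (p - i)"
    by (simp add: conj_by_mat_mult power_mult_distrib mult.commute)
qed simp

text \<open>The factor omega(g)^i of the moment is absorbed by conjugating the coefficient of A with
  g, and the invariance of the trace then removes g altogether.\<close>

lemma trace_mult_moment:
  assumes "covariant (int p) A" "i \<le> p"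
  shows "trace (mcoeff A (p - i) ** moment Q i)
    = kap * card G\<^sub>0 * (\<Sum>\<sigma>\<in>UNIV. complex_of_real (l \<sigma>) ^ i * trace (mcoeff A (p - i) ** Q \<sigma>))"
proof -
  have "(\<omega> g * complex_of_real (l \<sigma>)) ^ i * trace (mcoeff A (p - i) ** conj_by g (Q \<sigma>))
      = complex_of_real (l \<sigma>) ^ i * trace (mcoeff A (p - i) ** Q \<sigma>)" if g: "g \<in> G\<^sub>0" for g \<sigma>
  proof -
    have "conj_by g (mcoeff A (p - i)) = mat (\<omega> g ^ i) ** mcoeff A (p - i)"
      using assms g by (simp add: covariant_def of_nat_diff)
    then have "\<omega> g ^ i * trace (mcoeff A (p - i) ** conj_by g (Q \<sigma>)) = trace (conj_by g (mcoeff A (p - i)) ** conj_by g (Q \<sigma>))"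
      by (simp add: trace_mat_mult flip: matrix_mul_assoc)
    also have "\<dots> = trace (mcoeff A (p - i) ** Q \<sigma>)"
      using g by (simp add: trace_conj_by G_invertible flip: conj_by_mult)
    finally show ?thesis by (simp add: power_mult_distrib algebra_simps)
  qed
  then have "(\<Sum>g\<in>G\<^sub>0. \<Sum>\<sigma>\<in>UNIV. (\<omega> g * complex_of_real (l \<sigma>)) ^ i * trace (mcoeff A (p - i) ** conj_by g (Q \<sigma>)))
    = card G\<^sub>0 * (\<Sum>\<sigma>\<in>UNIV. complex_of_real (l \<sigma>) ^ i * trace (mcoeff A (p - i) ** Q \<sigma>))"
    by simp
  then show ?thesis
    by (simp add: moment_def mat_mult_assoc'[of "mcoeff _ _"] matrix_sum_ldistrib trace_mat_mult trace_sum mult.assoc flip: sum_distrib_left)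
qed

text \<open>dL has no constant term, so the product involves its coefficients of lambda^(-1) to
  lambda^(-p-1) only; their powers of lambda_sigma assemble the polynomial part of lambda^p A at the
  poles.\<close>

lemma trace_mult_dL:
  assumes "covariant (int p) A"
  shows "trace (mcoeff (A ** dL Q) (p + 1))
    = kap * card G\<^sub>0 * (\<Sum>\<sigma>\<in>UNIV. trace (plus p A (l \<sigma>) ** Q \<sigma>))"
proof -
  have "trace (mcoeff (A ** dL Q) (p + 1)) = (\<Sum>i\<le>p. trace (mcoeff A i ** moment Q (p - i)))"
    by (simp add: mcoeff_mult trace_sum trace_add Suc_diff_le)
  also have "\<dots> = (\<Sum>i\<le>p. trace (mcoeff A (p - i) ** moment Q i))"
    by (subst sum_atMost_rev[symmetric]) simp
  also have "\<dots> = (\<Sum>i\<le>p. kap * card G\<^sub>0 * (\<Sum>\<sigma>\<in>UNIV. complex_of_real (l \<sigma>) ^ i * trace (mcoeff A (p - i) ** Q \<sigma>)))"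
    by (rule sum.cong) (simp_all add: trace_mult_moment assms)
  also have "\<dots> = kap * card G\<^sub>0 * (\<Sum>\<sigma>\<in>UNIV. trace (plus p A (l \<sigma>) ** Q \<sigma>))"
    by (simp add: plus_def matrix_sum_rdistrib trace_sum trace_mat_mult sum_distrib_left sum.swap[of _ UNIV] flip: matrix_mul_assoc)
  finally show ?thesis .
qed

text \<open>A truncation of \<open>A\<close> plays the role of \<open>(\<lambda>\<^sup>p A)\<^sub>+\<close>, and coefficients of powers of \<open>\<lambda>\<close> are
  compared one by one, so no poles have to be matched.\<close>

lemma dL_eq_commutator:
  fixes A :: "(complex fps)^'m^'m" and p :: nat and \<Phi> :: "real^'m^'r"
  defines "P \<equiv> \<lambda>\<sigma>. rank_one (\<Phi> $ \<sigma>) (\<Phi> $ \<sigma>)"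
  assumes cov: "covariant (int p) A" and comm: "A ** L \<Phi> = L \<Phi> ** A"
    and Q: "\<And>\<sigma>. Q \<sigma> = plus p A (l \<sigma>) ** P \<sigma> - P \<sigma> ** plus p A (l \<sigma>)"
  shows "\<exists>T. mat (fps_X ^ p) ** dL Q = T ** L \<Phi> - L \<Phi> ** T"
proof -
  \<comment> \<open>Multiplied by lambda^p, \<open>T\<close> is the polynomial part of lambda^p
    A.\<close>
  define T where "T = mfps (\<lambda>i. if i \<le> p then mcoeff A i else 0)"
  have "mat (fps_X ^ p) ** dL Q = T ** L \<Phi> - L \<Phi> ** T"
  proof (rule mcoeff_eqI)
    fix n
    show "mcoeff (mat (fps_X ^ p) ** dL Q) n = mcoeff (T ** L \<Phi> - L \<Phi> ** T) n"
    proof (cases "n \<le> p")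
      case True
      \<comment> \<open>Up to index p the truncation is not felt, so the coefficient is that of
        [A, L] = 0; on the other side dL has no constant term.\<close>
      have "mcoeff (T ** L \<Phi>) n = mcoeff (A ** L \<Phi>) n" "mcoeff (L \<Phi> ** T) n = mcoeff (L \<Phi> ** A) n"
        using True by (auto simp: mcoeff_mult T_def intro!: sum.cong)
      then show ?thesis using True comm by (cases "n = p") (auto simp: mcoeff_diff mcoeff_X_power_mult)
    next
      case False
      define q where "q = n - p - 1"
      have n: "n = p + Suc q" using False by (simp add: q_def)
      have 1: "mcoeff (T ** L \<Phi>) n = (\<Sum>i\<le>p. mcoeff A (p - i) ** moment P (q + i))"
      proof -
        have "mcoeff (T ** L \<Phi>) n = (\<Sum>i\<le>n. if i \<le> p then mcoeff A i ** mcoeff (L \<Phi>) (n - i) else 0)"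
          unfolding mcoeff_mult by (rule sum.cong) (auto simp: T_def)
        also have "\<dots> = (\<Sum>i\<le>p. mcoeff A i ** mcoeff (L \<Phi>) (n - i))"
          using n by (intro sum.mono_neutral_cong_right) auto
        also have "\<dots> = (\<Sum>i\<le>p. mcoeff A (p - i) ** mcoeff (L \<Phi>) (n - (p - i)))"
          by (subst sum_atMost_rev[symmetric]) simp
        also have "\<dots> = (\<Sum>i\<le>p. mcoeff A (p - i) ** moment P (q + i))"
        proof (rule sum.cong)
          fix i assume "i \<in> {..p}"
          then have "n - (p - i) = Suc (q + i)" by (simp add: n)
          then show "mcoeff A (p - i) ** mcoeff (L \<Phi>) (n - (p - i)) = mcoeff A (p - i) ** moment P (q + i)"
            by (simp add: P_def)
        qed simp
        finally show ?thesis .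
      qed
      have 2: "mcoeff (L \<Phi> ** T) n = (\<Sum>i\<le>p. moment P (q + i) ** mcoeff A (p - i))"
      proof -
        have "mcoeff (L \<Phi> ** T) n = (\<Sum>i\<le>n. mcoeff (L \<Phi>) (n - i) ** mcoeff T i)"
          unfolding mcoeff_mult by (subst sum_atMost_rev[symmetric]) simp
        also have "\<dots> = (\<Sum>i\<le>n. if i \<le> p then mcoeff (L \<Phi>) (n - i) ** mcoeff A i else 0)"
          by (rule sum.cong) (auto simp: T_def)
        also have "\<dots> = (\<Sum>i\<le>p. mcoeff (L \<Phi>) (n - i) ** mcoeff A i)"
          using n by (intro sum.mono_neutral_cong_right) auto
        also have "\<dots> = (\<Sum>i\<le>p. mcoeff (L \<Phi>) (n - (p - i)) ** mcoeff A (p - i))"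
          by (subst sum_atMost_rev[symmetric]) simp
        also have "\<dots> = (\<Sum>i\<le>p. moment P (q + i) ** mcoeff A (p - i))"
        proof (rule sum.cong)
          fix i assume "i \<in> {..p}"
          then have "n - (p - i) = Suc (q + i)" by (simp add: n)
          then show "mcoeff (L \<Phi>) (n - (p - i)) ** mcoeff A (p - i) = moment P (q + i) ** mcoeff A (p - i)"
            by (simp add: P_def)
        qed simp
        finally show ?thesis .
      qed
      let ?z = "\<lambda>g \<sigma>. \<omega> g * complex_of_real (l \<sigma>)"
      \<comment> \<open>Conjugation by g moves the evaluation point to \<open>?z g \<sigma>\<close>;
        its powers merge with the q-th power of the moment into order q + i.\<close>
      have cjQ: "mat (?z g \<sigma> ^ q) ** conj_by g (Q \<sigma>)
          = (\<Sum>i\<le>p. mcoeff A (p - i) ** (mat (?z g \<sigma> ^ (q + i)) ** conj_by g (P \<sigma>)))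
          - (\<Sum>i\<le>p. (mat (?z g \<sigma> ^ (q + i)) ** conj_by g (P \<sigma>)) ** mcoeff A (p - i))" if g: "g \<in> G\<^sub>0" for g \<sigma>
      proof -
        have "conj_by g (Q \<sigma>) = plus p A (?z g \<sigma>) ** conj_by g (P \<sigma>) - conj_by g (P \<sigma>) ** plus p A (?z g \<sigma>)"
          by (simp add: Q conj_by_diff conj_by_mult G_invertible conj_by_plus[OF cov] g)
        then show ?thesis
          by (simp add: plus_def matrix_diff_ldistrib matrix_sum_ldistrib matrix_sum_rdistrib
              mat_mult_assoc'[of "conj_by _ _"] mat_mult_assoc'[of "mcoeff _ _"] power_add flip: matrix_mul_assoc)
      qed
      have "moment Q q = (\<Sum>i\<le>p. mcoeff A (p - i) ** moment P (q + i))
         - (\<Sum>i\<le>p. moment P (q + i) ** mcoeff A (p - i))"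
        unfolding moment_def
        by (simp add: cjQ sum_subtractf matrix_diff_ldistrib sum.swap[of _ "{..p}"] mat_mult_assoc'[of "mcoeff _ _"]
            matrix_sum_ldistrib matrix_sum_rdistrib flip: matrix_mul_assoc)
      then show ?thesis by (simp add: n mcoeff_diff mcoeff_X_power_mult 1[unfolded n, simplified] 2[unfolded n, simplified])
    qed
  qed
  then show ?thesis by blast
qed

text \<open>Up to a power of the series variable dL is a commutator [T, L], and B commutes with L,
  so cyclicity annihilates the trace; the power of \<open>fps_X\<close> cancels because power series
  over a field form a domain.\<close>

lemma trace_dL_eq_0:
  assumes "covariant (int p) A" "A ** L \<Phi> = L \<Phi> ** A"
    and "\<And>\<sigma>. Q \<sigma> = plus p A (l \<sigma>) ** rank_one (\<Phi> $ \<sigma>) (\<Phi> $ \<sigma>) - rank_one (\<Phi> $ \<sigma>) (\<Phi> $ \<sigma>) ** plus p A (l \<sigma>)"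
    and B: "B ** L \<Phi> = L \<Phi> ** B"
  shows "trace (B ** dL Q) = 0"
proof -
  obtain T where T: "mat (fps_X ^ p) ** dL Q = T ** L \<Phi> - L \<Phi> ** T"
    using dL_eq_commutator[OF assms(1-3)] by blast
  have "fps_X ^ p * trace (B ** dL Q) = trace (B ** (mat (fps_X ^ p) ** dL Q))"
    by (simp add: mat_mult_assoc'[of B] trace_mat_mult)
  also have "\<dots> = trace (B ** T ** L \<Phi>) - trace (B ** L \<Phi> ** T)"
    by (simp add: T matrix_diff_ldistrib trace_sub matrix_mul_assoc)
  also have "trace (B ** T ** L \<Phi>) = trace (L \<Phi> ** B ** T)"
    by (subst trace_mul_sym) (simp add: matrix_mul_assoc)
  finally show ?thesis by (simp add: B)
qed

end

subsection \<open>Hamiltonian vector fields and involution\<close>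

lemma trace_conjmat: "trace (conjmat X) = cnj (trace X)"
  by (simp add: trace_def)

context lax_data
begin

lemma moment_add: "moment (\<lambda>\<sigma>. Q \<sigma> + R \<sigma>) n = moment Q n + moment R n"
  by (simp add: moment_def conj_by_add matrix_add_ldistrib sum.distrib)

lemma moment_mat_mult: "moment (\<lambda>\<sigma>. mat c ** Q \<sigma>) n = mat c ** moment Q n"
  by (simp add: moment_def conj_by_mat_mult matrix_sum_ldistrib ac_simps)

lemma rank_one_line:
  "rank_one (u + t *\<^sub>R v) (u + t *\<^sub>R v)
     = rank_one u u + mat (complex_of_real t) ** (rank_one v u + rank_one u v) + mat (complex_of_real (t\<^sup>2)) ** rank_one v v"
  by (simp add: vec_eq_iff)
     (simp add: rank_one_def matrix_mult_nth sum_distrib_left algebra_simps power2_eq_square flip: sum.distrib)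

definition polar :: "real^'m^'r \<Rightarrow> real^'m^'r \<Rightarrow> 'r \<Rightarrow> complex^'m^'m" where
  "polar \<Phi> \<Psi> \<sigma> = rank_one (\<Psi> $ \<sigma>) (\<Phi> $ \<sigma>) + rank_one (\<Phi> $ \<sigma>) (\<Psi> $ \<sigma>)"

text \<open>Along a line every coefficient of L is a polynomial of degree at most two in t, and its
  linear part is the moment of \<open>polar\<close>.\<close>

lemma mder_L: "mder (\<lambda>t. L (\<Phi> + t *\<^sub>R \<Psi>)) (dL (polar \<Phi> \<Psi>))"
  unfolding mder_def
proof (intro allI)
  fix i j n
  show "((\<lambda>t. fps_nth (L (\<Phi> + t *\<^sub>R \<Psi>) $ i $ j) n) has_vector_derivative
      fps_nth (dL (polar \<Phi> \<Psi>) $ i $ j) n) (at 0)"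
  proof (cases n)
    case 0
    have "fps_nth (L X $ i $ j) 0 = K $ i $ j" for X
      using mcoeff_L(1)[of X] by (metis mcoeff_nth)
    moreover have "fps_nth (dL (polar \<Phi> \<Psi>) $ i $ j) 0 = 0"
      using mcoeff_dL(1)[of "polar \<Phi> \<Psi>"] by (metis mcoeff_nth zero_index)
    ultimately show ?thesis using 0 by simp
  next
    case (Suc q)
    let ?A = "moment (\<lambda>\<sigma>. rank_one (\<Phi> $ \<sigma>) (\<Phi> $ \<sigma>)) q $ i $ j"
    let ?B = "moment (polar \<Phi> \<Psi>) q $ i $ j"
    let ?C = "moment (\<lambda>\<sigma>. rank_one (\<Psi> $ \<sigma>) (\<Psi> $ \<sigma>)) q $ i $ j"
    have "fps_nth (L (\<Phi> + t *\<^sub>R \<Psi>) $ i $ j) (Suc q)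
        = ?A + complex_of_real t * ?B + complex_of_real (t\<^sup>2) * ?C" for t
    proof -
      have "moment (\<lambda>\<sigma>. rank_one ((\<Phi> + t *\<^sub>R \<Psi>) $ \<sigma>) ((\<Phi> + t *\<^sub>R \<Psi>) $ \<sigma>)) q
        = moment (\<lambda>\<sigma>. rank_one (\<Phi> $ \<sigma>) (\<Phi> $ \<sigma>) + mat (complex_of_real t) ** polar \<Phi> \<Psi> \<sigma>
            + mat (complex_of_real (t\<^sup>2)) ** rank_one (\<Psi> $ \<sigma>) (\<Psi> $ \<sigma>)) q"
        by (simp add: rank_one_line polar_def)
      then show ?thesis
        unfolding mcoeff_nth[symmetric] mcoeff_L(2) moment_add moment_mat_mult by simp
    qed
    moreover have "((\<lambda>t. ?A + complex_of_real t * ?B + complex_of_real (t\<^sup>2) * ?C)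
        has_vector_derivative ?B) (at 0)"
    proof -
      have "((\<lambda>t::real. t\<^sup>2) has_real_derivative 0) (at 0)"
        by (auto intro!: derivative_eq_intros)
      from has_vector_derivative_of_real[OF this]
      have "((\<lambda>t. complex_of_real (t\<^sup>2)) has_vector_derivative 0) (at 0)" by simp
      then show ?thesis by (auto intro!: derivative_eq_intros simp del: of_real_power)
    qed
    moreover have "fps_nth (dL (polar \<Phi> \<Psi>) $ i $ j) (Suc q) = ?B"
      using mcoeff_dL(2)[of "polar \<Phi> \<Psi>" q] by (metis mcoeff_nth)
    ultimately show ?thesis using Suc by simp
  qed
qed

section \<open>Polynomial dependence on the point of phase space\<close>

lemma complex_polynomial_function_moment:
  "complex_polynomial_function (\<lambda>\<Phi> :: real^'m^'r. moment (\<lambda>\<sigma>. rank_one (\<Phi> $ \<sigma>) (\<Phi> $ \<sigma>)) n $ i $ j)"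
  unfolding moment_def conj_by_def rank_one_def mat_mult_nth sum_component matrix_mult_nth outer_nth cvec_nth
  by (intro complex_polynomial_function_sum complex_polynomial_function_mult
      complex_polynomial_function_const complex_polynomial_function_of_real
      real_polynomial_function_coordinate)

lemma mpoly_function_L: "mpoly_function L"
  unfolding mpoly_function_def
proof (intro allI)
  fix i j n
  show "complex_polynomial_function (\<lambda>x. fps_nth (L x $ i $ j) n)"
    unfolding mcoeff_nth[symmetric]
    by (cases n) (simp_all add: complex_polynomial_function_const complex_polynomial_function_moment)
qed

lemma real_polynomial_function_hamiltonian: "real_polynomial_function (hamiltonian \<theta> p s b)"
proof -
  have "complex_polynomial_function (\<lambda>x. mcoeff (mconst \<theta> ** matpow (L x) j) n $ a $ c)" for j n a c
    using mpoly_function_mult[OF mpoly_function_const mpoly_function_matpow[OF mpoly_function_L]]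
    by (simp add: mpoly_function_def)
  then have "complex_polynomial_function (complex_hamiltonian \<theta> p s b)"
    unfolding complex_hamiltonian_def[abs_def] trace_def
    by (intro complex_polynomial_function_sum complex_polynomial_function_mult
      complex_polynomial_function_const)
  then show ?thesis by (simp add: hamiltonian_def[abs_def] complex_polynomial_function_def)
qed

lemma plus_M_polynomial:
  "complex_polynomial_function (\<lambda>x. plus p (M \<theta> s b x) z $ i $ j)"
proof -
  have "mpoly_function (M \<theta> s b)"
    unfolding M_def[abs_def]
    by (intro mpoly_function_sum mpoly_function_mult mpoly_function_const mpoly_function_matpow mpoly_function_L)
  then have "complex_polynomial_function (\<lambda>x. mcoeff (M \<theta> s b x) n $ i $ j)" for n
    by (simp add: mpoly_function_def)
  then show ?thesis unfolding plus_def sum_component mat_mult_nth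
    by (intro complex_polynomial_function_sum complex_polynomial_function_mult
      complex_polynomial_function_const)
qed

text \<open>The value that the gradient will turn out to have in column \<sigma>: W times the vector
  field. It is complex here and real by \<open>of_real_Re_grad\<close>.\<close>

definition grad :: "complex^'m^'m \<Rightarrow> nat \<Rightarrow> nat \<Rightarrow> (nat \<Rightarrow> real) \<Rightarrow> real^'m^'r \<Rightarrow> 'r \<Rightarrow> complex^'m" where
  "grad \<theta> p s b \<Phi> \<sigma> = (cmat W ** plus p (M \<theta> s b \<Phi>) (complex_of_real (l \<sigma>))) *v cvec (\<Phi> $ \<sigma>)"

text \<open>For Y in the Lie algebra W Y is symmetric, so both halves of the polarisation contribute
  equally; the resulting 2 cancels the 1/2 in the Hamiltonian.\<close>

lemma trace_lie_alg_mult_rank_one: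
  assumes "Y \<in> lie_alg W"
  shows "trace (Y ** (rank_one u v + rank_one v u)) = 2 * (\<Sum>i\<in>UNIV. complex_of_real (u $ i) * ((cmat W ** Y) *v cvec v) $ i)"
proof -
  let ?S = "cmat W ** Y"
  have sym: "?S $ i $ j = ?S $ j $ i" for i j
  proof -
    have "transpose ?S = ?S"
      using assms by (simp add: matrix_transpose_mul transpose_cmat_W lie_alg_iff)
    then have "transpose ?S $ j $ i = ?S $ j $ i" by simp
    then show ?thesis by (simp add: transpose_def)
  qed
  have 1: "trace (Y ** rank_one x y) = (\<Sum>i\<in>UNIV. \<Sum>j\<in>UNIV. y $ i * ?S $ i $ j * x $ j)" for x y
  proof -
    have "trace (Y ** rank_one x y) = trace (?S ** outer (cvec x) (cvec y))"
      unfolding rank_one_def by (simp add: matrix_mul_assoc) (subst trace_mul_sym, simp add: matrix_mul_assoc)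
    then show ?thesis
      by (simp add: matrix_mult_outer trace_outer matrix_vector_mult_def sum_distrib_left mult.assoc)
  qed
  have "trace (Y ** rank_one v u) = trace (Y ** rank_one u v)"
    unfolding 1 by (subst sum.swap) (simp add: sym mult.commute mult.left_commute)
  then have "trace (Y ** (rank_one u v + rank_one v u)) = 2 * trace (Y ** rank_one v u)"
    by (simp add: matrix_add_ldistrib trace_add)
  then show ?thesis unfolding 1
    by (simp add: matrix_vector_mult_def sum_distrib_left mult.assoc)
qed

context
  fixes \<theta> h p s b
  assumes \<theta>: "\<theta> \<in> \<Theta> W G\<^sub>0 \<omega> h" and adm: "admissible p h s b"
begin

text \<open>Both the derivative of the Hamiltonian and the Poisson brackets are evaluated through
  this residue formula, with different directions \<Psi>.\<close>

lemma sum_mult_grad: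
  "(\<Sum>\<sigma>\<in>UNIV. \<Sum>j\<in>UNIV. complex_of_real (\<Psi> $ \<sigma> $ j) * grad \<theta> p s b \<Phi> \<sigma> $ j)
    = 1 / (2 * kap * card G\<^sub>0) * trace (mcoeff (M \<theta> s b \<Phi> ** dL (polar \<Phi> \<Psi>)) (p + 1))"
proof -
  have "trace (plus p (M \<theta> s b \<Phi>) (l \<sigma>) ** polar \<Phi> \<Psi> \<sigma>)
      = 2 * (\<Sum>j\<in>UNIV. complex_of_real (\<Psi> $ \<sigma> $ j) * grad \<theta> p s b \<Phi> \<sigma> $ j)" for \<sigma>
    unfolding polar_def grad_def by (rule trace_lie_alg_mult_rank_one) (rule plus_lie_alg[OF \<theta> adm])
  then show ?thesis
    using kap_nonzero card_G_pos
    by (simp only: trace_mult_dL[OF M_covariant[OF \<theta> adm]]) (simp add: sum_distrib_left[symmetric])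
qed

text \<open>Although L and dL need not commute, the trace against theta lets F(L) differentiate like
  a scalar function; the factor j from the power cancels the 1/j of F.\<close>

lemma complex_hamiltonian_derivative:
  "((\<lambda>t. complex_hamiltonian \<theta> p s b (\<Phi> + t *\<^sub>R \<Psi>)) has_vector_derivative
     (\<Sum>\<sigma>\<in>UNIV. \<Sum>j\<in>UNIV. complex_of_real (\<Psi> $ \<sigma> $ j) * grad \<theta> p s b \<Phi> \<sigma> $ j)) (at 0)"
proof -
  let ?D = "dL (polar \<Phi> \<Psi>)"
  have each: "((\<lambda>t. trace (mcoeff (mconst \<theta> ** matpow (L (\<Phi> + t *\<^sub>R \<Psi>)) j) (p + 1))) has_vector_derivative
      of_nat j * trace (mcoeff (mconst \<theta> ** matpow (L \<Phi>) (j - 1) ** ?D) (p + 1))) (at 0)" for j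
  proof -
    obtain E where E: "mder (\<lambda>t. matpow (L (\<Phi> + t *\<^sub>R \<Psi>)) j) E"
      "\<And>B. B ** L \<Phi> = L \<Phi> ** B \<Longrightarrow> trace (B ** E) = of_nat j * trace (B ** matpow (L \<Phi>) (j - 1) ** ?D)"
      using mder_matpow[OF mder_L, of \<Phi> \<Psi> j] by auto
    have "mder (\<lambda>t. mconst \<theta> ** matpow (L (\<Phi> + t *\<^sub>R \<Psi>)) j) (mconst \<theta> ** E)"
      using mder_mult[OF mder_const E(1)] by simp
    from has_vector_derivative_trace[OF this, of "p + 1"] show ?thesis
      unfolding E(2)[OF theta_commute[OF \<theta> adm]] fps_nth_trace[symmetric]
      by (simp only: fps_of_nat[symmetric] fps_mult_left_const_nth)
  qed
  have "((\<lambda>t. complex_hamiltonian \<theta> p s b (\<Phi> + t *\<^sub>R \<Psi>)) has_vector_derivative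
    1 / (2 * kap * card G\<^sub>0) * (\<Sum>j=1..s. complex_of_real (b j) / of_nat j * (of_nat j * trace (mcoeff (mconst \<theta> ** matpow (L \<Phi>) (j - 1) ** ?D) (p + 1))))) (at 0)"
    unfolding complex_hamiltonian_def
    by (intro has_vector_derivative_mult_right has_vector_derivative_sum each)
  also have "(\<Sum>j=1..s. complex_of_real (b j) / of_nat j * (of_nat j * trace (mcoeff (mconst \<theta> ** matpow (L \<Phi>) (j - 1) ** ?D) (p + 1))))
     = trace (mcoeff (M \<theta> s b \<Phi> ** ?D) (p + 1))"
    by (simp add: M_def matrix_sum_rdistrib mcoeff_sum trace_sum mcoeff_const_mult trace_mat_mult flip: matrix_mul_assoc)
  finally show ?thesis by (simp only: sum_mult_grad)
qed

text \<open>Stated for any real v, because the independence argument evaluates the matrix at one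
  point and applies it to a vector that is not a column of that point.\<close>

lemma cnj_gradient_form:
  "cnj (((cmat W ** plus p (M \<theta> s b \<Phi>) (complex_of_real x)) *v cvec v) $ j)
     = ((cmat W ** plus p (M \<theta> s b \<Phi>) (complex_of_real x)) *v cvec v) $ j"
proof -
  let ?A = "cmat W ** plus p (M \<theta> s b \<Phi>) (complex_of_real x)"
  have "conjmat ?A = ?A"
    by (simp add: conjmat_mult plus_real[OF \<theta> adm])
  then have "cnj (?A $ i $ k) = ?A $ i $ k" for i k
    by (metis conjmat_nth)
  then show ?thesis by (simp add: matrix_vector_mult_def)
qed

lemma of_real_Re_grad: "complex_of_real (Re (grad \<theta> p s b \<Phi> \<sigma> $ j)) = grad \<theta> p s b \<Phi> \<sigma> $ j"
  unfolding grad_def using cnj_gradient_form by (simp add: complex_eq_iff)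

lemma of_real_hamiltonian: "complex_of_real (hamiltonian \<theta> p s b \<Phi>) = complex_hamiltonian \<theta> p s b \<Phi>"
proof -
  have "real_coeffs (mconst \<theta> ** matpow (L \<Phi>) j)" for j
    by (intro real_coeffs_mult theta_real_coeffs[OF \<theta> adm] real_coeffs_matpow real_coeffs_L)
  then have "cnj (trace (mcoeff (mconst \<theta> ** matpow (L \<Phi>) j) n)) = trace (mcoeff (mconst \<theta> ** matpow (L \<Phi>) j) n)" for j n
    by (simp add: real_coeffs_def flip: trace_conjmat)
  then have "cnj (complex_hamiltonian \<theta> p s b \<Phi>) = complex_hamiltonian \<theta> p s b \<Phi>"
    by (simp add: complex_hamiltonian_def)
  then show ?thesis by (simp add: hamiltonian_def complex_eq_iff)
qed

lemma pd_hamiltonian: "pd \<sigma> j (hamiltonian \<theta> p s b) \<Phi> = Re (grad \<theta> p s b \<Phi> \<sigma> $ j)"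
proof (rule pd_eqI)
  let ?\<Psi> = "axis \<sigma> (axis j 1) :: real^'m^'r"
  have "(\<Sum>\<tau>\<in>UNIV. \<Sum>i\<in>UNIV. complex_of_real (?\<Psi> $ \<tau> $ i) * grad \<theta> p s b \<Phi> \<tau> $ i)
      = (\<Sum>\<tau>\<in>UNIV. if \<tau> = \<sigma> then grad \<theta> p s b \<Phi> \<tau> $ j else 0)"
  proof (rule sum.cong)
    fix \<tau> :: 'r
    show "(\<Sum>i\<in>UNIV. complex_of_real (?\<Psi> $ \<tau> $ i) * grad \<theta> p s b \<Phi> \<tau> $ i) = (if \<tau> = \<sigma> then grad \<theta> p s b \<Phi> \<tau> $ j else 0)"
      by (simp add: axis_def if_distrib[of complex_of_real] mult_delta_left cong: if_cong)
  qed simp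
  then have "(\<Sum>\<tau>\<in>UNIV. \<Sum>i\<in>UNIV. complex_of_real (?\<Psi> $ \<tau> $ i) * grad \<theta> p s b \<Phi> \<tau> $ i)
      = grad \<theta> p s b \<Phi> \<sigma> $ j" by simp
  with complex_hamiltonian_derivative[of \<Phi> ?\<Psi>]
  have "((\<lambda>t. complex_hamiltonian \<theta> p s b (\<Phi> + t *\<^sub>R ?\<Psi>)) has_vector_derivative grad \<theta> p s b \<Phi> \<sigma> $ j) (at 0)" by simp
  from bounded_linear.has_vector_derivative[OF bounded_linear_Re this]
  show "((\<lambda>t. hamiltonian \<theta> p s b (\<Phi> + t *\<^sub>R ?\<Psi>)) has_real_derivative Re (grad \<theta> p s b \<Phi> \<sigma> $ j)) (at 0)"
    by (simp add: hamiltonian_def has_real_derivative_iff_has_vector_derivative)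
qed

lemma cvec_ham_field:
  "cvec (ham_field W (hamiltonian \<theta> p s b) \<Phi> $ \<sigma>)
     = plus p (M \<theta> s b \<Phi>) (complex_of_real (l \<sigma>)) *v cvec (\<Phi> $ \<sigma>)"
proof -
  have "cvec (ham_field W (hamiltonian \<theta> p s b) \<Phi> $ \<sigma>) = cmat (matrix_inv W) *v grad \<theta> p s b \<Phi> \<sigma>"
    by (simp add: vec_eq_iff ham_field_def pd_hamiltonian matrix_vector_mult_def of_real_Re_grad)
  also have "\<dots> = (matrix_inv (cmat W) ** cmat W ** plus p (M \<theta> s b \<Phi>) (l \<sigma>)) *v cvec (\<Phi> $ \<sigma>)"
    by (simp add: grad_def matrix_inv_cmat W_invertible matrix_vector_mul_assoc matrix_mul_assoc)
  finally show ?thesis by (simp add: matrix_inv_left invertible_cmat W_invertible)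
qed

text \<open>The field moves v to Y v; since Y^T W = - W Y, the second half of the polarisation is -
  v v^T W Y, and the sum is a commutator.\<close>

lemma polar_ham_field:
  "polar \<Phi> (ham_field W (hamiltonian \<theta> p s b) \<Phi>) \<sigma>
    = plus p (M \<theta> s b \<Phi>) (l \<sigma>) ** rank_one (\<Phi> $ \<sigma>) (\<Phi> $ \<sigma>) - rank_one (\<Phi> $ \<sigma>) (\<Phi> $ \<sigma>) ** plus p (M \<theta> s b \<Phi>) (l \<sigma>)"
proof -
  let ?Y = "plus p (M \<theta> s b \<Phi>) (l \<sigma>)" and ?v = "cvec (\<Phi> $ \<sigma>)"
  have "transpose ?Y ** cmat W = - (cmat W ** ?Y)"
    using plus_lie_alg[OF \<theta> adm] by (simp add: lie_alg_iff)
  moreover have "outer ?v (?Y *v ?v) = outer ?v ?v ** transpose ?Y"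
    by (simp add: outer_mult_matrix)
  ultimately show ?thesis
    unfolding polar_def rank_one_def cvec_ham_field
    by (simp add: matrix_mult_outer matrix_mul_assoc)
       (simp flip: matrix_mul_assoc)
qed

end

text \<open>The bracket is the derivative of the first function along the field of the second. That
  field changes L as in \<open>dL_eq_commutator\<close>, and \<open>M\<close> of the first function
  commutes with L, so the trace vanishes.\<close>

lemma poisson_hamiltonian_eq_0:
  assumes "\<theta> \<in> \<Theta> W G\<^sub>0 \<omega> h" "admissible p h s b" "\<theta>' \<in> \<Theta> W G\<^sub>0 \<omega> h'" "admissible p' h' s' b'"
  shows "poisson W (hamiltonian \<theta> p s b) (hamiltonian \<theta>' p' s' b') \<Phi> = 0"
proof -
  let ?f = "hamiltonian \<theta> p s b" and ?\<Psi> = "ham_field W (hamiltonian \<theta>' p' s' b') \<Phi>"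
  have "poisson W ?f (hamiltonian \<theta>' p' s' b') \<Phi> = (\<Sum>j\<in>UNIV. \<Sum>\<sigma>\<in>UNIV. ?\<Psi> $ \<sigma> $ j * pd \<sigma> j ?f \<Phi>)"
    unfolding poisson_def ham_field_def
    by (rule sum.cong, simp, subst sum.swap) (simp add: sum_distrib_left sum_distrib_right ac_simps)
  also have "\<dots> = (\<Sum>\<sigma>\<in>UNIV. \<Sum>j\<in>UNIV. ?\<Psi> $ \<sigma> $ j * pd \<sigma> j ?f \<Phi>)"
    by (rule sum.swap)
  finally have "complex_of_real (poisson W ?f (hamiltonian \<theta>' p' s' b') \<Phi>)
     = (\<Sum>\<sigma>\<in>UNIV. \<Sum>j\<in>UNIV. complex_of_real (?\<Psi> $ \<sigma> $ j) * grad \<theta> p s b \<Phi> \<sigma> $ j)"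
    by (simp add: pd_hamiltonian[OF assms(1,2)] of_real_Re_grad[OF assms(1,2)])
  also have "\<dots> = 1 / (2 * kap * card G\<^sub>0) * trace (mcoeff (M \<theta> s b \<Phi> ** dL (polar \<Phi> ?\<Psi>)) (p + 1))"
    by (rule sum_mult_grad[OF assms(1,2)])
  also have "trace (M \<theta> s b \<Phi> ** dL (polar \<Phi> ?\<Psi>)) = 0"
    using M_covariant[OF assms(3,4)] M_commute[OF assms(3,4)] polar_ham_field[OF assms(3,4)] M_commute[OF assms(1,2)]
    by (rule trace_dL_eq_0)
  then have "trace (mcoeff (M \<theta> s b \<Phi> ** dL (polar \<Phi> ?\<Psi>)) (p + 1)) = 0"
    by (simp flip: fps_nth_trace)
  finally show ?thesis by simp
qed

end

subsection \<open>Common eigenvectors\<close>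

text \<open>The zero vector is included, which is harmless for spans: the span is everything exactly
  when T has a common eigenbasis.\<close>

definition common_eigenvectors :: "(complex^'m^'m) set \<Rightarrow> (complex^'m) set" where
  "common_eigenvectors T = {u. \<forall>A\<in>T. \<exists>c. A *v u = c *s u}"

lemma matrix_vector_mult_smult: "A *v (c *s u) = c *s (A *v u)" for A :: "'a::comm_semiring_1^'m^'n"
  by (simp add: vec_eq_iff matrix_vector_mult_def sum_distrib_left ac_simps)

lemma span_eigenvectors_diagonalizable:
  fixes K :: "complex^'m^'m"
  assumes "diagonalizable K" shows "vec.span (common_eigenvectors {K}) = UNIV"
proof -
  obtain P D :: "complex^'m^'m" where P: "invertible P" and D: "\<And>i j. i \<noteq> j \<Longrightarrow> D $ i $ j = 0"
    and K: "K = P ** D ** matrix_inv P"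
    using assms by (auto simp: diagonalizable_def)
  have KP: "K ** P = P ** D" by (simp add: K matrix_inv_left P flip: matrix_mul_assoc)
  have "column j P \<in> common_eigenvectors {K}" for j
  proof -
    have "(K *v column j P) $ i = (D $ j $ j *s column j P) $ i" for i
    proof -
      have "(K *v column j P) $ i = (K ** P) $ i $ j"
        by (simp add: matrix_vector_mult_def column_def matrix_mult_nth)
      also have "\<dots> = (\<Sum>k\<in>UNIV. if k = j then P $ i $ j * D $ j $ j else 0)"
        unfolding KP matrix_mult_nth by (rule sum.cong) (auto simp: D)
      finally show ?thesis by (simp add: column_def)
    qed
    then show ?thesis by (auto simp: common_eigenvectors_def vec_eq_iff)
  qed
  moreover have "vec.span (columns P) = UNIV"
    using P matrix_right_invertible_span_columns[of P] unfolding invertible_def by blast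
  ultimately show ?thesis
    using vec.span_mono[of "columns P" "common_eigenvectors {K}"] by (auto simp: columns_def)
qed

text \<open>An involution up to sign, with \<open>A\<^sup>2 = \<mu>\<^sup>2\<close>, splits each vector \<open>u\<close> into the eigenvectors
  \<open>u \<plusminus> \<mu>\<^sup>-\<^sup>1 A u\<close>; these stay eigenvectors of everything that commutes with \<open>A\<close>.\<close>

lemma span_eigenvectors_insert:
  assumes span: "vec.span (common_eigenvectors T) = UNIV"
    and sq: "A ** A = mat 1 \<or> A ** A = - mat 1"
    and comm: "\<And>B. B \<in> T \<Longrightarrow> B ** A = A ** B"
  shows "vec.span (common_eigenvectors (insert A T)) = UNIV"
proof -
  obtain \<mu> :: complex where \<mu>: "\<mu> \<noteq> 0" "A ** A = mat (\<mu> * \<mu>)"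
  proof (cases "A ** A = mat 1")
    case True then show ?thesis using that[of 1] by simp
  next
    case False then show ?thesis using that[of \<i>] sq by (simp add: mat_uminus)
  qed
  have AA: "A *v (A *v u) = (\<mu> * \<mu>) *s u" for u
    by (simp add: matrix_vector_mul_assoc \<mu> vec_eq_iff)
  have eig: "u + e *s (A *v u) \<in> common_eigenvectors (insert A T)"
    if u: "u \<in> common_eigenvectors T" and e: "e * e * \<mu> * \<mu> = 1" for u e
    unfolding common_eigenvectors_def
  proof (intro CollectI ballI)
    fix B assume "B \<in> insert A T"
    then show "\<exists>c. B *v (u + e *s (A *v u)) = c *s (u + e *s (A *v u))"
    proof
      assume "B = A"
      have "e * (\<mu> * \<mu>) * e = 1" using e by (simp add: ac_simps)
      then have "A *v (u + e *s (A *v u)) = (e * (\<mu> * \<mu>)) *s (u + e *s (A *v u))"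
        by (simp add: matrix_vector_right_distrib matrix_vector_mult_smult AA vector_add_ldistrib vector_smult_assoc)
      then show ?thesis using \<open>B = A\<close> by blast
    next
      assume "B \<in> T"
      then obtain c where c: "B *v u = c *s u" using u by (auto simp: common_eigenvectors_def)
      have "B *v (A *v u) = A *v (B *v u)"
        by (simp add: matrix_vector_mul_assoc comm \<open>B \<in> T\<close>)
      then have "B *v (u + e *s (A *v u)) = c *s (u + e *s (A *v u))"
        by (simp add: matrix_vector_right_distrib matrix_vector_mult_smult c vector_add_ldistrib vector_smult_assoc mult.commute)
      then show ?thesis by blast
    qed
  qed
  have "common_eigenvectors T \<subseteq> vec.span (common_eigenvectors (insert A T))"
  proof
    fix u assume u: "u \<in> common_eigenvectors T"
    let ?p = "u + (1 / \<mu>) *s (A *v u)" and ?q = "u + (- 1 / \<mu>) *s (A *v u)"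
    have "?p \<in> vec.span (common_eigenvectors (insert A T))" "?q \<in> vec.span (common_eigenvectors (insert A T))"
      using \<mu>(1) by (intro vec.span_base eig u; simp add: field_simps)+
    then have "(1/2) *s ?p + (1/2) *s ?q \<in> vec.span (common_eigenvectors (insert A T))"
      by (rule vec.span_add[OF vec.span_scale vec.span_scale])
    moreover have "(1/2) *s ?p + (1/2) *s ?q = u" by (simp add: vec_eq_iff field_simps)
    ultimately show "u \<in> vec.span (common_eigenvectors (insert A T))" by simp
  qed
  from vec.span_minimal[OF this vec.subspace_span] show ?thesis using span by blast
qed

definition diag_mat :: "('m \<Rightarrow> complex) \<Rightarrow> complex^'m^'m" where
  "diag_mat d = (\<chi> i j. if i = j then d j else 0)"

lemma mult_diag_mat_nth: "(A ** diag_mat d) $ i $ j = A $ i $ j * d j"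
  by (simp add: matrix_mult_nth diag_mat_def mult_delta_right)

text \<open>A basis extracted from the common eigenvectors has as many members as the index type,
  and a bijection lists it as the columns of P.\<close>

lemma simultaneous_diagonalization:
  fixes T :: "(complex^'m^'m) set"
  assumes "vec.span (common_eigenvectors T) = UNIV"
  shows "\<exists>P :: complex^'m^'m. invertible P \<and> (\<forall>A\<in>T. \<exists>d. A ** P = P ** diag_mat d)"
proof -
  obtain B where B: "B \<subseteq> common_eigenvectors T" "vec.independent B"
    "common_eigenvectors T \<subseteq> vec.span B" "card B = vec.dim (common_eigenvectors T)"
    by (rule vec.basis_exists)
  have "vec.dim (common_eigenvectors T) = CARD('m)"
    using vec.dim_span[of "common_eigenvectors T"] unfolding assms vec_dim_card by (rule sym)
  then have "card B = CARD('m)" using B by simp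
  moreover have "finite B" by (rule vec.finiteI_independent[OF B(2)])
  ultimately obtain f :: "'m \<Rightarrow> complex^'m" where f: "bij_betw f UNIV B"
    using finite_same_card_bij[of "UNIV :: 'm set" B] by auto
  define P :: "complex^'m^'m" where "P = (\<chi> i j. f j $ i)"
  have col: "column j P = f j" for j by (simp add: P_def column_def vec_eq_iff)
  have "columns P = B" using f by (auto simp: columns_def col bij_betw_def)
  moreover have "vec.span B = UNIV"
    using assms vec.span_minimal[OF B(3) vec.subspace_span] by blast
  ultimately have "\<exists>Q. P ** Q = mat 1" using matrix_right_invertible_span_columns by metis
  then have "invertible P" by (simp add: invertible_right_inverse)
  moreover have "\<exists>d. A ** P = P ** diag_mat d" if A: "A \<in> T" for A
  proof -
    have "\<forall>j. \<exists>c. A *v f j = c *s f j"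
      using f A B(1) by (auto simp: bij_betw_def common_eigenvectors_def)
    then obtain d where d: "\<And>j. A *v f j = d j *s f j" by metis
    have "(A ** P) $ i $ j = (P ** diag_mat d) $ i $ j" for i j
      unfolding mult_diag_mat_nth
      using d[of j] by (simp add: vec_eq_iff matrix_vector_mult_def matrix_mult_nth P_def mult.commute)
    then have "A ** P = P ** diag_mat d" by (auto simp: vec_eq_iff)
    then show ?thesis by (rule exI[of _ d])
  qed
  ultimately show ?thesis by metis
qed

text \<open>The moment curve meets every hyperplane in finitely many points.\<close>

lemma exists_real_vector_avoiding_hyperplanes:
  fixes Q :: "complex^'m^'m"
  assumes "\<And>i. \<exists>j. Q $ i $ j \<noteq> 0"
  shows "\<exists>v :: real^'m. \<forall>i. (Q *v cvec v) $ i \<noteq> 0"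
proof -
  define c where "c i k = Q $ i $ (inv_into UNIV (enum_index :: 'm \<Rightarrow> nat) k)" for i k
  have inj: "inj (enum_index :: 'm \<Rightarrow> nat)" using bij_betw_enum_index bij_betw_def by blast
  have c: "c i (enum_index j) = Q $ i $ j" for i j by (simp add: c_def inj)
  have lt: "enum_index j < CARD('m)" for j :: 'm
    using bij_betw_enum_index[where 'q = 'm] by (auto simp: bij_betw_def)
  obtain N where N: "CARD('m) = Suc N" using zero_less_card_finite[where 'a = 'm] gr0_conv_Suc by blast
  have eval: "(Q *v cvec (\<chi> j. t ^ enum_index j)) $ i = (\<Sum>k\<le>N. c i k * complex_of_real t ^ k)" for t i
  proof -
    have "(Q *v cvec (\<chi> j. t ^ enum_index j)) $ i
      = (\<Sum>j\<in>(UNIV::'m set). if enum_index j < CARD('m) then c i (enum_index j) * complex_of_real t ^ enum_index j else 0)"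
      by (simp add: matrix_vector_mult_def c lt)
    also have "\<dots> = (\<Sum>k<CARD('m). c i k * complex_of_real t ^ k)"
      by (rule sum_enum_index) simp
    finally show ?thesis by (simp add: N lessThan_Suc_atMost)
  qed
  have "finite {z. (\<Sum>k\<le>N. c i k * z ^ k) = 0}" for i
  proof -
    obtain j where "Q $ i $ j \<noteq> 0" using assms by blast
    then have "c i (enum_index j) \<noteq> 0" "enum_index j \<le> N" using c lt[of j] N by auto
    then show ?thesis using polyfun_finite_roots[of "c i" N] by blast
  qed
  then have "finite (\<Union>i\<in>UNIV. complex_of_real -` {z. (\<Sum>k\<le>N. c i k * z ^ k) = 0})"
    by (intro finite_UN_I finite_vimageI) (auto simp: inj_on_def)
  then obtain t where "t \<notin> (\<Union>i\<in>UNIV. complex_of_real -` {z. (\<Sum>k\<le>N. c i k * z ^ k) = 0})"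
    using ex_new_if_finite[OF infinite_UNIV_char_0] by blast
  then have "\<forall>i. (Q *v cvec (\<chi> j. t ^ enum_index j)) $ i \<noteq> 0" unfolding eval by simp
  then show ?thesis by blast
qed

text \<open>In the coordinates given by P every combination S is diagonal. If v has no vanishing
  coordinate there, S v = 0 makes all diagonal entries zero, so one real v serves all coefficients
  at once.\<close>

lemma exists_real_separating_vector:
  fixes A :: "nat \<Rightarrow> complex^'m^'m" and P :: "complex^'m^'m"
  assumes "invertible P" and A: "\<And>k. k \<in> I \<Longrightarrow> \<exists>d. A k ** P = P ** diag_mat d"
  shows "\<exists>v :: real^'m. \<forall>c :: nat \<Rightarrow> complex.
    (\<Sum>k\<in>I. mat (c k) ** A k) *v cvec v = 0 \<longrightarrow> (\<Sum>k\<in>I. mat (c k) ** A k) = 0"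
proof -
  obtain d where d: "\<And>k. k \<in> I \<Longrightarrow> A k ** P = P ** diag_mat (d k)" using A by metis
  \<comment> \<open>No row of an invertible matrix vanishes, so each coordinate is a non-zero linear
    form in v, as the choice of v requires.\<close>
  have "\<exists>j. matrix_inv P $ i $ j \<noteq> 0" for i
  proof (rule ccontr)
    assume "\<nexists>j. matrix_inv P $ i $ j \<noteq> 0"
    then have "(matrix_inv P ** P) $ i $ i = 0" by (simp add: matrix_mult_nth)
    then show False by (simp add: matrix_inv_left assms mat_def)
  qed
  then obtain v :: "real^'m" where v: "\<And>i. (matrix_inv P *v cvec v) $ i \<noteq> 0"
    using exists_real_vector_avoiding_hyperplanes[of "matrix_inv P"] by metis
  have "S = 0" if S: "S = (\<Sum>k\<in>I. mat (c k) ** A k)" and Sv: "S *v cvec v = 0" for c S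
  proof -
    define e where "e j = (\<Sum>k\<in>I. c k * d k j)" for j
    have SP: "S ** P = P ** diag_mat e"
    proof -
      have "S ** P = (\<Sum>k\<in>I. mat (c k) ** (P ** diag_mat (d k)))"
        by (simp add: S matrix_sum_rdistrib d flip: matrix_mul_assoc)
      then show ?thesis
        by (simp add: vec_eq_iff mult_diag_mat_nth e_def sum_distrib_left ac_simps)
    qed
    have "P *v (diag_mat e *v (matrix_inv P *v cvec v)) = S *v cvec v"
    proof -
      have "P ** (diag_mat e ** matrix_inv P) = S ** (P ** matrix_inv P)"
        by (simp only: SP matrix_mul_assoc)
      then show ?thesis by (simp add: matrix_vector_mul_assoc matrix_inv_right assms)
    qed
    then have "matrix_inv P *v (P *v (diag_mat e *v (matrix_inv P *v cvec v))) = 0"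
      by (simp add: Sv)
    then have "diag_mat e *v (matrix_inv P *v cvec v) = 0"
      by (simp add: matrix_vector_mul_assoc matrix_inv_left assms matrix_mul_assoc)
    then have "e j * (matrix_inv P *v cvec v) $ j = 0" for j
      by (simp add: vec_eq_iff diag_mat_def matrix_vector_mult_def[of "\<chi> i j. _ i j"] mult_delta_left)
    then have "e = (\<lambda>j. 0)" using v by fastforce
    then have "S ** P = 0" by (simp add: SP vec_eq_iff mult_diag_mat_nth)
    then have "S ** (P ** matrix_inv P) = 0" by (simp add: matrix_mul_assoc)
    then show "S = 0" by (simp add: matrix_inv_right assms)
  qed
  then show ?thesis by blast
qed

section \<open>Products and powers in a common eigenbasis\<close>

lemma diag_mat_mult: "diag_mat d ** diag_mat e = diag_mat (\<lambda>j. d j * e j)"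
  by (simp add: vec_eq_iff mult_diag_mat_nth) (simp add: diag_mat_def)

lemma diagonalized_mult:
  fixes A B P :: "complex^'m^'m"
  assumes "A ** P = P ** diag_mat d" "B ** P = P ** diag_mat e"
  shows "(A ** B) ** P = P ** diag_mat (\<lambda>j. d j * e j)"
proof -
  have "(A ** B) ** P = (A ** P) ** diag_mat e" by (simp add: assms(2) flip: matrix_mul_assoc)
  then show ?thesis by (simp add: assms(1) diag_mat_mult flip: matrix_mul_assoc)
qed

lemma diagonalized_matpow:
  fixes A P :: "complex^'m^'m"
  assumes "A ** P = P ** diag_mat d" shows "\<exists>e. matpow A k ** P = P ** diag_mat e"
proof (induction k)
  case 0
  have "diag_mat (\<lambda>j::'m. 1) = mat 1" by (simp add: vec_eq_iff diag_mat_def mat_def)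
  then show ?case by (intro exI[of _ "\<lambda>j. 1"]) simp
next
  case (Suc k)
  then show ?case using diagonalized_mult[OF _ assms] by (metis matpow.simps(2))
qed

text \<open>A non-zero polynomial of degree below CARD('r) cannot have CARD('r) distinct roots;
  counting roots replaces a determinant.\<close>

lemma vandermonde_injective:
  fixes x :: "'r::finite \<Rightarrow> real"
  assumes "inj x" and "\<And>\<sigma>. (\<Sum>s<CARD('r). c s * x \<sigma> ^ s) = 0" and "s < CARD('r)"
  shows "c s = 0"
proof (rule ccontr)
  assume "c s \<noteq> 0"
  obtain N where N: "CARD('r) = Suc N" using zero_less_card_finite[where 'a = 'r] gr0_conv_Suc by blast
  have *: "finite {z. (\<Sum>i\<le>N. c i * z ^ i) = 0} \<and> card {z. (\<Sum>i\<le>N. c i * z ^ i) = 0} \<le> N"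
    using \<open>c s \<noteq> 0\<close> assms(3) N by (intro polyfun_rootbound) (auto intro!: exI[of _ s])
  have "range x \<subseteq> {z. (\<Sum>i\<le>N. c i * z ^ i) = 0}"
    using assms(2) by (auto simp: N lessThan_Suc_atMost)
  then have "card (range x) \<le> N" using * by (meson card_mono le_trans)
  then show False using card_image[OF assms(1)] N by simp
qed

text \<open>Lists the pairs (k, s) as i = k * r + s, the numbering used for the integrals.\<close>

lemma sum_lessThan_mult:
  fixes f :: "nat \<Rightarrow> nat \<Rightarrow> 'a::comm_monoid_add"
  shows "(\<Sum>i<n * r. f (i div r) (i mod r)) = (\<Sum>k<n. \<Sum>s<r. f k s)"
proof (cases "r = 0")
  case False
  have "(\<Sum>i<n * r. f (i div r) (i mod r)) = (\<Sum>(k,s)\<in>{..<n} \<times> {..<r}. f k s)"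
  proof (rule sum.reindex_bij_witness[of _ "\<lambda>(k,s). k * r + s" "\<lambda>i. (i div r, i mod r)"])
    fix a assume a: "a \<in> {..<n} \<times> {..<r}"
    then obtain k s where ks: "a = (k, s)" "k < n" "s < r" by auto
    then have "k * r + s < Suc k * r" by simp
    also have "\<dots> \<le> n * r" using ks by (intro mult_le_mono1) simp
    finally show "(case a of (k, s) \<Rightarrow> k * r + s) \<in> {..<n * r}" by (simp add: ks)
    show "((case a of (k, s) \<Rightarrow> k * r + s) div r, (case a of (k, s) \<Rightarrow> k * r + s) mod r) = a"
      using ks by simp
  next
    fix i assume "i \<in> {..<n * r}"
    then show "(i div r, i mod r) \<in> {..<n} \<times> {..<r}"
      using False by (auto simp: less_mult_imp_div_less)
  qed auto
  then show ?thesis by (simp add: sum.cartesian_product)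
qed simp

subsection \<open>Liouville integrability\<close>

lemma scaleR_conv_mat_mult: "r *\<^sub>R A = mat (complex_of_real r) ** A" for A :: "complex^'m^'n"
  unfolding vec_eq_iff mat_mult_nth vector_scaleR_component by (simp add: scaleR_conv_of_real)

context lax_data
begin

text \<open>theta is its own conjugate and the phase c has modulus 1, so theta^2 is
  \<open>conjmat g ** g\<close>.\<close>

lemma theta_square:
  assumes "\<theta> \<in> \<Theta> W G\<^sub>0 \<omega> h" shows "\<theta> ** \<theta> = mat 1 \<or> \<theta> ** \<theta> = - mat 1"
proof -
  obtain c g where c: "cmod c = 1" and g: "g \<in> G\<^sub>0" "\<theta> = mat c ** g" "conjmat \<theta> = \<theta>"
    using assms by (auto simp: \<Theta>_def)
  have "cnj c * c = 1" using c by (simp add: complex_mult_cnj cmod_power2[symmetric] mult.commute)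
  have "\<theta> ** \<theta> = conjmat \<theta> ** \<theta>" using g(3) by simp
  also have "\<dots> = conjmat g ** g"
    unfolding g(2) conjmat_mult conjmat_mat mat_mult_mat_mult by (simp add: \<open>cnj c * c = 1\<close>)
  finally show ?thesis using G_conj[OF g(1)] by simp
qed

lemma theta_commute_K:
  assumes "\<theta> \<in> \<Theta> W G\<^sub>0 \<omega> h" shows "\<theta> ** K = K ** \<theta>"
proof -
  \<comment> \<open>Vacuous data with s = 0, supplied to enter the context of
    \<open>theta_commute\<close>; the constant coefficient of L is K.\<close>
  have "admissible 0 h 0 (\<lambda>_. 0)" by (simp add: admissible_def)
  from theta_commute[OF assms this, of 0] show ?thesis
    unfolding mconst_commute_iff by (metis mcoeff_L(1))
qed

text \<open>A common eigenbasis of K and all theta_k is built by adding one theta_k at a time; each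
  is an involution up to sign and commutes with K and with the earlier ones.\<close>

lemma exists_separating_vector:
  assumes diag: "diagonalizable K"
    and \<theta>: "\<And>k. k \<in> {1..n} \<Longrightarrow> \<theta> k \<in> \<Theta> W G\<^sub>0 \<omega> (hh k)"
    and comm: "\<And>j k. j \<in> {1..n} \<Longrightarrow> k \<in> {1..n} \<Longrightarrow> \<theta> j ** \<theta> k = \<theta> k ** \<theta> j"
  shows "\<exists>v :: real^'m. \<forall>c :: nat \<Rightarrow> complex.
    (\<Sum>k\<in>{1..n}. mat (c k) ** (\<theta> k ** matpow K (2 * k - 1))) *v cvec v = 0 \<longrightarrow>
    (\<Sum>k\<in>{1..n}. mat (c k) ** (\<theta> k ** matpow K (2 * k - 1))) = 0"
proof -
  have "vec.span (common_eigenvectors (insert K (\<theta> ` {1..i}))) = UNIV" if "i \<le> n" for i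
    using that
  proof (induction i)
    case 0
    then show ?case using span_eigenvectors_diagonalizable[OF diag] by simp
  next
    case (Suc i)
    have eq: "insert K (\<theta> ` {1..Suc i}) = insert (\<theta> (Suc i)) (insert K (\<theta> ` {1..i}))"
      by (simp add: atLeastAtMostSuc_conv insert_commute)
    have Suc_in: "Suc i \<in> {1..n}" using Suc by simp
    show ?case unfolding eq
    proof (rule span_eigenvectors_insert)
      show "vec.span (common_eigenvectors (insert K (\<theta> ` {1..i}))) = UNIV" using Suc by simp
      show "\<theta> (Suc i) ** \<theta> (Suc i) = mat 1 \<or> \<theta> (Suc i) ** \<theta> (Suc i) = - mat 1"
        by (rule theta_square[OF \<theta>[OF Suc_in]])
      fix B assume "B \<in> insert K (\<theta> ` {1..i})"
      then show "B ** \<theta> (Suc i) = \<theta> (Suc i) ** B"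
        using theta_commute_K[OF \<theta>[OF Suc_in]] comm[OF _ Suc_in] Suc by auto
    qed
  qed
  then obtain P :: "complex^'m^'m" where P: "invertible P"
    "\<And>A. A \<in> insert K (\<theta> ` {1..n}) \<Longrightarrow> \<exists>d. A ** P = P ** diag_mat d"
    using simultaneous_diagonalization[of "insert K (\<theta> ` {1..n})"] by blast
  show ?thesis
  proof (rule exists_real_separating_vector[OF P(1)])
    fix k assume k: "k \<in> {1..n}"
    obtain d e where "\<theta> k ** P = P ** diag_mat d" "K ** P = P ** diag_mat e"
      using P(2)[of "\<theta> k"] P(2)[of K] k by auto
    then show "\<exists>d. \<theta> k ** matpow K (2 * k - 1) ** P = P ** diag_mat d"
      using diagonalized_matpow diagonalized_mult by meson
  qed
qed

lemma M_single: "1 \<le> q \<Longrightarrow> M \<theta> q (\<lambda>j. if j = q then 1 else 0) \<Phi> = mconst \<theta> ** matpow (L \<Phi>) (q - 1)"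
proof -
  assume "1 \<le> q"
  have "M \<theta> q (\<lambda>j. if j = q then 1 else 0) \<Phi>
    = (\<Sum>j=1..q. if j = q then mconst \<theta> ** matpow (L \<Phi>) (j - 1) else 0)"
    unfolding M_def by (rule sum.cong) (auto simp: vec_eq_iff)
  then show ?thesis using \<open>1 \<le> q\<close> by simp
qed

lemma L_zero: "L 0 = mconst K"
proof (rule mcoeff_eqI)
  fix n
  have "rank_one 0 0 = 0" by (simp add: rank_one_def vec_eq_iff matrix_mult_nth)
  then show "mcoeff (L 0) n = mcoeff (mconst K) n"
    by (cases n) (simp_all add: mcoeff_mconst moment_def conj_by_def)
qed

lemma mconst_mult: "mconst A ** mconst B = mconst (A ** B)" for A :: "complex^'m^'m"
  by (rule mcoeff_eqI) (simp add: mcoeff_mconst_mult mcoeff_mconst)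

lemma mconst_matpow: "matpow (mconst A) k = mconst (matpow A k)" for A :: "complex^'m^'m"
proof (induction k)
  case 0
  show ?case by (rule mcoeff_eqI) (simp add: mcoeff_mat mcoeff_mconst)
qed (simp add: mconst_mult)

text \<open>At \<Phi> = 0 the Lax matrix is the constant K, so only the power lambda^p
  survives.\<close>

lemma plus_M_zero:
  assumes "1 \<le> q"
  shows "plus p (M \<theta> q (\<lambda>j. if j = q then 1 else 0) 0) z = mat (z ^ p) ** (\<theta> ** matpow K (q - 1))"
proof -
  have "plus p (M \<theta> q (\<lambda>j. if j = q then 1 else 0) 0) z
    = (\<Sum>i\<le>p. if i = p then mat (z ^ p) ** (\<theta> ** matpow K (q - 1)) else 0)"
    unfolding plus_def M_single[OF assms] L_zero mconst_matpow mconst_mult mcoeff_mconst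
    by (rule sum.cong) auto
  then show ?thesis by simp
qed

lemma liouville_integrable_hamiltonian:
  assumes n: "CARD('m) = 2 * n" and diag: "diagonalizable K"
    and \<theta>f: "\<theta>f \<in> \<Theta> W G\<^sub>0 \<omega> h" "admissible p h s bf"
    and \<theta>: "\<And>k. k \<in> {1..n} \<Longrightarrow> \<theta> k \<in> \<Theta> W G\<^sub>0 \<omega> (hh k)"
    and comm: "\<And>j k. j \<in> {1..n} \<Longrightarrow> k \<in> {1..n} \<Longrightarrow> \<theta> j ** \<theta> k = \<theta> k ** \<theta> j"
    and indep: "\<And>c :: nat \<Rightarrow> real. (\<Sum>j=1..n. c j *\<^sub>R (\<theta> j ** matpow K (2 * j - 1))) = 0
           \<Longrightarrow> \<forall>j\<in>{1..n}. c j = 0"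
  shows "liouville_integrable W (hamiltonian \<theta>f p s bf)"
proof -
  define R where "R = CARD('r)"
  define d where "d = n * R"
  have R_pos: "R > 0" by (simp add: R_def)
  have d: "CARD('m) * CARD('r) div 2 = d" by (simp add: n d_def R_def)
  \<comment> \<open>Index i encodes a pair (k, s), with k = \<open>kk i\<close> counted from 1 and s
    = \<open>i mod R\<close> shifting the power of lambda.\<close>
  define kk where "kk i = Suc (i div R)" for i
  \<comment> \<open>The least non-negative exponent p with h_k + 2k congruent to p + 1; adding
    multiples of m keeps the congruence and yields R exponents for each k.\<close>
  define p0 where "p0 k = nat ((hh k + int (2 * k) - 1) mod int m)" for k
  define pp where "pp i = p0 (kk i) + m * (i mod R)" for i
  \<comment> \<open>Selects the power 2k - 1, so that \<open>E i\<close> is a multiple of a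
    coefficient of tr(theta_k L^(2k)).\<close>
  define bb :: "nat \<Rightarrow> nat \<Rightarrow> real" where "bb k = (\<lambda>j. if j = 2 * k then 1 else 0)" for k
  define E where "E i = hamiltonian (\<theta> (kk i)) (pp i) (2 * kk i) (bb (kk i))" for i
  have kk: "kk i \<in> {1..n}" if "i < d" for i
    using that R_pos by (simp add: kk_def d_def less_mult_imp_div_less Suc_leI)
  have adm: "admissible (pp i) (hh (kk i)) (2 * kk i) (bb (kk i))" for i
    unfolding admissible_def
  proof (intro ballI impI conjI)
    fix j assume "bb (kk i) j \<noteq> 0"
    then have j: "j = 2 * kk i" by (simp add: bb_def split: if_splits)
    then show "even j" by simp
    have "int (p0 (kk i)) = (hh (kk i) + int j - 1) mod int m"
      using m_pos by (simp add: p0_def j)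
    then have "[int (pp i) = hh (kk i) + int j - 1] (mod int m)"
      by (simp add: pp_def cong_def)
    then have "[int (pp i) + 1 = hh (kk i) + int j - 1 + 1] (mod int m)"
      by (intro cong_add) auto
    then show "[hh (kk i) + int j = int (pp i) + 1] (mod int m)" by (simp add: cong_sym)
  qed
  note E\<theta> = \<theta>[OF kk]
  have poly: "real_polynomial_function (E i)" for i
    by (simp add: E_def real_polynomial_function_hamiltonian)
  have grad_E: "gradient (E i) \<Phi> $ \<sigma> $ j
      = Re (grad (\<theta> (kk i)) (pp i) (2 * kk i) (bb (kk i)) \<Phi> \<sigma> $ j)" if "i < d" for i \<Phi> \<sigma> j
    by (simp add: gradient_def E_def pd_hamiltonian[OF E\<theta>[OF that] adm])

  obtain v :: "real^'m" where v: "\<And>c :: nat \<Rightarrow> complex.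
    (\<Sum>k\<in>{1..n}. mat (c k) ** (\<theta> k ** matpow K (2 * k - 1))) *v cvec v = 0 \<Longrightarrow>
    (\<Sum>k\<in>{1..n}. mat (c k) ** (\<theta> k ** matpow K (2 * k - 1))) = 0"
    using exists_separating_vector[where n = n and \<theta> = \<theta> and hh = hh, OF diag \<theta> comm] by blast
  \<comment> \<open>One vector in all columns suffices: the columns are told apart by the values
    \<open>l \<sigma>\<close>.\<close>
  define \<Phi>0 :: "real^'m^'r" where "\<Phi>0 = (\<chi> \<sigma>. v)"
  \<comment> \<open>The gradient on the ray with its scale factor divided out: the matrix still
    depends on \<Phi>, the vector is fixed as v.\<close>
  define cf where "cf i \<Phi> \<sigma> = (cmat W ** plus (pp i) (M (\<theta> (kk i)) (2 * kk i) (bb (kk i)) \<Phi>) (complex_of_real (l \<sigma>))) *v cvec v" for i \<Phi> \<sigma>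
  define w :: "nat \<Rightarrow> real^'m^'r \<Rightarrow> real^'m^'r" where "w i \<Phi> = (\<chi> \<sigma> j. Re (cf i \<Phi> \<sigma> $ j))" for i \<Phi>
  have grad_w: "gradient (E i) (t *\<^sub>R \<Phi>0) = t *\<^sub>R w i (t *\<^sub>R \<Phi>0)" if "i < d" for i t
  proof -
    have "cvec (t *\<^sub>R v) = complex_of_real t *s cvec v" by (simp add: vec_eq_iff)
    then have "gradient (E i) (t *\<^sub>R \<Phi>0) $ \<sigma> $ j = (t *\<^sub>R w i (t *\<^sub>R \<Phi>0)) $ \<sigma> $ j" for \<sigma> j
      by (simp add: grad_E[OF that] grad_def w_def cf_def \<Phi>0_def matrix_vector_mult_smult)
    then show ?thesis by (simp add: vec_eq_iff)
  qed

  have w0: "\<forall>i<d. c i = 0" if c: "(\<Sum>i<d. c i *\<^sub>R w i 0) = 0" for c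
  proof -
    let ?A = "\<lambda>k. \<theta> k ** matpow K (2 * k - 1)"
    \<comment> \<open>Collects over s the coefficient of theta_k K^(2k-1) in column
      \<sigma>.\<close>
    define a where "a \<sigma> k = (\<Sum>s<R. c ((k - 1) * R + s) * l \<sigma> ^ (p0 k + m * s))" for \<sigma> k
    have a0: "a \<sigma> k = 0" if k: "k \<in> {1..n}" for \<sigma> k
    proof -
      have cf0: "cf i 0 \<sigma> = (cmat W ** (mat (complex_of_real (l \<sigma>) ^ pp i) ** ?A (kk i))) *v cvec v" for i
        unfolding cf_def bb_def by (subst plus_M_zero) (simp_all add: kk_def)
      have "(\<Sum>i<d. complex_of_real (c i) *s cf i 0 \<sigma>) $ j = 0" for j
      proof -
        have "complex_of_real (Re (cf i 0 \<sigma> $ j)) = cf i 0 \<sigma> $ j" if "i < d" for i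
          using cnj_gradient_form[OF E\<theta>[OF that] adm] by (simp add: cf_def complex_eq_iff)
        then have "(\<Sum>i<d. complex_of_real (c i) *s cf i 0 \<sigma>) $ j
            = complex_of_real ((\<Sum>i<d. c i *\<^sub>R w i 0) $ \<sigma> $ j)"
          by (simp add: w_def)
        then show ?thesis using c by simp
      qed
      then have 1: "(\<Sum>i<d. complex_of_real (c i) *s cf i 0 \<sigma>) = 0" by (simp add: vec_eq_iff)
      have "complex_of_real (c i) *s cf i 0 \<sigma>
          = (cmat W ** (mat (complex_of_real (c i * l \<sigma> ^ pp i)) ** ?A (kk i))) *v cvec v" for i
      proof -
        have "complex_of_real (c i) *s cf i 0 \<sigma> = mat (complex_of_real (c i)) *v cf i 0 \<sigma>"
          by (simp add: vec_eq_iff)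
        then show ?thesis
          by (simp add: cf0 matrix_vector_mul_assoc mat_mult_assoc'[of "cmat W"])
      qed
      with 1 have "(\<Sum>i<d. (cmat W ** (mat (complex_of_real (c i * l \<sigma> ^ pp i)) ** ?A (kk i))) *v cvec v) = 0"
        by simp
      then have "cmat W *v ((\<Sum>i<d. mat (complex_of_real (c i * l \<sigma> ^ pp i)) ** ?A (kk i)) *v cvec v) = 0"
        unfolding matrix_vector_mul_assoc unfolding matrix_sum_ldistrib
        unfolding matrix_vector_sum_rdistrib .
      then have "matrix_inv (cmat W) *v (cmat W *v ((\<Sum>i<d. mat (complex_of_real (c i * l \<sigma> ^ pp i)) ** ?A (kk i)) *v cvec v)) = 0"
        by simp
      then have 2: "(\<Sum>i<d. mat (complex_of_real (c i * l \<sigma> ^ pp i)) ** ?A (kk i)) *v cvec v = 0"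
        unfolding matrix_vector_mul_assoc matrix_mul_assoc[of "matrix_inv (cmat W)"]
        by (simp add: matrix_inv_left invertible_cmat W_invertible)
      have "(\<Sum>i<d. mat (complex_of_real (c i * l \<sigma> ^ pp i)) ** ?A (kk i))
          = (\<Sum>k<n. \<Sum>s<R. mat (complex_of_real (c (k * R + s) * l \<sigma> ^ (p0 (Suc k) + m * s))) ** ?A (Suc k))"
        unfolding d_def kk_def pp_def
        by (subst sum_lessThan_mult[symmetric]) simp
      also have "\<dots> = (\<Sum>k<n. mat (complex_of_real (a \<sigma> (Suc k))) ** ?A (Suc k))"
        by (rule sum.cong) (simp_all add: a_def vec_eq_iff sum_distrib_right)
      also have "\<dots> = (\<Sum>k\<in>{1..n}. mat (complex_of_real (a \<sigma> k)) ** ?A k)"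
        by (rule sum.reindex_bij_witness[of _ "\<lambda>k. k - 1" Suc]) auto
      finally have eq: "(\<Sum>i<d. mat (complex_of_real (c i * l \<sigma> ^ pp i)) ** ?A (kk i))
          = (\<Sum>k\<in>{1..n}. mat (complex_of_real (a \<sigma> k)) ** ?A k)" .
      \<comment> \<open>The choice of v lifts the vanishing on v to a matrix identity; its
        coefficients are real, as \<open>indep\<close> requires.\<close>
      have "(\<Sum>k=1..n. a \<sigma> k *\<^sub>R ?A k) = 0"
        using v[of "\<lambda>k. complex_of_real (a \<sigma> k)"] 2 unfolding eq by (simp add: scaleR_conv_mat_mult)
      then show ?thesis using indep k by blast
    qed
    have "c i = 0" if i: "i < d" for i
    proof -
      let ?k = "kk i"
      \<comment> \<open>For even m the power loses the sign of \<open>l \<sigma>\<close>, so the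
        absolute values must be separated; distinct squares do that.\<close>
      have inj: "inj (\<lambda>\<sigma>. l \<sigma> ^ m)"
      proof (rule injI)
        fix \<sigma> \<tau> assume "l \<sigma> ^ m = l \<tau> ^ m"
        then have "\<bar>l \<sigma>\<bar> ^ m = \<bar>l \<tau>\<bar> ^ m" by (simp flip: power_abs)
        then have "\<bar>l \<sigma>\<bar> = \<bar>l \<tau>\<bar>" using m_pos by (meson abs_ge_zero power_eq_imp_eq_base)
        then have "(l \<sigma>)\<^sup>2 = (l \<tau>)\<^sup>2" by (metis power2_abs)
        then show "\<sigma> = \<tau>" using l_inj by (simp add: inj_def)
      qed
      have "(\<Sum>s<CARD('r). c (i div R * R + s) * (l \<sigma> ^ m) ^ s) = 0" for \<sigma>
      proof -
        \<comment> \<open>For fixed k a polynomial of degree below R in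
          \<open>l \<sigma> ^ m\<close> remains, up to a non-zero factor.\<close>
        have "a \<sigma> ?k = l \<sigma> ^ p0 ?k * (\<Sum>s<R. c (i div R * R + s) * (l \<sigma> ^ m) ^ s)"
          unfolding a_def kk_def power_add power_mult by (simp add: sum_distrib_left ac_simps)
        then show ?thesis using a0[OF kk[OF i]] l_nonzero by (simp add: R_def)
      qed
      from vandermonde_injective[OF inj this, of "i mod R"] show ?thesis
        using R_pos by (simp add: R_def)
    qed
    then show ?thesis by blast
  qed

  have dle: "d \<le> CARD('r) * CARD('m)" by (simp add: d_def R_def n)
  \<comment> \<open>Formed from \<open>w\<close> and not from the gradients, which all vanish at
    0.\<close>
  define g where "g \<Phi> = det (gram d (\<lambda>i. w i \<Phi>))" for \<Phi>
  have g_poly: "real_polynomial_function g" unfolding g_def[abs_def]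
  proof (rule real_polynomial_function_gram_det)
    fix i s j
    have "complex_polynomial_function (\<lambda>\<Phi>. cf i \<Phi> s $ j)"
      unfolding cf_def matrix_vector_mult_def vec_lambda_beta matrix_mult_nth
      by (intro complex_polynomial_function_sum complex_polynomial_function_mult
          complex_polynomial_function_const plus_M_polynomial)
    then show "real_polynomial_function (\<lambda>\<Phi>. w i \<Phi> $ s $ j)"
      by (simp add: w_def complex_polynomial_function_def)
  qed
  have "g 0 \<noteq> 0" unfolding g_def gram_det_nonzero_iff[OF dle] using w0 by blast
  then obtain e where e: "e > 0" "ball 0 e \<subseteq> {\<Phi>. g \<Phi> \<noteq> 0}"
    using nonvanishing_set_open_dense(1)[OF g_poly, of 0] open_contains_ball by blast
  \<comment> \<open>Small enough for \<open>t *\<^sub>R \<Phi>0\<close> to lie in the ball; the 1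
    keeps the denominator positive.\<close>
  define t where "t = e / (2 * (norm \<Phi>0 + 1))"
  have pos: "norm \<Phi>0 + 1 > 0" by (smt (verit) norm_ge_zero)
  have t: "t > 0" using e(1) pos by (simp add: t_def)
  have "norm (t *\<^sub>R \<Phi>0) < t * (2 * (norm \<Phi>0 + 1))"
    unfolding norm_scaleR abs_of_pos[OF t] using t by (simp add: distrib_left add_nonneg_pos)
  also have "\<dots> = e" using pos by (simp add: t_def)
  finally have "t *\<^sub>R \<Phi>0 \<in> ball 0 e" by simp
  then have gt: "g (t *\<^sub>R \<Phi>0) \<noteq> 0" using e(2) by blast

  define D where "D \<Phi> = det (gram d (\<lambda>i. gradient (E i) \<Phi>))" for \<Phi>
  have D_poly: "real_polynomial_function D" unfolding D_def[abs_def]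
    by (rule real_polynomial_function_gram_det) (simp add: gradient_def real_polynomial_function_pd poly)
  have D_iff: "D \<Phi> \<noteq> 0 \<longleftrightarrow> functionally_independent_at d E \<Phi>" for \<Phi>
    unfolding D_def functionally_independent_at_def by (rule gram_det_nonzero_iff[OF dle])
  have "D (t *\<^sub>R \<Phi>0) \<noteq> 0"
    unfolding D_iff functionally_independent_at_def
  proof (intro allI impI)
    fix c i assume c: "(\<Sum>i<d. c i *\<^sub>R gradient (E i) (t *\<^sub>R \<Phi>0)) = 0" and i: "i < d"
    have "(\<Sum>i<d. (c i * t) *\<^sub>R w i (t *\<^sub>R \<Phi>0)) = 0" using c by (simp add: grad_w)
    then have "\<forall>i<d. c i * t = 0"
      using spec[OF gt[unfolded g_def gram_det_nonzero_iff[OF dle]], of "\<lambda>i. c i * t"] by blast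
    then show "c i = 0" using i t by simp
  qed
  note dense = nonvanishing_set_open_dense[OF D_poly this]

  show ?thesis
    unfolding liouville_integrable_def Let_def d
  proof (intro conjI exI[of _ E])
    show "smooth (hamiltonian \<theta>f p s bf)" by (intro real_polynomial_function_smooth real_polynomial_function_hamiltonian)
    show "\<forall>i<d. smooth (E i)" by (simp add: real_polynomial_function_smooth poly)
    show "\<forall>i<d. \<forall>\<Phi>. poisson W (E i) (hamiltonian \<theta>f p s bf) \<Phi> = 0"
      unfolding E_def using poisson_hamiltonian_eq_0[OF E\<theta> adm \<theta>f] by blast
    show "\<forall>i<d. \<forall>j<d. \<forall>\<Phi>. poisson W (E i) (E j) \<Phi> = 0"
      unfolding E_def using poisson_hamiltonian_eq_0[OF E\<theta> adm E\<theta> adm] by blast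
    show "\<exists>U. open U \<and> closure U = UNIV \<and> (\<forall>\<Phi>\<in>U. functionally_independent_at d E \<Phi>)"
      using dense D_iff by blast
  qed
qed

end

subsection \<open>The reduction group\<close>

abbreviation (input) eq_up_to_sign :: "complex^'m^'m \<Rightarrow> complex^'m^'m \<Rightarrow> bool" (infix "\<approx>\<^sub>\<plusminus>" 50) where
  "A \<approx>\<^sub>\<plusminus> B \<equiv> A = B \<or> A = - B"

lemma Sp_carrier: "A \<in> carrier (Sp_group W) \<longleftrightarrow> invertible A \<and> transpose A ** cmat W ** A = cmat W"
  by (simp add: Sp_group_def)

lemma Sp_mult [simp]: "A \<otimes>\<^bsub>Sp_group W\<^esub> B = A ** B"
  and Sp_one [simp]: "\<one>\<^bsub>Sp_group W\<^esub> = mat 1"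
  by (simp_all add: Sp_group_def)

lemma matrix_inv_symplectic:
  fixes A Z :: "'a::comm_semiring_1^'m^'m"
  assumes "invertible A" "transpose A ** Z ** A = Z"
  shows "transpose (matrix_inv A) ** Z ** matrix_inv A = Z"
proof -
  have "transpose (matrix_inv A) ** transpose A = mat 1"
    by (simp add: matrix_inv_right assms(1) flip: matrix_transpose_mul)
  moreover have "transpose (matrix_inv A) ** Z ** matrix_inv A
      = (transpose (matrix_inv A) ** transpose A) ** Z ** (A ** matrix_inv A)"
    by (subst (1) assms(2)[symmetric]) (simp only: matrix_mul_assoc)
  ultimately show ?thesis by (simp add: matrix_inv_right assms(1))
qed

lemma invertible_matrix_inv: "invertible A \<Longrightarrow> invertible (matrix_inv A)"
  by (metis invertible_def matrix_inv_left matrix_inv_right)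

lemma group_Sp_group: "group (Sp_group W)"
proof (rule groupI)
  fix A B assume "A \<in> carrier (Sp_group W)" "B \<in> carrier (Sp_group W)"
  then have A: "invertible A" "transpose A ** cmat W ** A = cmat W"
    and B: "invertible B" "transpose B ** cmat W ** B = cmat W" by (auto simp: Sp_carrier)
  have "transpose (A ** B) ** cmat W ** (A ** B) = transpose B ** (transpose A ** cmat W ** A) ** B"
    by (simp only: matrix_transpose_mul matrix_mul_assoc)
  then show "A \<otimes>\<^bsub>Sp_group W\<^esub> B \<in> carrier (Sp_group W)"
    by (simp add: Sp_carrier A B invertible_mult)
next
  fix A assume "A \<in> carrier (Sp_group W)"
  then show "\<exists>B\<in>carrier (Sp_group W). B \<otimes>\<^bsub>Sp_group W\<^esub> A = \<one>\<^bsub>Sp_group W\<^esub>"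
    by (intro bexI[of _ "matrix_inv A"])
       (auto simp: Sp_carrier matrix_inv_left matrix_inv_symplectic invertible_matrix_inv)
qed (auto simp: Sp_carrier matrix_mul_assoc transpose_mat invertible_def intro: exI[of _ "mat 1"])

lemma Sp_inv: "A \<in> carrier (Sp_group W) \<Longrightarrow> inv\<^bsub>Sp_group W\<^esub> A = matrix_inv A"
  by (rule group.inv_equality[OF group_Sp_group])
     (auto simp: Sp_carrier matrix_inv_left matrix_inv_symplectic invertible_matrix_inv)

section \<open>The quotient by plus and minus the identity\<close>

lemma pr_eq: "pr W A = {A, - A}"
  by (auto simp: pr_def pmI_def r_coset_def)

lemma pr_eq_iff: "pr W A = pr W B \<longleftrightarrow> A \<approx>\<^sub>\<plusminus> B"
  by (auto simp: pr_eq doubleton_eq_iff)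

lemma uminus_in_Sp: "A \<in> carrier (Sp_group W) \<Longrightarrow> - A \<in> carrier (Sp_group W)"
  unfolding Sp_carrier invertible_def transpose_minus
  by (metis matrix_mult_minus_left matrix_mult_minus_right minus_minus)

lemma normal_pmI: "pmI \<lhd> Sp_group W" for W :: "real^'m^'m"
proof -
  interpret group "Sp_group W" by (rule group_Sp_group)
  have "mat 1 \<in> carrier (Sp_group W)" using one_closed by simp
  then have "pmI \<subseteq> carrier (Sp_group W)" by (auto simp: pmI_def uminus_in_Sp)
  moreover have "inv\<^bsub>Sp_group W\<^esub> A \<in> pmI" if "A \<in> pmI" for A
  proof -
    have "inv\<^bsub>Sp_group W\<^esub> A = A"
      using that \<open>pmI \<subseteq> _\<close> by (intro inv_equality) (auto simp: pmI_def)
    then show ?thesis using that by simp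
  qed
  moreover have "A ** B \<in> pmI" if "A \<in> pmI" "B \<in> pmI" for A B :: "complex^'m^'m"
    using that unfolding pmI_def by fastforce
  moreover have "pmI \<noteq> {}" by (simp add: pmI_def)
  ultimately have "subgroup pmI (Sp_group W)"
    by (intro subgroupI) (simp_all only: Sp_mult)
  then show ?thesis by (rule normalI) (auto simp: r_coset_def l_coset_def pmI_def)
qed

lemma pr_mult: "pr W A <#>\<^bsub>Sp_group W\<^esub> pr W B = pr W (A ** B)"
  by (auto simp: set_mult_def pr_eq)

lemma pr_one: "pr W (mat 1) = pmI"
  by (simp add: pr_eq pmI_def)

lemma pr_closed: "A \<in> carrier (Sp_group W) \<Longrightarrow> pr W A \<in> carrier (Sp_group W Mod pmI)"
  by (auto simp: FactGroup_def RCOSETS_def pr_def)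

lemma group_quotient: "group (Sp_group W Mod pmI)"
  by (rule normal.factorgroup_is_group[OF normal_pmI])

lemma pr_inv: "A \<in> carrier (Sp_group W) \<Longrightarrow> inv\<^bsub>Sp_group W Mod pmI\<^esub> (pr W A) = pr W (matrix_inv A)"
  by (rule group.inv_equality[OF group_quotient])
     (auto simp: pr_mult pr_one matrix_inv_left Sp_carrier matrix_inv_symplectic invertible_matrix_inv intro!: pr_closed)

lemma pr_pow: "A \<in> carrier (Sp_group W) \<Longrightarrow> pr W A [^]\<^bsub>Sp_group W Mod pmI\<^esub> (k::nat) = pr W (matpow A k)"
  by (induction k) (simp_all add: pr_mult pr_one group.is_monoid[OF group_quotient] monoid.nat_pow_0 monoid.nat_pow_Suc)

lemma sign_mult: "A \<approx>\<^sub>\<plusminus> B \<Longrightarrow> C \<approx>\<^sub>\<plusminus> D \<Longrightarrow> A ** C \<approx>\<^sub>\<plusminus> B ** D"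
  by auto

locale twisted_group =
  fixes W :: "real^'m^'m" and G\<^sub>0 :: "(complex^'m^'m) set" and N :: nat
    and \<Omega> :: "nat \<Rightarrow> complex^'m^'m" and \<omega> :: "complex^'m^'m \<Rightarrow> complex"
  assumes sub: "subgroup G\<^sub>0 (Sp_group W)" and fin: "finite G\<^sub>0"
    and G_conj: "\<And>A. A \<in> G\<^sub>0 \<Longrightarrow> conjmat A ** A = mat 1 \<or> conjmat A ** A = - mat 1"
    and \<Omega>_G: "\<And>a. a \<in> {1..N} \<Longrightarrow> \<Omega> a \<in> G\<^sub>0"
    and gen: "generate (Sp_group W Mod pmI) ((\<lambda>a. pr W (\<Omega> a)) ` {1..N}) = pr W ` G\<^sub>0"
    and hom: "\<omega> \<in> hom ((Sp_group W)\<lparr>carrier := G\<^sub>0\<rparr>) circle_group"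
    and \<omega>_pmI: "\<And>A. A \<in> G\<^sub>0 \<Longrightarrow> A \<in> pmI \<Longrightarrow> \<omega> A = 1"
begin

lemma G_Sp: "A \<in> G\<^sub>0 \<Longrightarrow> A \<in> carrier (Sp_group W)"
  using subgroup.subset[OF sub] by blast

lemma G_invertible: "A \<in> G\<^sub>0 \<Longrightarrow> invertible A"
  and G_symplectic: "A \<in> G\<^sub>0 \<Longrightarrow> transpose A ** cmat W ** A = cmat W"
  using G_Sp by (auto simp: Sp_carrier)

lemma G_one: "mat 1 \<in> G\<^sub>0" using subgroup.one_closed[OF sub] by simp

lemma G_mult: "A \<in> G\<^sub>0 \<Longrightarrow> B \<in> G\<^sub>0 \<Longrightarrow> A ** B \<in> G\<^sub>0"
  using subgroup.m_closed[OF sub] by simp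

lemma G_inv: "A \<in> G\<^sub>0 \<Longrightarrow> matrix_inv A \<in> G\<^sub>0"
  using subgroup.m_inv_closed[OF sub] Sp_inv[OF G_Sp] by simp

lemma G_matpow: "A \<in> G\<^sub>0 \<Longrightarrow> matpow A k \<in> G\<^sub>0"
  by (induction k) (simp_all add: G_one G_mult)

lemma \<omega>_mult: "A \<in> G\<^sub>0 \<Longrightarrow> B \<in> G\<^sub>0 \<Longrightarrow> \<omega> (A ** B) = \<omega> A * \<omega> B"
  using hom by (auto simp: hom_def circle_group_def)

lemma \<omega>_norm: "A \<in> G\<^sub>0 \<Longrightarrow> cmod (\<omega> A) = 1"
  using hom by (auto simp: hom_def circle_group_def)

lemma \<omega>_one: "\<omega> (mat 1) = 1"
  by (rule \<omega>_pmI) (simp_all add: G_one pmI_def)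

lemma \<omega>_matpow: "A \<in> G\<^sub>0 \<Longrightarrow> \<omega> (matpow A k) = \<omega> A ^ k"
  by (induction k) (simp_all add: \<omega>_one \<omega>_mult G_matpow mult.commute)

text \<open>If A and - A lie in \<open>G\<^sub>0\<close>, so does - I, whose character value is 1.
  As - I need not belong to \<open>G\<^sub>0\<close>, sign invariance is stated for pairs within the
  group.\<close>

lemma \<omega>_uminus: "A \<in> G\<^sub>0 \<Longrightarrow> - A \<in> G\<^sub>0 \<Longrightarrow> \<omega> (- A) = \<omega> A"
proof -
  assume A: "A \<in> G\<^sub>0" "- A \<in> G\<^sub>0"
  have "matrix_inv A ** (- A) = - mat 1" by (simp add: matrix_inv_left G_invertible A)
  then have "- mat 1 \<in> G\<^sub>0" using G_mult[OF G_inv[OF A(1)] A(2)] by simp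
  then have "\<omega> (A ** (- mat 1)) = \<omega> A * 1"
    by (subst \<omega>_mult[OF A(1)]) (auto simp: pmI_def \<omega>_pmI)
  then show ?thesis by simp
qed

text \<open>Generation is only known in the quotient, so a word in the generators reaches A up to
  sign; the last case repairs the sign.\<close>

lemma G_induct [consumes 1, case_names one gen inv mult uminus]:
  assumes A: "A \<in> G\<^sub>0" and "Q (mat 1)" and "\<And>a. a \<in> {1..N} \<Longrightarrow> Q (\<Omega> a)"
    and "\<And>A. A \<in> G\<^sub>0 \<Longrightarrow> Q A \<Longrightarrow> Q (matrix_inv A)"
    and "\<And>A B. A \<in> G\<^sub>0 \<Longrightarrow> B \<in> G\<^sub>0 \<Longrightarrow> Q A \<Longrightarrow> Q B \<Longrightarrow> Q (A ** B)"
    and minus: "\<And>A. A \<in> G\<^sub>0 \<Longrightarrow> - A \<in> G\<^sub>0 \<Longrightarrow> Q A \<Longrightarrow> Q (- A)"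
  shows "Q A"
proof -
  have *: "\<exists>B\<in>G\<^sub>0. X = pr W B \<and> Q B"
    if "X \<in> generate (Sp_group W Mod pmI) ((\<lambda>a. pr W (\<Omega> a)) ` {1..N})" for X
    using that
  proof (induction X rule: generate.induct)
    case one
    then show ?case using assms(2) G_one pr_one[of W] by (intro bexI[of _ "mat 1"]) simp_all
  next
    case (incl X)
    then show ?case using assms(3) \<Omega>_G by blast
  next
    case (inv X)
    then obtain a where a: "a \<in> {1..N}" "X = pr W (\<Omega> a)" by blast
    then show ?case
      using assms(3,4) \<Omega>_G[OF a(1)] G_inv pr_inv[OF G_Sp] by metis
  next
    case (eng X Y)
    then show ?case using assms(5) G_mult pr_mult mult_FactGroup by metis
  qed
  have "pr W A \<in> generate (Sp_group W Mod pmI) ((\<lambda>a. pr W (\<Omega> a)) ` {1..N})"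
    unfolding gen using A by blast
  then obtain B where B: "B \<in> G\<^sub>0" "pr W A = pr W B" "Q B" using * by blast
  then have "A = B \<or> A = - B" by (simp add: pr_eq_iff)
  then show ?thesis using B minus A by auto
qed

abbreviation ordm :: "nat \<Rightarrow> nat" where "ordm a \<equiv> ord_pr W \<Omega> a"

lemma matpow_ord: "a \<in> {1..N} \<Longrightarrow> matpow (\<Omega> a) (ordm a) \<approx>\<^sub>\<plusminus> mat 1"
proof -
  assume a: "a \<in> {1..N}"
  note Sp = G_Sp[OF \<Omega>_G[OF a]]
  have "pr W (matpow (\<Omega> a) (ordm a)) = pr W (mat 1)"
    using group.pow_ord_eq_1[OF group_quotient pr_closed[OF Sp]]
    by (simp add: pr_pow[OF Sp] pr_one ord_pr_def)
  then show ?thesis by (simp add: pr_eq_iff)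
qed

text \<open>\<open>group.ord\<close> is 0 for infinite order; this is excluded because the powers of
  a generator repeat in the finite group.\<close>

lemma ord_pos: "a \<in> {1..N} \<Longrightarrow> ordm a > 0"
proof -
  assume a: "a \<in> {1..N}"
  note Sp = G_Sp[OF \<Omega>_G[OF a]]
  have "\<not> inj (matpow (\<Omega> a))"
    using finite_imageD[of "matpow (\<Omega> a)" UNIV] finite_subset[OF _ fin, of "range (matpow (\<Omega> a))"] G_matpow[OF \<Omega>_G[OF a]]
    by auto
  then obtain i j where ij: "i < j" "matpow (\<Omega> a) i = matpow (\<Omega> a) j"
    unfolding inj_def by (metis linorder_neqE_nat)
  then have "matpow (\<Omega> a) (i + (j - i)) = matpow (\<Omega> a) i" by simp
  then have "matpow (\<Omega> a) i ** matpow (\<Omega> a) (j - i) = matpow (\<Omega> a) i ** mat 1"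
    unfolding matpow_add by simp
  then have "matpow (\<Omega> a) (j - i) = mat 1"
    using matrix_left_cancel[OF G_invertible[OF G_matpow[OF \<Omega>_G[OF a]]]] by blast
  then have "ordm a dvd (j - i)"
    unfolding ord_pr_def
    by (subst group.pow_eq_id[OF group_quotient pr_closed[OF Sp], symmetric]) (simp add: pr_pow[OF Sp] pr_one)
  then show ?thesis using ij(1) by (metis dvd_0_left_iff gr0I zero_less_diff less_numeral_extra(3))
qed

text \<open>The m_a-th power of a generator is plus or minus the identity, where omega is 1, and m_0
  is a multiple of m_a.\<close>

lemma \<omega>_pow_m0: "A \<in> G\<^sub>0 \<Longrightarrow> \<omega> A ^ m0 W \<Omega> N = 1"
proof (induction rule: G_induct)
  case one
  show ?case by (simp add: \<omega>_one)
next
  case (gen a)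
  have "\<omega> (matpow (\<Omega> a) (ordm a)) = 1"
    using matpow_ord[OF gen] G_matpow[OF \<Omega>_G[OF gen]] by (intro \<omega>_pmI) (auto simp: pmI_def)
  then have *: "\<omega> (\<Omega> a) ^ ordm a = 1" by (simp add: \<omega>_matpow \<Omega>_G[OF gen])
  have "ordm a dvd m0 W \<Omega> N" unfolding m0_def using gen by (intro dvd_Lcm) auto
  then show ?case using * by (auto simp: power_mult elim!: dvdE)
next
  case (inv A)
  have "\<omega> (matrix_inv A) ^ m0 W \<Omega> N * \<omega> A ^ m0 W \<Omega> N = \<omega> (matrix_inv A ** A) ^ m0 W \<Omega> N"
    using inv by (simp add: \<omega>_mult G_inv power_mult_distrib)
  then show ?case using inv by (simp add: matrix_inv_left G_invertible \<omega>_one)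
next
  case (mult A B)
  then show ?case by (simp add: \<omega>_mult power_mult_distrib)
next
  case (uminus A)
  then show ?case by (simp add: \<omega>_uminus)
qed

lemma m0_pos: "m0 W \<Omega> N > 0"
proof -
  have "0 \<notin> ordm ` {1..N}" using ord_pos by force
  then show ?thesis unfolding m0_def by (metis Lcm_0_iff finite_atLeastAtMost finite_imageI gr0I)
qed

text \<open>Since \<open>A\<^sup>-\<^sup>1\<close> is the conjugate of \<open>A\<close> up to sign on all of \<open>G\<^sub>0\<close>, inversion is
  multiplicative up to sign, which makes \<open>G\<^sub>0\<close> commutative up to sign.\<close>

lemma G_commute: "A \<in> G\<^sub>0 \<Longrightarrow> B \<in> G\<^sub>0 \<Longrightarrow> A ** B \<approx>\<^sub>\<plusminus> B ** A"
proof -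
  assume A: "A \<in> G\<^sub>0" and B: "B \<in> G\<^sub>0"
  have swap: "X ** conjmat X \<approx>\<^sub>\<plusminus> mat 1" if X: "X \<in> G\<^sub>0" for X
  proof -
    have "X ** conjmat X = X ** (conjmat X ** X) ** matrix_inv X"
      by (simp add: matrix_inv_right G_invertible X flip: matrix_mul_assoc)
    then show ?thesis using G_conj[OF X] by (auto simp: matrix_inv_right G_invertible X)
  qed
  have "conjmat A ** conjmat B ** A ** B \<approx>\<^sub>\<plusminus> mat 1"
    using G_conj[OF G_mult[OF A B]] by (simp add: conjmat_mult matrix_mul_assoc)
  \<comment> \<open>With \<open>B ** A\<close> on the left the conjugates cancel from the inside,
    first that of A, then that of B.\<close>
  then have "B ** A ** (conjmat A ** conjmat B ** A ** B) \<approx>\<^sub>\<plusminus> B ** A"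
    by auto
  moreover have "B ** A ** (conjmat A ** conjmat B ** A ** B) = B ** (A ** conjmat A) ** conjmat B ** (A ** B)"
    by (simp only: matrix_mul_assoc)
  moreover have "\<dots> \<approx>\<^sub>\<plusminus> B ** conjmat B ** (A ** B)" using swap[OF A] by auto
  moreover have "B ** conjmat B ** (A ** B) \<approx>\<^sub>\<plusminus> A ** B" using swap[OF B] by auto
  ultimately show ?thesis by (metis minus_minus)
qed

section \<open>Ordered products of generators and sums over exponents\<close>

lemma Omega_pow_G: "k \<le> N \<Longrightarrow> Omega_pow \<Omega> k \<alpha> \<in> G\<^sub>0"
  by (induction k) (auto simp: G_one G_mult G_matpow \<Omega>_G)

lemma omega_pow_eq: "omega_pow \<omega> \<Omega> N \<alpha> = \<omega> (Omega_pow \<Omega> N \<alpha>)"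
proof -
  have "k \<le> N \<Longrightarrow> \<omega> (Omega_pow \<Omega> k \<alpha>) = (\<Prod>a=1..k. \<omega> (\<Omega> a) ^ \<alpha> a)" for k
    by (induction k) (simp_all add: \<omega>_one \<omega>_mult Omega_pow_G G_matpow \<Omega>_G \<omega>_matpow)
  then show ?thesis by (simp add: omega_pow_def)
qed

lemma Omega_pow_upd_beyond: "k < a \<Longrightarrow> Omega_pow \<Omega> k (\<alpha>(a := x)) = Omega_pow \<Omega> k \<alpha>"
  by (induction k) auto

text \<open>The new factor moves past the earlier generators, up to sign, until it joins its own
  power.\<close>

lemma Omega_pow_shift:
  "a \<in> {1..k} \<Longrightarrow> k \<le> N \<Longrightarrow> \<Omega> a ** Omega_pow \<Omega> k \<alpha> \<approx>\<^sub>\<plusminus> Omega_pow \<Omega> k (\<alpha>(a := Suc (\<alpha> a)))"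
proof (induction k)
  case (Suc k)
  show ?case
  proof (cases "a = Suc k")
    case True
    have "\<Omega> a ** Omega_pow \<Omega> k \<alpha> \<approx>\<^sub>\<plusminus> Omega_pow \<Omega> k \<alpha> ** \<Omega> a"
      using Suc.prems by (intro G_commute Omega_pow_G \<Omega>_G) auto
    then have "\<Omega> a ** Omega_pow \<Omega> k \<alpha> ** matpow (\<Omega> a) (\<alpha> a) \<approx>\<^sub>\<plusminus> Omega_pow \<Omega> k \<alpha> ** \<Omega> a ** matpow (\<Omega> a) (\<alpha> a)"
      by auto
    moreover have "Omega_pow \<Omega> k \<alpha> ** \<Omega> a ** matpow (\<Omega> a) (\<alpha> a) = Omega_pow \<Omega> k \<alpha> ** matpow (\<Omega> a) (Suc (\<alpha> a))"
      unfolding matpow_Suc_left by (simp only: matrix_mul_assoc)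
    moreover have "Omega_pow \<Omega> (Suc k) (\<alpha>(a := Suc (\<alpha> a))) = Omega_pow \<Omega> k \<alpha> ** matpow (\<Omega> a) (Suc (\<alpha> a))"
      using Omega_pow_upd_beyond[of k a \<alpha> "Suc (\<alpha> a)"] True unfolding Omega_pow.simps by simp
    moreover have "\<Omega> a ** Omega_pow \<Omega> (Suc k) \<alpha> = \<Omega> a ** Omega_pow \<Omega> k \<alpha> ** matpow (\<Omega> a) (\<alpha> a)"
      using True by (simp add: matrix_mul_assoc)
    ultimately show ?thesis by (simp only:)
  next
    case False
    then have "\<Omega> a ** Omega_pow \<Omega> k \<alpha> \<approx>\<^sub>\<plusminus> Omega_pow \<Omega> k (\<alpha>(a := Suc (\<alpha> a)))"
      by (intro Suc.IH) (use False Suc.prems in auto)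
    then have "\<Omega> a ** Omega_pow \<Omega> k \<alpha> ** matpow (\<Omega> (Suc k)) (\<alpha> (Suc k))
        \<approx>\<^sub>\<plusminus> Omega_pow \<Omega> k (\<alpha>(a := Suc (\<alpha> a))) ** matpow (\<Omega> (Suc k)) (\<alpha> (Suc k))"
      by (rule sign_mult) simp
    moreover have "Omega_pow \<Omega> (Suc k) (\<alpha>(a := Suc (\<alpha> a)))
        = Omega_pow \<Omega> k (\<alpha>(a := Suc (\<alpha> a))) ** matpow (\<Omega> (Suc k)) (\<alpha> (Suc k))"
      using False by (simp only: Omega_pow.simps fun_upd_other)
    moreover have "\<Omega> a ** Omega_pow \<Omega> (Suc k) \<alpha> = \<Omega> a ** Omega_pow \<Omega> k \<alpha> ** matpow (\<Omega> (Suc k)) (\<alpha> (Suc k))"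
      by (simp only: Omega_pow.simps matrix_mul_assoc)
    ultimately show ?thesis by (simp only:)
  qed
qed simp

lemma Omega_pow_upd_sign:
  "matpow (\<Omega> a) x \<approx>\<^sub>\<plusminus> matpow (\<Omega> a) y \<Longrightarrow> Omega_pow \<Omega> k (\<alpha>(a := x)) \<approx>\<^sub>\<plusminus> Omega_pow \<Omega> k (\<alpha>(a := y))"
proof (induction k)
  case (Suc k)
  then have "Omega_pow \<Omega> k (\<alpha>(a := x)) \<approx>\<^sub>\<plusminus> Omega_pow \<Omega> k (\<alpha>(a := y))" by blast
  moreover have "matpow (\<Omega> (Suc k)) ((\<alpha>(a := x)) (Suc k)) \<approx>\<^sub>\<plusminus> matpow (\<Omega> (Suc k)) ((\<alpha>(a := y)) (Suc k))"
    using Suc.prems by auto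
  ultimately show ?case unfolding Omega_pow.simps by (rule sign_mult)
qed simp

text \<open>The exponent wraps around because the m_a-th power is trivial up to sign; left
  multiplication by a generator thus permutes the tuples.\<close>

lemma Omega_pow_cyclic_shift:
  assumes a: "a \<in> {1..N}" and \<alpha>: "\<alpha> a < ordm a"
  shows "\<Omega> a ** Omega_pow \<Omega> N \<alpha> \<approx>\<^sub>\<plusminus> Omega_pow \<Omega> N (\<alpha>(a := Suc (\<alpha> a) mod ordm a))"
proof -
  have "matpow (\<Omega> a) (Suc (\<alpha> a)) \<approx>\<^sub>\<plusminus> matpow (\<Omega> a) (Suc (\<alpha> a) mod ordm a)"
  proof (cases "Suc (\<alpha> a) = ordm a")
    case True
    then show ?thesis using matpow_ord[OF a] by simp
  qed (use \<alpha> in auto)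
  from Omega_pow_upd_sign[OF this, of N \<alpha>] Omega_pow_shift[OF a order_refl, of \<alpha>]
  show ?thesis by (metis minus_minus)
qed

text \<open>A generator shifts one exponent cyclically and T does not see the sign. T is generalised
  because the inverse and product cases use the hypothesis for translates of T.\<close>

lemma sum_exponents_translate:
  fixes T :: "complex^'m^'m \<Rightarrow> 'b::real_vector"
  assumes "A \<in> G\<^sub>0" "\<And>A. A \<in> G\<^sub>0 \<Longrightarrow> - A \<in> G\<^sub>0 \<Longrightarrow> T (- A) = T A"
  shows "(\<Sum>\<alpha>\<in>\<Sigma>\<^sub>0 W \<Omega> N. T (A ** Omega_pow \<Omega> N \<alpha>)) = (\<Sum>\<alpha>\<in>\<Sigma>\<^sub>0 W \<Omega> N. T (Omega_pow \<Omega> N \<alpha>))"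
  using assms
proof (induction arbitrary: T rule: G_induct)
  case one
  show ?case by simp
next
  case (gen a)
  have "T (\<Omega> a ** Omega_pow \<Omega> N \<alpha>) = T (Omega_pow \<Omega> N (\<alpha>(a := Suc (\<alpha> a) mod ordm a)))"
    if "\<alpha> \<in> \<Sigma>\<^sub>0 W \<Omega> N" for \<alpha>
  proof -
    have "\<alpha> a < ordm a" using that gen(1) by (auto simp: \<Sigma>\<^sub>0_def PiE_def Pi_def)
    from Omega_pow_cyclic_shift[where \<alpha> = \<alpha>, OF gen(1) this] show ?thesis
      using gen(2)[of "Omega_pow \<Omega> N (\<alpha>(a := Suc (\<alpha> a) mod ordm a))"]
        G_mult[OF \<Omega>_G[OF gen(1)] Omega_pow_G[OF order_refl, of \<alpha>]] Omega_pow_G[OF order_refl]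
      by metis
  qed
  then have "(\<Sum>\<alpha>\<in>\<Sigma>\<^sub>0 W \<Omega> N. T (\<Omega> a ** Omega_pow \<Omega> N \<alpha>))
      = (\<Sum>\<alpha>\<in>\<Sigma>\<^sub>0 W \<Omega> N. T (Omega_pow \<Omega> N (\<alpha>(a := Suc (\<alpha> a) mod ordm a))))" by simp
  also have "\<dots> = (\<Sum>\<alpha>\<in>\<Sigma>\<^sub>0 W \<Omega> N. T (Omega_pow \<Omega> N \<alpha>))"
  \<comment> \<open>Adding \<open>ordm a - 1\<close> modulo \<open>ordm a\<close> inverts the cyclic
    successor without leaving the naturals.\<close>
  proof (rule sum.reindex_bij_witness[of _ "\<lambda>\<alpha>. \<alpha>(a := (\<alpha> a + (ordm a - 1)) mod ordm a)"
        "\<lambda>\<alpha>. \<alpha>(a := Suc (\<alpha> a) mod ordm a)"])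
    fix \<alpha> assume \<alpha>: "\<alpha> \<in> \<Sigma>\<^sub>0 W \<Omega> N"
    then have lt: "\<alpha> a < ordm a" using gen(1) by (auto simp: \<Sigma>\<^sub>0_def PiE_def Pi_def)
    show "\<alpha>(a := Suc (\<alpha> a) mod ordm a) \<in> \<Sigma>\<^sub>0 W \<Omega> N" "\<alpha>(a := (\<alpha> a + (ordm a - 1)) mod ordm a) \<in> \<Sigma>\<^sub>0 W \<Omega> N"
      using \<alpha> gen(1) ord_pos[OF gen(1)] by (auto simp: \<Sigma>\<^sub>0_def PiE_def Pi_def extensional_def)
    have "(Suc (\<alpha> a) mod ordm a + (ordm a - 1)) mod ordm a = (\<alpha> a + ordm a) mod ordm a"
      using lt by (subst mod_add_left_eq) simp
    then have 1: "(Suc (\<alpha> a) mod ordm a + (ordm a - 1)) mod ordm a = \<alpha> a" using lt by simp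
    have "Suc ((\<alpha> a + (ordm a - 1)) mod ordm a) mod ordm a = Suc (\<alpha> a + (ordm a - 1)) mod ordm a"
      by (simp add: mod_Suc_eq)
    also have "Suc (\<alpha> a + (ordm a - 1)) = \<alpha> a + ordm a" using lt by simp
    finally have 2: "Suc ((\<alpha> a + (ordm a - 1)) mod ordm a) mod ordm a = \<alpha> a" using lt by simp
    show "(\<alpha>(a := Suc (\<alpha> a) mod ordm a))(a := ((\<alpha>(a := Suc (\<alpha> a) mod ordm a)) a + (ordm a - 1)) mod ordm a) = \<alpha>"
      using 1 by simp
    show "(\<alpha>(a := (\<alpha> a + (ordm a - 1)) mod ordm a))(a := Suc ((\<alpha>(a := (\<alpha> a + (ordm a - 1)) mod ordm a)) a) mod ordm a) = \<alpha>"
      using 2 by simp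
  qed simp
  finally show ?case .
next
  case (inv A)
  have "(\<Sum>\<alpha>\<in>\<Sigma>\<^sub>0 W \<Omega> N. T (matrix_inv A ** (A ** Omega_pow \<Omega> N \<alpha>)))
      = (\<Sum>\<alpha>\<in>\<Sigma>\<^sub>0 W \<Omega> N. T (matrix_inv A ** Omega_pow \<Omega> N \<alpha>))"
  proof (rule inv.IH)
    fix B assume B: "B \<in> G\<^sub>0" "- B \<in> G\<^sub>0"
    show "T (matrix_inv A ** (- B)) = T (matrix_inv A ** B)"
      using inv.prems[of "matrix_inv A ** B"] G_mult[OF G_inv[OF inv.hyps]] B
      by (metis matrix_mult_minus_right)
  qed
  then show ?case by (simp add: matrix_mul_assoc matrix_inv_left G_invertible inv.hyps)
next
  case (mult A B)
  have "(\<Sum>\<alpha>\<in>\<Sigma>\<^sub>0 W \<Omega> N. T (A ** (B ** Omega_pow \<Omega> N \<alpha>))) = (\<Sum>\<alpha>\<in>\<Sigma>\<^sub>0 W \<Omega> N. T (A ** Omega_pow \<Omega> N \<alpha>))"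
  proof (rule mult.IH(2))
    fix C assume C: "C \<in> G\<^sub>0" "- C \<in> G\<^sub>0"
    show "T (A ** (- C)) = T (A ** C)"
      using mult.prems[of "A ** C"] G_mult[OF mult.hyps(1)] C
      by (metis matrix_mult_minus_right)
  qed
  then show ?case using mult.IH(1)[of T, OF mult.prems] by (simp add: matrix_mul_assoc)
next
  case (uminus A)
  have "T ((- A) ** Omega_pow \<Omega> N \<alpha>) = T (A ** Omega_pow \<Omega> N \<alpha>)" for \<alpha>
    using uminus.prems[of "A ** Omega_pow \<Omega> N \<alpha>"] G_mult[OF uminus.hyps(1) Omega_pow_G[OF order_refl, of \<alpha>]]
      G_mult[OF uminus.hyps(2) Omega_pow_G[OF order_refl, of \<alpha>]] by simp
  then show ?case using uminus.IH[of T, OF uminus.prems] by simp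
qed

text \<open>Averaging over translates avoids counting the fibres of \<open>\<alpha> \<mapsto> pr(\<Omega>\<^sup>\<alpha>)\<close>.\<close>

lemma sum_exponents:
  fixes T :: "complex^'m^'m \<Rightarrow> 'b::real_vector"
  assumes "\<And>A. A \<in> G\<^sub>0 \<Longrightarrow> - A \<in> G\<^sub>0 \<Longrightarrow> T (- A) = T A"
  shows "(\<Sum>\<alpha>\<in>\<Sigma>\<^sub>0 W \<Omega> N. T (Omega_pow \<Omega> N \<alpha>)) = ((\<Prod>a=1..N. ordm a) / card G\<^sub>0) *\<^sub>R (\<Sum>A\<in>G\<^sub>0. T A)"
proof -
  have card: "card (\<Sigma>\<^sub>0 W \<Omega> N) = (\<Prod>a=1..N. ordm a)" by (simp add: \<Sigma>\<^sub>0_def card_PiE)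
  have pos: "card G\<^sub>0 > 0" using fin G_one card_gt_0_iff by blast
  have "real (card G\<^sub>0) *\<^sub>R (\<Sum>\<alpha>\<in>\<Sigma>\<^sub>0 W \<Omega> N. T (Omega_pow \<Omega> N \<alpha>))
      = (\<Sum>A\<in>G\<^sub>0. \<Sum>\<alpha>\<in>\<Sigma>\<^sub>0 W \<Omega> N. T (A ** Omega_pow \<Omega> N \<alpha>))"
    using sum_exponents_translate[of _ T] assms by (simp add: sum_constant_scaleR)
  also have "\<dots> = (\<Sum>\<alpha>\<in>\<Sigma>\<^sub>0 W \<Omega> N. \<Sum>A\<in>G\<^sub>0. T (A ** Omega_pow \<Omega> N \<alpha>))" by (rule sum.swap)
  also have "\<dots> = (\<Sum>\<alpha>\<in>\<Sigma>\<^sub>0 W \<Omega> N. \<Sum>A\<in>G\<^sub>0. T A)"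
  proof (rule sum.cong)
    fix \<alpha>
    let ?B = "Omega_pow \<Omega> N \<alpha>"
    have B: "?B \<in> G\<^sub>0" by (rule Omega_pow_G) simp
    show "(\<Sum>A\<in>G\<^sub>0. T (A ** ?B)) = (\<Sum>A\<in>G\<^sub>0. T A)"
      by (rule sum.reindex_bij_witness[of _ "\<lambda>A. A ** matrix_inv ?B" "\<lambda>A. A ** ?B"])
         (auto simp: G_mult G_inv B matrix_inv_left matrix_inv_right G_invertible simp flip: matrix_mul_assoc)
  qed simp
  also have "\<dots> = real (\<Prod>a=1..N. ordm a) *\<^sub>R (\<Sum>A\<in>G\<^sub>0. T A)"
    by (simp add: sum_constant_scaleR card)
  finally have "(1 / real (card G\<^sub>0)) *\<^sub>R (real (card G\<^sub>0) *\<^sub>R (\<Sum>\<alpha>\<in>\<Sigma>\<^sub>0 W \<Omega> N. T (Omega_pow \<Omega> N \<alpha>)))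
      = (1 / real (card G\<^sub>0)) *\<^sub>R (real (\<Prod>a=1..N. ordm a) *\<^sub>R (\<Sum>A\<in>G\<^sub>0. T A))" by simp
  then show ?thesis using pos by simp
qed

end

subsection \<open>Laurent expansions at infinity\<close>

abbreviation to_fls :: "('a::comm_ring_1 fps)^'m^'n \<Rightarrow> ('a fls)^'m^'n" where
  "to_fls \<equiv> map_matrix fps_to_fls"

lemma to_fls_mult: "to_fls (A ** B) = to_fls A ** to_fls B" for A :: "('a::comm_ring_1 fps)^'m^'m"
  by (rule map_matrix_mult) (simp_all add: fls_times_fps_to_fls)

lemma to_fls_matpow: "to_fls (matpow A k) = matpow (to_fls A) k" for A :: "('a::comm_ring_1 fps)^'m^'m"
  by (induction k) (simp_all add: to_fls_mult, simp add: vec_eq_iff mat_def)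

lemma to_fls_sum: "to_fls (\<Sum>i\<in>I. f i) = (\<Sum>i\<in>I. to_fls (f i))"
  by (induction I rule: infinite_finite_induct) (simp_all add: vec_eq_iff)

lemma to_fls_mconst: "to_fls (mconst A) = map_matrix fls_const A"
  by (simp add: vec_eq_iff fls_const_def)

lemma lam_coeff_to_fls:
  "lam_coeff (mat (fls_X_inv ^ p) ** to_fls M) j = (if int p - j \<ge> 0 then mcoeff M (nat (int p - j)) else 0)"
  by (simp add: vec_eq_iff lam_coeff_def fls_X_inv_power_times_conv_shift)

lemma Res_to_fls: "Res (mat (fls_X_inv ^ p) ** to_fls M) = mcoeff M (p + 1)"
proof -
  have "nat (int p + 1) = p + 1" by simp
  then show ?thesis unfolding Res_def lam_coeff_to_fls by simp
qed

lemma plus_part_at_to_fls: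
  "plus_part_at (mat (fls_X_inv ^ p) ** to_fls M) z = (\<Sum>i\<le>p. mat (z ^ i) ** mcoeff M (p - i))"
proof -
  have coeff: "lam_coeff (mat (fls_X_inv ^ p) ** to_fls M) (int i) = (if i \<le> p then mcoeff M (p - i) else 0)" for i
    by (simp add: lam_coeff_to_fls nat_diff_distrib flip: of_nat_diff)
  show ?thesis unfolding plus_part_at_def coeff
    by (rule sum.mono_neutral_cong_left) (auto split: if_splits)
qed

text \<open>The geometric series: 1/(lambda - c) is the sum of c^n / lambda^(n+1), hence the
  constant term 0 and the shift by one.\<close>

lemma inverse_X_inv_minus_const:
  "1 / (fls_X_inv - fls_const c) = fps_to_fls (Abs_fps (case_nat 0 (\<lambda>n. c ^ n)))" for c :: complex
proof -
  let ?F = "fps_to_fls (Abs_fps (case_nat 0 (\<lambda>n. c ^ n)))"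
  have F: "fls_nth ?F k = (if k \<le> 0 then 0 else c ^ (nat k - 1))" for k
    by (auto split: nat.split)
  have "fls_nth ((fls_X_inv - fls_const c) * ?F) k = fls_nth (1 :: complex fls) k" for k
  proof -
    have "fls_nth ((fls_X_inv - fls_const c) * ?F) k = fls_nth ?F (k + 1) - c * fls_nth ?F k"
      using fls_X_inv_power_times_conv_shift(1)[of 1 ?F] by (simp add: left_diff_distrib del: fps_to_fls_nth)
    also have "\<dots> = fls_nth (1 :: complex fls) k"
    proof (cases "k > 0")
      case True
      then obtain n where "k = int (Suc n)" by (metis pos_int_cases Suc_pred)
      moreover from this have "nat (k + 1) = Suc (Suc n)" "nat k = Suc n" by simp_all
      ultimately show ?thesis unfolding F by (simp only:) simp
    qed (auto simp: F)
    finally show ?thesis .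
  qed
  then have "(fls_X_inv - fls_const c) * ?F = 1" by (simp add: fls_eq_iff del: fps_to_fls_nth)
  then show ?thesis by (metis mult_zero_left nonzero_mult_div_cancel_left one_neq_zero)
qed

section \<open>Evaluation of matrix-valued polynomials\<close>

lemma mp_eval_eq:
  assumes "degree f \<le> n"
  shows "mp_eval f X = (\<Sum>i\<le>n. map_matrix fls_const (Polynomial.coeff f i) ** matpow X i)"
  unfolding mp_eval_def
proof (rule sum.mono_neutral_left)
  show "\<forall>i\<in>{..n} - {..degree f}. map_matrix fls_const (Polynomial.coeff f i) ** matpow X i = 0"
  proof
    fix i assume "i \<in> {..n} - {..degree f}"
    then have "map_matrix fls_const (Polynomial.coeff f i) = 0"
      by (simp add: coeff_eq_0 vec_eq_iff)
    then show "map_matrix fls_const (Polynomial.coeff f i) ** matpow X i = 0" by simp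
  qed
qed (use assms in auto)

lemma coeff_mp_deriv: "Polynomial.coeff (mp_deriv F) i = real (Suc i) *\<^sub>R Polynomial.coeff F (Suc i)"
proof -
  have "Polynomial.coeff (mp_deriv F) i
     = (\<Sum>j=1..degree F. if j = Suc i then real j *\<^sub>R Polynomial.coeff F j else 0)"
    unfolding mp_deriv_def coeff_sum by (rule sum.cong) auto
  also have "\<dots> = real (Suc i) *\<^sub>R Polynomial.coeff F (Suc i)"
    by (auto simp: coeff_eq_0)
  finally show ?thesis .
qed

lemma coeff_sum_monom:
  "Polynomial.coeff (\<Sum>j=1..s. Polynomial.monom (a j) (j - 1)) i = (if i < s then a (Suc i) else 0)"
proof -
  have "Polynomial.coeff (\<Sum>j=1..s. Polynomial.monom (a j) (j - 1)) i = (\<Sum>j=1..s. if j = Suc i then a j else 0)"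
    unfolding coeff_sum by (rule sum.cong) auto
  then show ?thesis by auto
qed

lemma mp_eval_sum_monom:
  "mp_eval (\<Sum>j=1..s. Polynomial.monom (a j) (j - 1)) X = (\<Sum>j=1..s. map_matrix fls_const (a j) ** matpow X (j - 1))"
proof -
  let ?f = "\<Sum>j=1..s. Polynomial.monom (a j) (j - 1)"
  have z: "map_matrix fls_const 0 = 0" by (simp add: vec_eq_iff)
  have "degree ?f \<le> s" by (rule degree_le) (unfold coeff_sum_monom, simp)
  then have "mp_eval ?f X = (\<Sum>i\<le>s. if i < s then map_matrix fls_const (a (Suc i)) ** matpow X i else 0)"
    unfolding mp_eval_eq[OF \<open>degree ?f \<le> s\<close>] coeff_sum_monom by (intro sum.cong) (auto simp: z)
  also have "\<dots> = (\<Sum>i<s. map_matrix fls_const (a (Suc i)) ** matpow X i)"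
    by (rule sum.mono_neutral_cong_right) auto
  also have "\<dots> = (\<Sum>j=1..s. map_matrix fls_const (a j) ** matpow X (j - 1))"
    by (rule sum.reindex_bij_witness[of _ "\<lambda>k. k - 1" Suc]) auto
  finally show ?thesis .
qed

text \<open>F is given only by its formal derivative and its constant term; dividing the coefficient
  at tau^(j-1) by j recovers it.\<close>

lemma mp_eval_antiderivative:
  assumes "mp_deriv F = (\<Sum>j=1..s. Polynomial.monom (a j) (j - 1))" "Polynomial.coeff F 0 = 0"
  shows "mp_eval F X = (\<Sum>j=1..s. map_matrix fls_const ((1 / real j) *\<^sub>R a j) ** matpow X j)"
proof -
  have coeff: "Polynomial.coeff F i = (if 1 \<le> i \<and> i \<le> s then (1 / real i) *\<^sub>R a i else 0)" for i
  proof (cases i)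
    case (Suc k)
    have "real (Suc k) *\<^sub>R Polynomial.coeff F (Suc k) = (if k < s then a (Suc k) else 0)"
      unfolding coeff_mp_deriv[symmetric] assms(1) coeff_sum_monom ..
    then have "(1 / real (Suc k)) *\<^sub>R (real (Suc k) *\<^sub>R Polynomial.coeff F (Suc k))
        = (1 / real (Suc k)) *\<^sub>R (if k < s then a (Suc k) else 0)" by simp
    then show ?thesis using Suc by (auto simp del: of_nat_Suc)
  qed (simp add: assms(2))
  have z: "map_matrix fls_const 0 = 0" by (simp add: vec_eq_iff)
  have deg: "degree F \<le> s" by (rule degree_le) (simp add: coeff)
  show ?thesis unfolding mp_eval_eq[OF deg]
    by (rule sum.mono_neutral_cong_right) (auto simp: coeff z)
qed

lemma matrix_inv_uminus: "matrix_inv (- A) = - matrix_inv A" if "invertible A" for A :: "complex^'m^'m"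
  by (rule matrix_inv_unique) (simp_all add: matrix_inv_left matrix_inv_right that)

text \<open>Quantifying over a real-valued H makes the reality of the residue expression part of the
  claim.\<close>

theorem theorem7:
  fixes W :: "real^'m^'m"
    and n :: nat
    and G\<^sub>0 :: "(complex^'m^'m) set"
    and N :: nat
    and \<Omega> :: "nat \<Rightarrow> complex^'m^'m"
    and \<omega> :: "complex^'m^'m \<Rightarrow> complex"
    and l :: "'r::finite \<Rightarrow> real"
    and \<kappa> :: real
    and p :: nat
    and h :: int
    and K :: "complex^'m^'m"
    and f F :: "(complex^'m^'m) poly"
    and hh :: "nat \<Rightarrow> int"
    and \<theta> :: "nat \<Rightarrow> complex^'m^'m"
  assumes "CARD('m) = 2 * n"
    and "invertible W" and "transpose W = - W"
    and "subgroup G\<^sub>0 (Sp_group W)" and "finite G\<^sub>0"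
    and "\<And>A. A \<in> G\<^sub>0 \<Longrightarrow> conjmat A ** A = mat 1 \<or> conjmat A ** A = - mat 1"
    and "\<And>a. a \<in> {1..N} \<Longrightarrow> \<Omega> a \<in> G\<^sub>0"
    and "generate (Sp_group W Mod pmI) ((\<lambda>a. pr W (\<Omega> a)) ` {1..N}) = pr W ` G\<^sub>0"
    and "\<omega> \<in> hom ((Sp_group W)\<lparr>carrier := G\<^sub>0\<rparr>) circle_group"
    and "\<And>A. A \<in> G\<^sub>0 \<Longrightarrow> A \<in> pmI \<Longrightarrow> \<omega> A = 1"
    and "\<And>\<sigma>. l \<sigma> \<noteq> 0" and "inj (\<lambda>\<sigma>. (l \<sigma>)\<^sup>2)"
    and "\<kappa> \<noteq> 0"
    and "1 \<le> p"
    and "K \<in> \<D> W G\<^sub>0 \<omega> 1" and "diagonalizable K"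
    and "f \<in> \<F> W G\<^sub>0 \<omega> \<Omega> N p h"
    and "mp_deriv F = f" and "Polynomial.coeff F 0 = 0"
    and "\<And>k. k \<in> {1..n} \<Longrightarrow> \<theta> k \<in> \<Theta> W G\<^sub>0 \<omega> (hh k)"
    and "\<And>j k. j \<in> {1..n} \<Longrightarrow> k \<in> {1..n} \<Longrightarrow> \<theta> j ** \<theta> k - \<theta> k ** \<theta> j = 0"
    and "\<And>c :: nat \<Rightarrow> real. (\<Sum>j=1..n. c j *\<^sub>R (\<theta> j ** matpow K (2 * j - 1))) = 0
           \<Longrightarrow> \<forall>j\<in>{1..n}. c j = 0"
  shows "\<exists>H :: real^'m^'r \<Rightarrow> real.
     (\<forall>\<Phi>. complex_of_real (H \<Phi>) =
        1 / (2 * complex_of_real \<kappa> * (\<Prod>a=1..N. of_nat (ord_pr W \<Omega> a)))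
          * trace (Res (mat (fls_X_inv ^ p) ** mp_eval F (Lax W \<Omega> N \<omega> K \<kappa> l \<Phi>)))) \<and>
     (\<forall>\<Phi> \<sigma>. cvec (ham_field W H \<Phi> $ \<sigma>) =
        plus_part_at (mat (fls_X_inv ^ p) ** mp_eval f (Lax W \<Omega> N \<omega> K \<kappa> l \<Phi>))
          (complex_of_real (l \<sigma>)) *v cvec (\<Phi> $ \<sigma>)) \<and>
     liouville_integrable W H"
proof -
  interpret tg: twisted_group W G\<^sub>0 N \<Omega> \<omega>
    by (rule twisted_group.intro) (fact assms)+
  define \<mu> where "\<mu> = (\<Prod>a=1..N. ord_pr W \<Omega> a)"
  have \<mu>_pos: "\<mu> > 0" unfolding \<mu>_def using tg.ord_pos by (intro prod_pos) auto
  have card_pos: "card G\<^sub>0 > 0" using assms(5) tg.G_one card_gt_0_iff by blast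
  \<comment> \<open>Chosen so that \<open>kap * card G\<^sub>0\<close> is kappa m_1...m_N, the
    constant in the required Hamiltonian.\<close>
  define kap where "kap = \<kappa> * (\<mu> / card G\<^sub>0)"
  interpret lax_data W G\<^sub>0 \<omega> l kap K "m0 W \<Omega> N"
    by unfold_locales
      (use assms(2,3,5,11,12,13,15) \<mu>_pos card_pos in \<open>auto simp: kap_def tg.G_one tg.G_mult tg.G_inv
        tg.G_invertible tg.G_symplectic tg.G_conj tg.\<omega>_mult tg.\<omega>_norm tg.m0_pos tg.\<omega>_pow_m0\<close>)

  have Lax_eq: "Lax W \<Omega> N \<omega> K \<kappa> l \<Phi> = to_fls (L \<Phi>)" for \<Phi> :: "real^'m^'r"
  proof -
    let ?P = "\<lambda>\<sigma>. rank_one (\<Phi> $ \<sigma>) (\<Phi> $ \<sigma>)"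
    \<comment> \<open>\<open>Omega_pow \<Omega> N \<alpha>\<close> is symplectic, so A^T W = W A^-1
      turns each summand into a conjugate of a rank-one matrix.\<close>
    have term_eq: "Omega_pow \<Omega> N \<alpha> ** (columnvector (cvec (\<Phi> $ \<sigma>)) :: complex^1^'m)
          ** rowvector (cvec (\<Phi> $ \<sigma>)) ** transpose (Omega_pow \<Omega> N \<alpha>) ** cmat W
        = conj_by (Omega_pow \<Omega> N \<alpha>) (?P \<sigma>)" for \<alpha> \<sigma>
    proof -
      let ?A = "Omega_pow \<Omega> N \<alpha>"
      have A: "?A \<in> G\<^sub>0" by (rule tg.Omega_pow_G) simp
      have "transpose ?A ** cmat W = transpose ?A ** cmat W ** ?A ** matrix_inv ?A"
        by (simp add: matrix_inv_right G_invertible A flip: matrix_mul_assoc)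
      then have "transpose ?A ** cmat W = cmat W ** matrix_inv ?A"
        by (simp add: G_symplectic A)
      then show ?thesis
        unfolding conj_by_def rank_one_def columnvector_mult_rowvector[symmetric, where 'm = 'm]
        by (simp flip: matrix_mul_assoc)
    qed
    \<comment> \<open>The summands do not change under A |-> - A, so the sum over exponents becomes
      a sum over the group.\<close>
    have moment_eq: "mat (complex_of_real \<kappa>) ** (\<Sum>\<alpha>\<in>\<Sigma>\<^sub>0 W \<Omega> N. \<Sum>\<sigma>\<in>UNIV.
         mat ((omega_pow \<omega> \<Omega> N \<alpha> * complex_of_real (l \<sigma>)) ^ q) ** conj_by (Omega_pow \<Omega> N \<alpha>) (?P \<sigma>))
        = moment ?P q" for q
    proof -
      define T where "T A = (\<Sum>\<sigma>\<in>UNIV. mat ((\<omega> A * complex_of_real (l \<sigma>)) ^ q) ** conj_by A (?P \<sigma>))" for A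
      have "T (- A) = T A" if "A \<in> G\<^sub>0" "- A \<in> G\<^sub>0" for A
        using that by (simp add: T_def tg.\<omega>_uminus conj_by_def matrix_inv_uminus G_invertible)
      from tg.sum_exponents[of T, OF this]
      have "(\<Sum>\<alpha>\<in>\<Sigma>\<^sub>0 W \<Omega> N. T (Omega_pow \<Omega> N \<alpha>)) = (\<mu> / card G\<^sub>0) *\<^sub>R (\<Sum>A\<in>G\<^sub>0. T A)"
        by (simp add: \<mu>_def)
      then show ?thesis
        unfolding moment_def by (simp add: T_def tg.omega_pow_eq kap_def scaleR_conv_mat_mult)
    qed
    have "fls_nth (Lax W \<Omega> N \<omega> K \<kappa> l \<Phi> $ i $ j) k = fls_nth (to_fls (L \<Phi>) $ i $ j) k" for i j k
    proof -
      let ?c = "\<lambda>\<alpha> \<sigma>. omega_pow \<omega> \<Omega> N \<alpha> * complex_of_real (l \<sigma>)"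
      let ?X = "\<lambda>\<alpha> \<sigma>. conj_by (Omega_pow \<Omega> N \<alpha>) (?P \<sigma>) $ i $ j"
      have "fls_nth (Lax W \<Omega> N \<omega> K \<kappa> l \<Phi> $ i $ j) k
        = fls_nth (fls_const (K $ i $ j)) k + \<kappa> * (\<Sum>\<alpha>\<in>\<Sigma>\<^sub>0 W \<Omega> N. \<Sum>\<sigma>\<in>UNIV.
            fls_nth (fps_to_fls (Abs_fps (case_nat 0 (\<lambda>n. ?c \<alpha> \<sigma> ^ n)))) k * ?X \<alpha> \<sigma>)"
        unfolding Lax_def term_eq inverse_X_inv_minus_const
        by (simp add: fls_nth_sum del: fps_to_fls_nth)
      also have "\<dots> = fls_nth (fps_to_fls (L \<Phi> $ i $ j)) k"
      \<comment> \<open>Index 0 carries K, and index q + 1 the moment of order q.\<close>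
      proof (cases "k \<le> 0")
        case True
        have "fps_nth (L \<Phi> $ i $ j) 0 = K $ i $ j" using mcoeff_L(1)[of \<Phi>] by (metis mcoeff_nth)
        then show ?thesis using True by (cases "k = 0") auto
      next
        case False
        define q where "q = nat k - 1"
        have q: "nat k = Suc q" "\<not> k < 0" "k \<noteq> 0" using False by (auto simp: q_def)
        have "fps_nth (L \<Phi> $ i $ j) (Suc q) = moment ?P q $ i $ j"
          using mcoeff_L(2)[of \<Phi> q] by (metis mcoeff_nth)
        then show ?thesis using q moment_eq[of q, symmetric] by simp
      qed
      finally show ?thesis by simp
    qed
    then show ?thesis by (simp add: vec_eq_iff fls_eq_iff)
  qed

  obtain s \<theta>f c where s: "\<theta>f \<in> \<Theta> W G\<^sub>0 \<omega> h"
    and c: "\<And>j. j \<in> {1..s} \<Longrightarrow> c (s - j) \<noteq> (0::real) \<Longrightarrow> even j \<and> [h + int j = int p + 1] (mod int (m0 W \<Omega> N))"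
    and f: "f = (\<Sum>j=1..s. Polynomial.monom (c (s - j) *\<^sub>R \<theta>f) (j - 1))"
    using assms(17) unfolding \<F>_def by blast
  define b where "b j = c (s - j)" for j
  have adm: "admissible p h s b" using c by (auto simp: admissible_def b_def)

  have fconst: "map_matrix fls_const (r *\<^sub>R \<theta>f) ** matpow (to_fls A) k
      = to_fls (mat (fps_const (complex_of_real r)) ** (mconst \<theta>f ** matpow A k))" for r k and A :: "(complex fps)^'m^'m"
    unfolding scaleR_conv_mat_mult to_fls_matpow[symmetric] to_fls_mconst[symmetric] to_fls_mult[symmetric]
    by (simp only: mat_fps_const mconst_mult matrix_mul_assoc)
  have eval_f: "mp_eval f (to_fls A) = to_fls (\<Sum>j=1..s. mat (fps_const (complex_of_real (b j))) ** (mconst \<theta>f ** matpow A (j - 1)))" for A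
    unfolding f mp_eval_sum_monom to_fls_sum b_def by (rule sum.cong) (simp_all add: fconst)
  have eval_F: "mp_eval F (to_fls A) = to_fls (\<Sum>j=1..s. mat (fps_const (complex_of_real (b j / j))) ** (mconst \<theta>f ** matpow A j))" for A
    unfolding mp_eval_antiderivative[OF assms(18)[unfolded f] assms(19)] to_fls_sum scaleR_scaleR fconst b_def
    by (rule sum.cong) simp_all

  let ?H = "hamiltonian \<theta>f p s b :: real^'m^'r \<Rightarrow> real"
  show ?thesis
  proof (intro exI[of _ ?H] conjI allI)
    fix \<Phi> :: "real^'m^'r"
    have "trace (Res (mat (fls_X_inv ^ p) ** mp_eval F (Lax W \<Omega> N \<omega> K \<kappa> l \<Phi>)))
        = (\<Sum>j=1..s. complex_of_real (b j) / of_nat j * trace (mcoeff (mconst \<theta>f ** matpow (L \<Phi>) j) (p + 1)))"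
      unfolding Lax_eq eval_F Res_to_fls by (simp add: mcoeff_sum trace_sum mcoeff_const_mult trace_mat_mult)
    moreover have "2 * complex_of_real kap * of_nat (card G\<^sub>0) = 2 * complex_of_real \<kappa> * (\<Prod>a=1..N. of_nat (ord_pr W \<Omega> a))"
      using card_pos by (simp add: kap_def \<mu>_def)
    ultimately show "complex_of_real (?H \<Phi>) = 1 / (2 * complex_of_real \<kappa> * (\<Prod>a=1..N. of_nat (ord_pr W \<Omega> a)))
          * trace (Res (mat (fls_X_inv ^ p) ** mp_eval F (Lax W \<Omega> N \<omega> K \<kappa> l \<Phi>)))"
      unfolding of_real_hamiltonian[OF s adm] complex_hamiltonian_def by simp
  next
    fix \<Phi> :: "real^'m^'r" and \<sigma>
    show "cvec (ham_field W ?H \<Phi> $ \<sigma>) =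
        plus_part_at (mat (fls_X_inv ^ p) ** mp_eval f (Lax W \<Omega> N \<omega> K \<kappa> l \<Phi>))
          (complex_of_real (l \<sigma>)) *v cvec (\<Phi> $ \<sigma>)"
      unfolding cvec_ham_field[OF s adm] Lax_eq eval_f plus_part_at_to_fls plus_def M_def ..
  next
    show "liouville_integrable W ?H"
      using assms(1,16) s adm assms(20) _ assms(22)
      by (rule liouville_integrable_hamiltonian) (use assms(21) in auto)
  qed
qed

end
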